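(* Fix $\mu\in\mathbb{R}^{m+q}$, $s\in\mathcal{S}$, $\rho>0$, and $z^{(0)}\in\mathcal{Z}$. Let $(z^{(l)})_{l\ge0}$ be generated by infinitely many successive primal sweeps on $L_\rho(\cdot,\mu,s)$. Then $(z^{(l)})$ converges to a point $z^\infty\in\mathcal{Z}$ which is a critical point of $L_\rho(\cdot,\mu,s)+\iota_{\mathcal{Z}}$, i.e. $0\in\nabla_zL_\rho(z^\infty,\mu,s)+\mathcal{N}_{\mathcal{Z}}(z^\infty)$.
   Context: Setting: $P\ge1$, $z=(z_1,\dots,z_P)\in\mathbb{R}^{n_z}$, $z_i\in\mathbb{R}^{n_i}$, $n_z\ge2$; each $\mathcal{Z}_i\subset\mathbb{R}^{n_i}$ a nonempty bounded box, $\mathcal{Z}=\mathcal{Z}_1\times\cdots\times\mathcal{Z}_P$; $J(z)=\sum_iJ_i(z_i)$ with polynomials $J_i$ of degree $\ge2$; polynomial maps $Q_c:\mathbb{R}^{n_z}\to\mathbb{R}^m$, $g_i:\mathbb{R}^{n_i}\to\mathbb{R}^{q_i}$; matrices $T_i\in\mathbb{R}^{q_i\times p}$; $q=\sum q_i$; $\mathcal{S}\subseteq\mathbb{R}^p$; $G(z,s)=(Q_c(z),g_1(z_1)+T_1s,\dots,g_P(z_P)+T_Ps)$. Augmented Lagrangian: $L_\rho(z,\mu,s)=J(z)+\big(\mu+\tfrac{\rho}{2}G(z,s)\big)^\top G(z,s)$. $\iota_{\mathcal{Z}}$ is the indicator of $\mathcal{Z}$; $\mathcal{N}_{\mathcal{Z}}$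 its normal cone; $\pi_{\mathcal{Z}_i}$ the Euclidean projection onto $\mathcal{Z}_i$. Primal sweep on $f=L_\rho(\cdot,\mu,s)$: fix $\alpha_i>0$, $\beta>1$ and $c_i^0>0$. Given $z^{(l)}\in\mathcal{Z}$, for $i=1,\dots,P$ in order, let $f^{(i,l)}(x):=f(z_1^{(l+1)},\dots,z_{i-1}^{(l+1)},x,z_{i+1}^{(l)},\dots,z_P^{(l)})$, set $c_i:=c_i^0$ and repeat: compute $u:=\pi_{\mathcal{Z}_i}\big(z_i^{(l)}-\tfrac1{c_i}\nabla f^{(i,l)}(z_i^{(l)})\big)$; if $f^{(i,l)}(u)+\tfrac{\alpha_i}{2}\|u-z_i^{(l)}\|^2\le f^{(i,l)}(z_i^{(l)})+\nabla f^{(i,l)}(z_i^{(l)})^\top(u-z_i^{(l)})+\tfrac{c_i}{2}\|u-z_i^{(l)}\|^2$ stop and set $z_i^{(l+1)}:=u$, otherwise set $c_i:=\beta c_i$ and repeat. The sweep outputs $z^{(l+1)}$. *)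

theory Defs
  imports "HOL-Analysis.Analysis"
begin

inductive poly_deg_le :: "nat \<Rightarrow> (real^'n \<Rightarrow> real) \<Rightarrow> bool" where
  pconst: "poly_deg_le d (\<lambda>x. c)"
| pvar: "1 \<le> d \<Longrightarrow> poly_deg_le d (\<lambda>x. x $ j)"
| padd: "poly_deg_le d f \<Longrightarrow> poly_deg_le d g \<Longrightarrow> poly_deg_le d (\<lambda>x. f x + g x)"
| pmul: "poly_deg_le d1 f \<Longrightarrow> poly_deg_le d2 g \<Longrightarrow> poly_deg_le (d1 + d2) (\<lambda>x. f x * g x)"
| pmono: "poly_deg_le d f \<Longrightarrow> d \<le> e \<Longrightarrow> poly_deg_le e f"

definition polyfun :: "(real^'n \<Rightarrow> real) \<Rightarrow> bool" where
  "polyfun f \<longleftrightarrow> (\<exists>d. poly_deg_le d f)"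

definition poly_deg_ge2 :: "(real^'n \<Rightarrow> real) \<Rightarrow> bool" where
  "poly_deg_ge2 f \<longleftrightarrow> polyfun f \<and> \<not> poly_deg_le 1 f"

definition dep_block :: "('n \<Rightarrow> nat) \<Rightarrow> nat \<Rightarrow> (real^'n \<Rightarrow> real) \<Rightarrow> bool" where
  "dep_block blk i f \<longleftrightarrow> (\<forall>x y. (\<forall>j. blk j = i \<longrightarrow> x $ j = y $ j) \<longrightarrow> f x = f y)"

definition upd_blk :: "('n \<Rightarrow> nat) \<Rightarrow> nat \<Rightarrow> real^'n \<Rightarrow> real^'n \<Rightarrow> real^'n" where
  "upd_blk blk i w x = (\<chi> j. if blk j = i then x $ j else w $ j)"

definition aug_lag ::
  "nat \<Rightarrow> nat \<Rightarrow> (nat \<Rightarrow> nat) \<Rightarrow> (nat \<Rightarrow> real^'n \<Rightarrow> real) \<Rightarrow> (nat \<Rightarrow> real^'n \<Rightarrow> real)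
   \<Rightarrow> (nat \<Rightarrow> nat \<Rightarrow> real^'n \<Rightarrow> real) \<Rightarrow> (nat \<Rightarrow> nat \<Rightarrow> real^'p)
   \<Rightarrow> real \<Rightarrow> (nat \<Rightarrow> real) \<Rightarrow> (nat \<Rightarrow> nat \<Rightarrow> real) \<Rightarrow> real^'p \<Rightarrow> real^'n \<Rightarrow> real" where
  "aug_lag P m q J Q g T rho muQ mug s z =
     (\<Sum>i<P. J i z)
     + (\<Sum>k<m. (muQ k + rho / 2 * Q k z) * Q k z)
     + (\<Sum>i<P. \<Sum>r<q i. (mug i r + rho / 2 * (g i r z + T i r \<bullet> s)) * (g i r z + T i r \<bullet> s))"

definition block_step ::
  "(real^'n \<Rightarrow> real) \<Rightarrow> (real^'n) set \<Rightarrow> ('n \<Rightarrow> nat) \<Rightarrow> real \<Rightarrow> real \<Rightarrow> real \<Rightarrow> nat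
   \<Rightarrow> real^'n \<Rightarrow> real^'n \<Rightarrow> bool" where
  "block_step f Z blk alpha beta c0 i w w' \<longleftrightarrow>
     (\<exists>D. GDERIV (\<lambda>x. f (upd_blk blk i w x)) w :> D \<and>
        (let cand = (\<lambda>c. upd_blk blk i w (closest_point Z (w - (1 / c) *\<^sub>R D)));
             ok = (\<lambda>c. f (cand c) + alpha / 2 * (norm (cand c - w))\<^sup>2
                        \<le> f w + D \<bullet> (cand c - w) + c / 2 * (norm (cand c - w))\<^sup>2)
         in \<exists>k::nat. ok (beta ^ k * c0) \<and> (\<forall>k'<k. \<not> ok (beta ^ k' * c0))
                    \<and> w' = cand (beta ^ k * c0)))"

definition primal_sweep ::
  "(real^'n \<Rightarrow> real) \<Rightarrow> (real^'n) set \<Rightarrow> ('n \<Rightarrow> nat) \<Rightarrow> nat \<Rightarrow> (nat \<Rightarrow> real) \<Rightarrow> real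
   \<Rightarrow> (nat \<Rightarrow> real) \<Rightarrow> real^'n \<Rightarrow> real^'n \<Rightarrow> bool" where
  "primal_sweep f Z blk P alpha beta c0 z z' \<longleftrightarrow>
     (\<exists>w :: nat \<Rightarrow> real^'n. w 0 = z
        \<and> (\<forall>i<P. block_step f Z blk (alpha i) beta (c0 i) i (w i) (w (Suc i)))
        \<and> z' = w P)"

definition normal_cone :: "'a::real_inner set \<Rightarrow> 'a \<Rightarrow> 'a set" where
  "normal_cone Z x = {v. x \<in> Z \<and> (\<forall>y\<in>Z. v \<bullet> (y - x) \<le> 0)}"

end

theory Submission
  imports Defs "HOL-Computational_Algebra.Polynomial_Factorial"
    "HOL-Computational_Algebra.Field_as_Ring" "HOL-Library.Function_Algebras"
    "HOL-Real_Asymp.Real_Asymp"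
begin

text \<open>
  The objective is a polynomial \<open>f\<close>. Each sweep decreases it by a multiple of the squared step
  length and ends at a point that is stationary up to a multiple of the step length. Such a sequence
  has finite length, hence converges, as soon as \<open>f\<close> satisfies a Lojasiewicz inequality on the box:
  for \<open>f x\<close> slightly above a value \<open>v\<close>,
  \<open>(f x - v)\<^sup>2\<^sup>-\<^sup>\<delta> \<le> h x\<close>, where \<open>h x = \<Sum>j. (x\<^sub>j - a\<^sub>j) (b\<^sub>j - x\<^sub>j) (\<partial>\<^sub>j f x)\<^sup>2\<close>.
  The weights remove the need to treat the faces of the box separately: on the cube, \<open>h\<close> is the
  squared gradient after the substitution \<open>x\<^sub>j = cos t\<^sub>j\<close>.

  The inequality is proved without quantifier elimination. On a level \<open>f = r\<close> a minimizer of \<open>h\<close>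
  is obtained as a limit of minimizers of penalty functions whose critical equations have the form
  \<open>e\<^sup>2 x\<^sub>j\<^sup>M = lower order\<close>; linear algebra over the ring of polynomials in \<open>(r, e)\<close> eliminates all
  other variables, and after division by a power of \<open>e\<close> the limit \<open>e \<longlonglongrightarrow> 0\<close> shows that every
  coordinate of the minimizer is a root of a fixed bivariate polynomial at \<open>r\<close>. Hence the minimizers
  lie on finitely many curves with continuous monotone coordinates, so in the variable \<open>t\<close> on curves
  of finite length. Since \<open>f\<close> grows with unit speed along them, \<open>h \<le> C r\<^sup>2\<close> would force infinite
  length; and \<open>h\<close>, being algebraic over \<open>r\<close>, then exceeds some \<open>r\<^sup>2\<^sup>-\<^sup>\<delta>\<close>.
\<close>

section \<open>Gradients and polynomial functions\<close>

lemma GDERIV_vec_nth: "GDERIV (\<lambda>x. x $ j) x :> axis j 1"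
  unfolding gderiv_def
  by (simp add: inner_axis bounded_linear_imp_has_derivative[OF bounded_linear_vec_nth])

lemma GDERIV_sum:
  assumes "\<And>a. a \<in> A \<Longrightarrow> GDERIV (f a) x :> D a"
  shows "GDERIV (\<lambda>x. \<Sum>a\<in>A. f a x) x :> (\<Sum>a\<in>A. D a)"
  using assms
  by (induction A rule: infinite_finite_induct) (auto intro: GDERIV_const GDERIV_add)

lemma GDERIV_continuous_on:
  assumes "\<And>x. GDERIV f x :> D x"
  shows "continuous_on S f"
  using assms unfolding gderiv_def
  by (meson continuous_at_imp_continuous_on has_derivative_continuous)

lemma GDERIV_global_min:
  assumes "GDERIV f x :> D" "\<And>y. f x \<le> f y"
  shows "D = 0"
proof -
  have "(\<lambda>h. h \<bullet> D) = (\<lambda>h. 0)"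
    by (rule has_derivative_local_min[OF assms(1)[unfolded gderiv_def]]) (simp add: assms(2))
  from fun_cong[OF this, of D] show ?thesis by simp
qed

lemma GDERIV_coordinatewise:
  fixes f :: "real^'n \<Rightarrow> real"
  assumes \<phi>: "\<And>j. (\<phi> j has_real_derivative \<phi>' j) (at (x $ j))"
    and f: "GDERIV f (\<chi> j. \<phi> j (x $ j)) :> D"
  shows "GDERIV (\<lambda>x. f (\<chi> j. \<phi> j (x $ j))) x :> (\<chi> j. \<phi>' j * D $ j)"
proof -
  have "((\<lambda>x. \<chi> j. \<phi> j (x $ j)) has_derivative (\<lambda>h. \<chi> j. \<phi>' j * h $ j)) (at x)"
  proof (subst has_derivative_componentwise_within, intro ballI)
    fix i :: "real^'n" assume "i \<in> Basis"
    then obtain j where i: "i = axis j 1" by (auto simp: Basis_vec_def)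
    have "((\<lambda>x::real^'n. x $ j) has_derivative (\<lambda>h. h $ j)) (at x)"
      by (rule bounded_linear_imp_has_derivative[OF bounded_linear_vec_nth])
    from has_derivative_compose[OF this \<phi>[unfolded has_field_derivative_def]]
    show "((\<lambda>x. (\<chi> j. \<phi> j (x $ j)) \<bullet> i) has_derivative (\<lambda>h. (\<chi> j. \<phi>' j * h $ j) \<bullet> i)) (at x)"
      by (simp add: i inner_axis)
  qed
  from has_derivative_compose[OF this f[unfolded gderiv_def]]
  have "((\<lambda>x. f (\<chi> j. \<phi> j (x $ j))) has_derivative (\<lambda>h. (\<chi> j. \<phi>' j * h $ j) \<bullet> D)) (at x)" .
  also have "(\<lambda>h. (\<chi> j. \<phi>' j * h $ j) \<bullet> D) = (\<lambda>h. h \<bullet> (\<chi> j. \<phi>' j * D $ j))"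
    by (simp add: fun_eq_iff inner_vec_def mult_ac)
  finally show ?thesis by (simp add: gderiv_def)
qed

lemma GDERIV_eventually_norm_diff_le:
  assumes "GDERIV f x :> D" "norm D < C"
  shows "\<forall>\<^sub>F y in nhds x. \<bar>f y - f x\<bar> \<le> C * norm (y - x)"
proof -
  have "C - norm D > 0" using assms(2) by simp
  then obtain d where d: "d > 0"
    and approx: "\<And>y. norm (y - x) < d \<Longrightarrow>
      norm (f y - f x - (y - x) \<bullet> D) \<le> (C - norm D) * norm (y - x)"
    using assms(1) unfolding gderiv_def has_derivative_at_alt by blast
  have "\<bar>f y - f x\<bar> \<le> C * norm (y - x)" if "norm (y - x) < d" for y
  proof -
    have "\<bar>f y - f x\<bar> \<le> \<bar>(y - x) \<bullet> D\<bar> + (C - norm D) * norm (y - x)"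
      using approx[OF that] by simp
    also have "\<dots> \<le> norm (y - x) * norm D + (C - norm D) * norm (y - x)"
      by (intro add_right_mono Cauchy_Schwarz_ineq2)
    finally show ?thesis by (simp add: algebra_simps)
  qed
  with d show ?thesis unfolding eventually_nhds_metric dist_norm by blast
qed

lemma GDERIV_lipschitz_descent:
  assumes D: "\<And>x. x \<in> S \<Longrightarrow> GDERIV f x :> D x" and lipschitz: "L-lipschitz_on S D"
    and S: "convex S" "x \<in> S" "y \<in> S"
  shows "f y \<le> f x + D x \<bullet> (y - x) + L * (norm (y - x))\<^sup>2"
proof -
  define p where "p t = x + t *\<^sub>R (y - x)" for t
  have p_S: "p t \<in> S" if "0 \<le> t" "t \<le> 1" for t
    using convexD_alt[OF S that] by (simp add: p_def algebra_simps)
  have "((\<lambda>t. f (p t)) has_real_derivative (y - x) \<bullet> D (p t)) (at t)" if "0 \<le> t" "t \<le> 1" for t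
  proof -
    have "(p has_derivative (\<lambda>h. h *\<^sub>R (y - x))) (at t)"
      unfolding p_def by (auto intro!: derivative_eq_intros)
    from has_derivative_compose[OF this D[OF p_S[OF that], unfolded gderiv_def]] show ?thesis
      unfolding has_field_derivative_def by (simp add: mult_commute_abs)
  qed
  then obtain t where t: "0 < t" "t < 1" and mvt: "f (p 1) - f (p 0) = (y - x) \<bullet> D (p t)"
    using MVT2[of 0 1 "\<lambda>t. f (p t)" "\<lambda>t. (y - x) \<bullet> D (p t)"] by auto
  have "norm (D (p t) - D x) \<le> L * norm (p t - x)"
    using lipschitz_on_normD[OF lipschitz p_S S(2)] t by simp
  also have "\<dots> \<le> L * norm (y - x)"
    using t lipschitz_on_nonneg[OF lipschitz]
    by (intro mult_left_mono) (auto simp: p_def mult_left_le_one_le)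
  finally have "norm (D (p t) - D x) * norm (y - x) \<le> L * norm (y - x) * norm (y - x)"
    by (intro mult_right_mono) auto
  moreover have "f y - f x = D x \<bullet> (y - x) + (D (p t) - D x) \<bullet> (y - x)"
    using mvt by (simp add: p_def inner_diff_left inner_diff_right inner_commute)
  ultimately show ?thesis
    using norm_cauchy_schwarz[of "D (p t) - D x" "y - x"] by (simp add: power2_eq_square mult.assoc)
qed

lemma polyfun_const [intro]: "polyfun (\<lambda>x. c)"
  and polyfun_vec_nth [intro]: "polyfun (\<lambda>x. x $ j)"
  unfolding polyfun_def by (blast intro: poly_deg_le.intros)+

lemma polyfun_add [intro]:
  assumes "polyfun f" "polyfun g"
  shows "polyfun (\<lambda>x. f x + g x)"
proof -
  obtain d e where "poly_deg_le d f" "poly_deg_le e g" using assms by (auto simp: polyfun_def)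
  then have "poly_deg_le (d + e) f" "poly_deg_le (d + e) g" by (auto intro: pmono)
  from padd[OF this] show ?thesis by (auto simp: polyfun_def)
qed

lemma polyfun_mult [intro]: "polyfun f \<Longrightarrow> polyfun g \<Longrightarrow> polyfun (\<lambda>x. f x * g x)"
  unfolding polyfun_def by (blast intro: poly_deg_le.intros)

lemma polyfun_diff [intro]:
  assumes "polyfun f" "polyfun g"
  shows "polyfun (\<lambda>x. f x - g x)"
  using polyfun_add[OF assms(1) polyfun_mult[OF polyfun_const[of "-1"] assms(2)]] by simp

lemma polyfun_power [intro]: "polyfun f \<Longrightarrow> polyfun (\<lambda>x. f x ^ k)"
  by (induction k) auto

lemma polyfun_sum [intro]: "(\<And>a. a \<in> A \<Longrightarrow> polyfun (f a)) \<Longrightarrow> polyfun (\<lambda>x. \<Sum>a\<in>A. f a x)"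
  by (induction A rule: infinite_finite_induct) auto

lemma polyfun_induct [consumes 1, case_names const var add mult]:
  assumes "polyfun f"
    and "\<And>c. Q (\<lambda>x. c)" and "\<And>j. Q (\<lambda>x. x $ j)"
    and "\<And>f g. polyfun f \<Longrightarrow> polyfun g \<Longrightarrow> Q f \<Longrightarrow> Q g \<Longrightarrow> Q (\<lambda>x. f x + g x)"
    and "\<And>f g. polyfun f \<Longrightarrow> polyfun g \<Longrightarrow> Q f \<Longrightarrow> Q g \<Longrightarrow> Q (\<lambda>x. f x * g x)"
  shows "Q f"
proof -
  obtain d where "poly_deg_le d f" using assms(1) by (auto simp: polyfun_def)
  then show ?thesis
  proof (induction rule: poly_deg_le.induct)
    case (padd d f g)
    then show ?case by (intro assms(4)) (auto simp: polyfun_def)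
  next
    case (pmul d1 f d2 g)
    then show ?case by (intro assms(5)) (auto simp: polyfun_def)
  qed (use assms(2,3) in auto)
qed

lemma polyfun_compose:
  assumes "polyfun f" "\<And>j. polyfun (\<lambda>x. g x $ j)"
  shows "polyfun (\<lambda>x. f (g x))"
  using assms(1) by (induction rule: polyfun_induct) (auto intro: assms(2))

lemma polyfun_GDERIV:
  fixes f :: "real^'n \<Rightarrow> real"
  assumes "polyfun f"
  shows "\<exists>D. (\<forall>x. GDERIV f x :> D x) \<and> (\<forall>j. polyfun (\<lambda>x. D x $ j))"
  using assms
proof (induction rule: polyfun_induct)
  case (const c)
  show ?case by (rule exI[of _ "\<lambda>x. 0"]) (auto intro: GDERIV_const)
next
  case (var j)
  show ?case by (rule exI[of _ "\<lambda>x. axis j 1"]) (auto intro: GDERIV_vec_nth)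
next
  case (add f g)
  then obtain Df Dg where "\<forall>x. GDERIV f x :> Df x" "\<forall>j. polyfun (\<lambda>x. Df x $ j)"
    "\<forall>x. GDERIV g x :> Dg x" "\<forall>j. polyfun (\<lambda>x. Dg x $ j)" by blast
  then show ?case by (intro exI[of _ "\<lambda>x. Df x + Dg x"]) (auto intro: GDERIV_add)
next
  case (mult f g)
  then obtain Df Dg where "\<forall>x. GDERIV f x :> Df x" "\<forall>j. polyfun (\<lambda>x. Df x $ j)"
    "\<forall>x. GDERIV g x :> Dg x" "\<forall>j. polyfun (\<lambda>x. Dg x $ j)" by blast
  with mult show ?case
    by (intro exI[of _ "\<lambda>x. f x *\<^sub>R Dg x + g x *\<^sub>R Df x"])
      (auto intro!: GDERIV_mult polyfun_add polyfun_mult)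
qed

lemma continuous_on_polyfun: "polyfun f \<Longrightarrow> continuous_on S f"
  using polyfun_GDERIV GDERIV_continuous_on by metis

lemma continuous_on_polyfun_compose:
  "polyfun f \<Longrightarrow> continuous_on S g \<Longrightarrow> continuous_on S (\<lambda>x. f (g x))"
  using continuous_on_compose2[OF continuous_on_polyfun[of f UNIV]] by auto

lemma tendsto_polyfun:
  "polyfun f \<Longrightarrow> (g \<longlongrightarrow> l) F \<Longrightarrow> ((\<lambda>x. f (g x)) \<longlongrightarrow> f l) F"
  using continuous_on_polyfun[of f UNIV] continuous_on_tendsto_compose[of UNIV f g l F] by auto

lemma polyfun_lipschitz_on_bounded:
  fixes S :: "(real^'n) set"
  assumes "polyfun f" "bounded S"
  shows "\<exists>L. L-lipschitz_on S f"
proof -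
  obtain r where r: "S \<subseteq> cball 0 r"
    using bounded_subset_ballD[OF assms(2)] by (meson ball_subset_cball order_trans)
  obtain D where D: "\<And>x. GDERIV f x :> D x" "\<And>j. polyfun (\<lambda>x. D x $ j)"
    using polyfun_GDERIV[OF assms(1)] by blast
  have "continuous_on (cball 0 r) (\<lambda>x. \<chi> j. D x $ j)"
    by (intro continuous_on_vec_lambda continuous_on_polyfun D(2))
  then have "bounded (D ` cball 0 r)"
    by (intro compact_imp_bounded compact_continuous_image compact_cball) simp
  then obtain B where B: "B > 0" "\<And>x. x \<in> cball 0 r \<Longrightarrow> norm (D x) \<le> B"
    unfolding bounded_pos by blast
  have "B-lipschitz_on (cball 0 r) f"
  proof (rule bounded_derivative_imp_lipschitz)
    fix x :: "real^'n" assume x: "x \<in> cball 0 r"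
    show "(f has_derivative (\<lambda>h. h \<bullet> D x)) (at x within cball 0 r)"
      using D(1) unfolding gderiv_def by (rule has_derivative_at_withinI)
    show "onorm (\<lambda>h. h \<bullet> D x) \<le> B"
    proof (rule onorm_le)
      fix h
      have "norm (h \<bullet> D x) \<le> norm h * norm (D x)" by (simp add: Cauchy_Schwarz_ineq2)
      also have "\<dots> \<le> B * norm h"
        using B(2)[OF x] by (subst mult.commute) (intro mult_right_mono, auto)
      finally show "norm (h \<bullet> D x) \<le> B * norm h" .
    qed
  qed (use B in auto)
  with r show ?thesis by (meson lipschitz_on_subset)
qed

lemma polyfun_vec_lipschitz_on_bounded:
  fixes D :: "real^'n \<Rightarrow> real^'m"
  assumes "\<And>j. polyfun (\<lambda>x. D x $ j)" "bounded S"
  shows "\<exists>L. L-lipschitz_on S D"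
proof -
  have "\<forall>j. \<exists>L. L-lipschitz_on S (\<lambda>x. D x $ j)"
    using polyfun_lipschitz_on_bounded[OF assms] by blast
  then obtain L where L: "\<And>j. (L j)-lipschitz_on S (\<lambda>x. D x $ j)" by metis
  have "(\<Sum>j\<in>UNIV. L j)-lipschitz_on S D"
  proof (rule lipschitz_onI)
    fix x y assume xy: "x \<in> S" "y \<in> S"
    have "dist (D x) (D y) \<le> (\<Sum>j\<in>UNIV. \<bar>(D x - D y) $ j\<bar>)"
      unfolding dist_norm by (rule norm_le_l1_cart)
    also have "\<dots> \<le> (\<Sum>j\<in>UNIV. L j * dist x y)"
      using lipschitz_onD[OF L xy] by (intro sum_mono) (simp add: dist_real_def)
    finally show "dist (D x) (D y) \<le> (\<Sum>j\<in>UNIV. L j) * dist x y" by (simp add: sum_distrib_right)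
  qed (use lipschitz_on_nonneg[OF L] in \<open>auto intro: sum_nonneg\<close>)
  then show ?thesis by blast
qed

lemma polyfun_uniform_degree:
  assumes "finite A" "\<And>f. f \<in> A \<Longrightarrow> polyfun f"
  shows "\<exists>d. \<forall>f\<in>A. poly_deg_le d f"
proof -
  obtain d where d: "\<And>f. f \<in> A \<Longrightarrow> poly_deg_le (d f) f"
    using assms(2) unfolding polyfun_def by metis
  have "poly_deg_le (\<Sum>f\<in>A. d f) f" if "f \<in> A" for f
    using pmono[OF d[OF that]] member_le_sum[OF that, of d] assms(1) by auto
  then show ?thesis by blast
qed

section \<open>Elimination\<close>

lemma sum_fun_apply: "(\<Sum>a\<in>A. f a) x = (\<Sum>a\<in>A. f a x)"
  by (induction A rule: infinite_finite_induct) auto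

lemma sum_pivot_elimination:
  fixes c :: "'k \<Rightarrow> 'a \<Rightarrow> 'c::comm_ring" and d :: "'k \<Rightarrow> 'c" and a :: 'a
  assumes "finite K" "p \<in> K"
  defines "e \<equiv> (\<lambda>k. c p a * d k)(p := - (\<Sum>k\<in>K - {p}. d k * c k a))"
  shows "(\<Sum>k\<in>K. e k * c k x) = (\<Sum>k\<in>K - {p}. d k * (c p a * c k x - c k a * c p x))"
proof -
  have "(\<Sum>k\<in>K. e k * c k x) = e p * c p x + (\<Sum>k\<in>K - {p}. e k * c k x)"
    using assms(1,2) by (simp add: sum.remove)
  also have "(\<Sum>k\<in>K - {p}. e k * c k x) = (\<Sum>k\<in>K - {p}. c p a * d k * c k x)"
    by (rule sum.cong) (auto simp: e_def)
  finally show ?thesis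
    by (simp add: e_def sum_distrib_left sum_distrib_right sum_subtractf algebra_simps)
qed

lemma homogeneous_system_nontrivial_solution:
  fixes c :: "'k \<Rightarrow> 'a \<Rightarrow> 'c::idom"
  assumes "finite A" "finite K" "card A < card K"
  shows "\<exists>d. (\<exists>k\<in>K. d k \<noteq> 0) \<and> (\<forall>a\<in>A. (\<Sum>k\<in>K. d k * c k a) = 0)"
  using assms
proof (induction A arbitrary: K c rule: finite_induct)
  case empty
  then show ?case by (intro exI[of _ "\<lambda>_. 1"]) (auto simp: card_gt_0_iff)
next
  case (insert a A)
  show ?case
  proof (cases "\<forall>k\<in>K. c k a = 0")
    case True
    then show ?thesis using insert.IH[of K c] insert.hyps insert.prems by auto
  next
    case False
    then obtain p where p: "p \<in> K" "c p a \<noteq> 0" by blast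
    then have card_less: "card A < card (K - {p})" using insert.hyps insert.prems by simp
    have "\<exists>d. (\<exists>k\<in>K - {p}. d k \<noteq> 0) \<and>
        (\<forall>x\<in>A. (\<Sum>k\<in>K - {p}. d k * (c p a * c k x - c k a * c p x)) = 0)"
      by (rule insert.IH) (use insert.prems card_less in auto)
    then obtain d where nontrivial: "\<exists>k\<in>K - {p}. d k \<noteq> 0" and
      solution: "\<And>x. x \<in> A \<Longrightarrow> (\<Sum>k\<in>K - {p}. d k * (c p a * c k x - c k a * c p x)) = 0" by blast
    define e where "e = (\<lambda>k. c p a * d k)(p := - (\<Sum>k\<in>K - {p}. d k * c k a))"
    have "(\<Sum>k\<in>K. e k * c k x) = 0" if "x \<in> insert a A" for x
      unfolding e_def sum_pivot_elimination[OF insert.prems(1) p(1)]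
      using that solution by (auto simp: mult.commute)
    moreover have "\<exists>k\<in>K. e k \<noteq> 0" using nontrivial p(2) by (auto simp: e_def)
    ultimately show ?thesis by blast
  qed
qed

locale elimination =
  fixes ev :: "'c::idom \<Rightarrow> 's \<Rightarrow> 'r::idom" and X :: "'i::finite \<Rightarrow> 's \<Rightarrow> 'r"
  assumes ev_0 [simp]: "ev 0 s = 0" and ev_1 [simp]: "ev 1 s = 1"
    and ev_add: "ev (c + d) s = ev c s + ev d s"
    and ev_mult: "ev (c * d) s = ev c s * ev d s"
begin

lemma ev_sum: "ev (sum c A) s = (\<Sum>a\<in>A. ev (c a) s)"
  by (induction A rule: infinite_finite_induct) (auto simp: ev_add)

lemma ev_power: "ev (c ^ k) s = ev c s ^ k"
  by (induction k) (auto simp: ev_mult)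

definition scale :: "'c \<Rightarrow> ('s \<Rightarrow> 'r) \<Rightarrow> 's \<Rightarrow> 'r" where
  "scale c F = (\<lambda>s. ev c s * F s)"

sublocale module scale
  by unfold_locales (auto simp: scale_def ev_add ev_mult fun_eq_iff algebra_simps)

definition monomial :: "('i \<Rightarrow> nat) \<Rightarrow> 's \<Rightarrow> 'r" where
  "monomial a = (\<lambda>s. \<Prod>i\<in>UNIV. X i s ^ a i)"

definition polys_le :: "nat \<Rightarrow> ('s \<Rightarrow> 'r) set" where
  "polys_le d = span (monomial ` {a. sum a UNIV \<le> d})"

lemma monomial_add: "monomial (a + b) = monomial a * monomial b"
  by (simp add: monomial_def power_add prod.distrib fun_eq_iff)

lemma monomial_single: "monomial (\<lambda>j. if j = i then k else 0) s = X i s ^ k"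
proof -
  have "monomial (\<lambda>j. if j = i then k else 0) s = (\<Prod>j\<in>UNIV. if j = i then X j s ^ k else 1)"
    unfolding monomial_def by (rule prod.cong) auto
  then show ?thesis by simp
qed

lemma polys_le_mono: "d \<le> e \<Longrightarrow> polys_le d \<subseteq> polys_le e"
  unfolding polys_le_def by (intro span_mono image_mono) auto

lemma polys_le_monomial: "sum a UNIV \<le> d \<Longrightarrow> monomial a \<in> polys_le d"
  unfolding polys_le_def by (intro span_base) auto

lemma polys_le_add: "F \<in> polys_le d \<Longrightarrow> G \<in> polys_le d \<Longrightarrow> (\<lambda>s. F s + G s) \<in> polys_le d"
  using span_add by (auto simp: polys_le_def plus_fun_def)

lemma polys_le_scale: "F \<in> polys_le d \<Longrightarrow> (\<lambda>s. ev c s * F s) \<in> polys_le d"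
  using span_scale by (auto simp: polys_le_def scale_def)

lemma polys_le_sum:
  "(\<And>a. a \<in> A \<Longrightarrow> F a \<in> polys_le d) \<Longrightarrow> (\<lambda>s. \<Sum>a\<in>A. F a s) \<in> polys_le d"
  using span_sum[of A F] by (simp add: polys_le_def sum_fun_apply[abs_def])

lemma polys_le_ev: "ev c \<in> polys_le d"
  using polys_le_scale[OF polys_le_monomial[of "\<lambda>_. 0" d], of c] by (simp add: monomial_def)

lemma polys_le_var:
  assumes "1 \<le> d"
  shows "X i \<in> polys_le d"
proof -
  have "monomial (\<lambda>j. if j = i then 1 else 0) = X i" by (simp add: fun_eq_iff monomial_single)
  with polys_le_monomial[of "\<lambda>j. if j = i then 1 else 0" d] assms show ?thesis by simp
qed

lemma polys_le_mult:
  assumes "F \<in> polys_le d" "G \<in> polys_le e"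
  shows "(\<lambda>s. F s * G s) \<in> polys_le (d + e)"
proof -
  have monomial_mult: "monomial a * G \<in> polys_le (d + e)" if a: "sum a UNIV \<le> d" for a
    using assms(2) unfolding polys_le_def
  proof (induction rule: span_induct_alt)
    case base
    show ?case by (simp only: mult_zero_right span_zero)
  next
    case (step c m G)
    then obtain b where "m = monomial b" "sum b UNIV \<le> e" by auto
    then have "monomial a * m \<in> polys_le (d + e)"
      using a polys_le_monomial[of "a + b" "d + e"] by (simp add: monomial_add sum.distrib)
    moreover have "monomial a * (scale c m + G) = scale c (monomial a * m) + monomial a * G"
      by (simp add: scale_def fun_eq_iff algebra_simps)
    ultimately show ?case
      using step.IH unfolding polys_le_def by (simp only: span_add span_scale)
  qed
  have "F * G \<in> polys_le (d + e)"
    using assms(1) unfolding polys_le_def[of d]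
  proof (induction rule: span_induct_alt)
    case base
    show ?case unfolding polys_le_def by (simp only: mult_zero_left span_zero)
  next
    case (step c m F)
    then have "m * G \<in> polys_le (d + e)" using monomial_mult by blast
    moreover have "(scale c m + F) * G = scale c (m * G) + F * G"
      by (simp add: scale_def fun_eq_iff algebra_simps)
    ultimately show ?case
      using step.IH unfolding polys_le_def by (simp only: span_add span_scale)
  qed
  then show ?thesis by (simp add: times_fun_def)
qed

lemma polys_le_power: "F \<in> polys_le d \<Longrightarrow> (\<lambda>s. F s ^ k) \<in> polys_le (k * d)"
proof (induction k)
  case 0
  have "ev 1 = (\<lambda>s. 1)" by (simp add: fun_eq_iff)
  then show ?case using polys_le_ev[of 1 0] by simp
next
  case (Suc k)
  then show ?case using polys_le_mult[of F d "\<lambda>s. F s ^ k" "k * d"] by simp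
qed

end

locale degree_reduction = elimination ev X
  for ev :: "'c::idom \<Rightarrow> 's \<Rightarrow> 'r::idom" and X :: "'i::finite \<Rightarrow> 's \<Rightarrow> 'r" +
  fixes S :: "'s set" and l :: 'c and M :: nat and q :: "'i \<Rightarrow> 's \<Rightarrow> 'r"
  assumes q_polys_le: "q i \<in> polys_le M"
    and X_power_eq: "s \<in> S \<Longrightarrow> ev l s * X i s ^ Suc M = q i s"
begin

definition reduced_monomials :: "('s \<Rightarrow> 'r) set" where
  "reduced_monomials = monomial ` {a. \<forall>i. a i \<le> M}"

definition reduces_with :: "nat \<Rightarrow> ('s \<Rightarrow> 'r) \<Rightarrow> bool" where
  "reduces_with k F \<longleftrightarrow> (\<exists>G\<in>span reduced_monomials. \<forall>s\<in>S. ev (l ^ k) s * F s = G s)"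

lemma finite_reduced_monomials: "finite reduced_monomials"
proof -
  have "{a. \<forall>i. a i \<le> M} = PiE (UNIV :: 'i set) (\<lambda>_. {..M})" by auto
  then show ?thesis by (simp add: reduced_monomials_def finite_PiE)
qed

lemma reduces_with_mono:
  assumes "reduces_with k F" "k \<le> k'"
  shows "reduces_with k' F"
proof -
  obtain G where G: "G \<in> span reduced_monomials" "\<And>s. s \<in> S \<Longrightarrow> ev (l ^ k) s * F s = G s"
    using assms(1) unfolding reduces_with_def by blast
  have "ev (l ^ k') s * F s = scale (l ^ (k' - k)) G s" if "s \<in> S" for s
  proof -
    have "l ^ k' = l ^ (k' - k) * l ^ k" using assms(2) by (simp add: power_add[symmetric])
    then show ?thesis using G(2)[OF that] by (simp add: scale_def ev_mult mult.assoc)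
  qed
  with G(1) show ?thesis unfolding reduces_with_def by (blast intro: span_scale)
qed

lemma subspace_reducible: "subspace {F. \<exists>k. reduces_with k F}"
proof (rule subspaceI)
  have "reduces_with 0 0"
    unfolding reduces_with_def by (rule bexI[of _ 0]) (auto intro: span_zero)
  then show "0 \<in> {F. \<exists>k. reduces_with k F}" by blast
next
  fix F G assume "F \<in> {F. \<exists>k. reduces_with k F}" "G \<in> {F. \<exists>k. reduces_with k F}"
  then obtain k k' where "reduces_with k F" "reduces_with k' G" by blast
  then have "reduces_with (max k k') F" "reduces_with (max k k') G"
    by (auto elim: reduces_with_mono)
  then obtain F' G' where "F' \<in> span reduced_monomials" "G' \<in> span reduced_monomials"
    "\<forall>s\<in>S. ev (l ^ max k k') s * F s = F' s" "\<forall>s\<in>S. ev (l ^ max k k') s * G s = G' s"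
    unfolding reduces_with_def by blast
  then have "reduces_with (max k k') (F + G)"
    unfolding reduces_with_def
    by (intro bexI[of _ "F' + G'"]) (auto intro: span_add simp: algebra_simps)
  then show "F + G \<in> {F. \<exists>k. reduces_with k F}" by blast
next
  fix c F assume "F \<in> {F. \<exists>k. reduces_with k F}"
  then obtain k G where "G \<in> span reduced_monomials" "\<forall>s\<in>S. ev (l ^ k) s * F s = G s"
    unfolding reduces_with_def by blast
  then have "reduces_with k (scale c F)"
    unfolding reduces_with_def
    by (intro bexI[of _ "scale c G"] ballI span_scale) (auto simp: scale_def mult.left_commute)
  then show "scale c F \<in> {F. \<exists>k. reduces_with k F}" by blast
qed

lemma monomial_degree_reduction:
  assumes "\<not> a i \<le> M"
  obtains F where "F \<in> polys_le (sum a UNIV - 1)" "\<And>s. s \<in> S \<Longrightarrow> ev l s * monomial a s = F s"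
proof -
  define b where "b = a(i := a i - Suc M)"
  have a_eq: "a = (\<lambda>j. if j = i then Suc M else 0) + b"
    using assms by (auto simp: b_def fun_eq_iff)
  then have "sum a UNIV = Suc M + sum b UNIV" by (simp add: sum.distrib)
  then have "(\<lambda>s. q i s * monomial b s) \<in> polys_le (sum a UNIV - 1)"
    using polys_le_mult[OF q_polys_le polys_le_monomial[OF order_refl]] by simp
  moreover have "ev l s * monomial a s = q i s * monomial b s" if "s \<in> S" for s
    using X_power_eq[OF that, of i, symmetric]
    by (subst a_eq) (simp add: monomial_add monomial_single mult.assoc)
  ultimately show thesis using that by blast
qed

lemma polys_le_reduces: "F \<in> polys_le d \<Longrightarrow> \<exists>k. reduces_with k F"
proof (induction d arbitrary: F rule: less_induct)
  case (less d)
  have "\<exists>k. reduces_with k (monomial a)" if a: "sum a UNIV \<le> d" for a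
  proof (cases "\<forall>i. a i \<le> M")
    case True
    then have "monomial a \<in> span reduced_monomials"
      unfolding reduced_monomials_def by (intro span_base) blast
    then have "reduces_with 0 (monomial a)" unfolding reduces_with_def by auto
    then show ?thesis ..
  next
    case False
    then obtain i where i: "\<not> a i \<le> M" by blast
    then obtain G where G: "G \<in> polys_le (sum a UNIV - 1)"
      "\<And>s. s \<in> S \<Longrightarrow> ev l s * monomial a s = G s" by (rule monomial_degree_reduction) blast
    have "sum a UNIV - 1 < d" using a i member_le_sum[of i UNIV a] by simp
    from less.IH[OF this G(1)] obtain k where "reduces_with k G" by blast
    moreover have "ev (l ^ Suc k) s * monomial a s = ev (l ^ k) s * G s" if "s \<in> S" for s
      using G(2)[OF that, symmetric] by (simp add: ev_mult mult_ac)
    ultimately have "reduces_with (Suc k) (monomial a)" unfolding reduces_with_def by auto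
    then show ?thesis ..
  qed
  then have "polys_le d \<subseteq> {F. \<exists>k. reduces_with k F}"
    unfolding polys_le_def by (intro span_minimal subspace_reducible) blast
  with less.prems show ?case by blast
qed

lemma powers_reduce_uniformly:
  assumes "F \<in> polys_le d"
  obtains e b where "\<And>k s. k \<le> N \<Longrightarrow> s \<in> S \<Longrightarrow>
    ev (l ^ e) s * F s ^ k = (\<Sum>v\<in>reduced_monomials. ev (b k v) s * v s)"
proof -
  have "\<forall>k. \<exists>e. reduces_with e (\<lambda>s. F s ^ k)"
    using polys_le_reduces[OF polys_le_power[OF assms]] by blast
  then obtain e where e: "\<And>k. reduces_with (e k) (\<lambda>s. F s ^ k)" by metis
  define E where "E = (\<Sum>k\<le>N. e k)"
  have "\<forall>k\<in>{..N}. \<exists>b. \<forall>s\<in>S. ev (l ^ E) s * F s ^ k = (\<Sum>v\<in>reduced_monomials. ev (b v) s * v s)"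
  proof
    fix k assume "k \<in> {..N}"
    then have "e k \<le> E" unfolding E_def by (rule member_le_sum) auto
    from reduces_with_mono[OF e this]
    show "\<exists>b. \<forall>s\<in>S. ev (l ^ E) s * F s ^ k = (\<Sum>v\<in>reduced_monomials. ev (b v) s * v s)"
      unfolding reduces_with_def span_finite[OF finite_reduced_monomials]
      by (auto simp: scale_def sum_fun_apply)
  qed
  from bchoice[OF this] obtain b where "\<forall>k\<in>{..N}. \<forall>s\<in>S.
    ev (l ^ E) s * F s ^ k = (\<Sum>v\<in>reduced_monomials. ev (b k v) s * v s)" ..
  then show thesis by (intro that[of E b]) auto
qed

theorem polys_le_algebraic:
  assumes "F \<in> polys_le d"
  shows "\<exists>p. p \<noteq> 0 \<and> (\<forall>s\<in>S. ev l s \<noteq> 0 \<longrightarrow> (\<Sum>k\<le>degree p. ev (coeff p k) s * F s ^ k) = 0)"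
proof -
  let ?V = reduced_monomials
  define N where "N = card ?V"
  obtain e b where b: "\<And>k s. k \<le> N \<Longrightarrow> s \<in> S \<Longrightarrow>
      ev (l ^ e) s * F s ^ k = (\<Sum>v\<in>?V. ev (b k v) s * v s)"
    using powers_reduce_uniformly[OF assms] by blast
  have "\<exists>c. (\<exists>k\<in>{..N}. c k \<noteq> 0) \<and> (\<forall>v\<in>?V. (\<Sum>k\<le>N. c k * b k v) = 0)"
    by (rule homogeneous_system_nontrivial_solution) (auto simp: N_def finite_reduced_monomials)
  then obtain c where nontrivial: "\<exists>k\<le>N. c k \<noteq> 0" and
    relation: "\<And>v. v \<in> ?V \<Longrightarrow> (\<Sum>k\<le>N. c k * b k v) = 0" by auto
  define p where "p = (\<Sum>k\<le>N. monom (c k) k)"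
  have coeff_p: "coeff p k = (if k \<le> N then c k else 0)" for k by (simp add: p_def coeff_sum)
  have "(\<Sum>k\<le>degree p. ev (coeff p k) s * F s ^ k) = 0" if s: "s \<in> S" and l: "ev l s \<noteq> 0" for s
  proof -
    have "degree p \<le> N" by (rule degree_le) (simp add: coeff_p)
    then have "(\<Sum>k\<le>degree p. ev (coeff p k) s * F s ^ k) = (\<Sum>k\<le>N. ev (coeff p k) s * F s ^ k)"
      by (intro sum.mono_neutral_left) (auto simp: coeff_eq_0)
    then have "ev (l ^ e) s * (\<Sum>k\<le>degree p. ev (coeff p k) s * F s ^ k)
        = (\<Sum>k\<le>N. ev (c k) s * (ev (l ^ e) s * F s ^ k))"
      by (simp add: coeff_p sum_distrib_left mult.left_commute)
    also have "\<dots> = (\<Sum>k\<le>N. \<Sum>v\<in>?V. ev (c k * b k v) s * v s)"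
      by (simp add: b s sum_distrib_left ev_mult mult.assoc)
    also have "\<dots> = (\<Sum>v\<in>?V. ev (\<Sum>k\<le>N. c k * b k v) s * v s)"
      by (subst sum.swap) (simp add: ev_sum sum_distrib_right)
    also have "\<dots> = 0" by (simp add: relation)
    finally show ?thesis using l by (simp add: ev_power)
  qed
  moreover have "p \<noteq> 0" using nontrivial coeff_p by (metis coeff_0)
  ultimately show ?thesis by blast
qed

end

locale real_elimination = elimination ev X
  for ev :: "'c::idom \<Rightarrow> 's \<Rightarrow> real" and X :: "'i::finite \<Rightarrow> 's \<Rightarrow> real" +
  assumes ev_scalar: "\<exists>c. \<forall>s. ev c s = t"
begin

lemma poly_deg_le_polys_le:
  assumes "poly_deg_le d f"
  shows "(\<lambda>s. f (\<chi> i. X i s)) \<in> polys_le d"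
  using assms
proof (induction rule: poly_deg_le.induct)
  case (pconst d t)
  obtain c where "ev c = (\<lambda>s. t)" using ev_scalar[of t] by auto
  then show ?case using polys_le_ev[of c d] by simp
next
  case (pvar d j)
  then show ?case by (simp add: polys_le_var)
next
  case (pmono d f e)
  then show ?case using polys_le_mono by blast
qed (auto intro: polys_le_add polys_le_mult)

end

section \<open>Roots of bivariate polynomials\<close>

text \<open>A bivariate polynomial is a polynomial in \<open>y\<close> whose coefficients are polynomials in \<open>r\<close>.\<close>

definition poly2 :: "'a::comm_ring_1 poly poly \<Rightarrow> 'a \<Rightarrow> 'a \<Rightarrow> 'a" where
  "poly2 R y r = poly (poly R [:y:]) r"

lemma poly2_0 [simp]: "poly2 0 y r = 0"
  and poly2_1 [simp]: "poly2 1 y r = 1"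
  and poly2_add [simp]: "poly2 (R + S) y r = poly2 R y r + poly2 S y r"
  and poly2_mult [simp]: "poly2 (R * S) y r = poly2 R y r * poly2 S y r"
  and poly2_power [simp]: "poly2 (R ^ k) y r = poly2 R y r ^ k"
  and poly2_pCons [simp]: "poly2 (pCons c R) y r = poly c r + y * poly2 R y r"
  and poly2_smult [simp]: "poly2 (smult c R) y r = poly c r * poly2 R y r"
  by (simp_all add: poly2_def)

lemma poly2_altdef: "poly2 R y r = (\<Sum>k\<le>degree R. poly (coeff R k) r * y ^ k)"
  by (simp add: poly2_def poly_altdef[of R] poly_sum)

lemma poly2_eq_sum:
  assumes "degree R \<le> n"
  shows "poly2 R y r = (\<Sum>k\<le>n. poly (coeff R k) r * y ^ k)"
  unfolding poly2_altdef using assms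
  by (intro sum.mono_neutral_left) (auto simp: coeff_eq_0)

lemma poly2_eq_poly_map_poly: "poly2 R y r = poly (map_poly (\<lambda>c. poly c r) R) y"
  by (induction R) (simp_all add: map_poly_pCons)

lemma poly2_pcompose: "poly2 (pcompose R S) y r = poly2 R (poly2 S y r) r"
  by (induction R) (simp_all add: pcompose_pCons)

lemma tendsto_poly2 [tendsto_intros]:
  fixes R :: "real poly poly"
  assumes "(f \<longlongrightarrow> y) F" "(g \<longlongrightarrow> r) F"
  shows "((\<lambda>x. poly2 R (f x) (g x)) \<longlongrightarrow> poly2 R y r) F"
  unfolding poly2_altdef by (intro tendsto_intros assms)

lemma continuous_on_poly2 [continuous_intros]:
  fixes R :: "real poly poly"
  assumes "continuous_on S f" "continuous_on S g"
  shows "continuous_on S (\<lambda>x. poly2 R (f x) (g x))"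
  using assms by (auto simp: continuous_on_def intro!: tendsto_intros)

lemma DERIV_poly2_fst: "((\<lambda>y. poly2 R y r) has_real_derivative poly2 (pderiv R) y r) (at y)"
proof (induction R)
  case (pCons c R)
  have "((\<lambda>y. poly c r + y * poly2 R y r) has_real_derivative
      (poly2 R y r + y * poly2 (pderiv R) y r)) (at y)"
    by (rule derivative_eq_intros pCons.IH refl | simp)+
  then show ?case by (simp add: pderiv_pCons)
qed simp

lemma DERIV_poly2_snd:
  "((\<lambda>r. poly2 R y r) has_real_derivative poly2 (map_poly pderiv R) y r) (at r)"
proof (induction R)
  case (pCons c R)
  have "((\<lambda>r. poly c r + y * poly2 R y r) has_real_derivative
      (poly (pderiv c) r + y * poly2 (map_poly pderiv R) y r)) (at r)"
    by (rule derivative_eq_intros pCons.IH poly_DERIV refl | simp)+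
  then show ?case by (simp add: map_poly_pCons)
qed simp

lemma poly2_factor_at:
  obtains A where "\<And>y r. poly2 R y r = (y - y0) * poly2 A y r + poly2 R y0 r"
    "\<And>r. poly2 A y0 r = poly2 (pderiv R) y0 r"
proof -
  define A where "A = synthetic_div R [:y0:]"
  have R_eq: "[:-[:y0:], 1:] * A + [:poly R [:y0:]:] = R"
    unfolding A_def by (rule synthetic_div_correct')
  have "poly2 R y r = (y - y0) * poly2 A y r + poly2 R y0 r" for y r
    using arg_cong[OF R_eq, of "\<lambda>W. poly2 W y r"] by (simp add: poly2_def algebra_simps)
  moreover have "pderiv R = A + [:-[:y0:], 1:] * pderiv A"
    by (subst R_eq[symmetric], simp only: pderiv_add pderiv_mult) (simp add: pderiv_pCons)
  then have "poly2 A y0 r = poly2 (pderiv R) y0 r" for r by simp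
  ultimately show thesis by (rule that)
qed

lemma implicit_function_DERIV:
  fixes R :: "real poly poly"
  assumes root: "\<And>r. r \<in> I \<Longrightarrow> poly2 R (\<xi> r) r = 0" and I: "open I" "r0 \<in> I"
    and cont: "continuous_on I \<xi>" and simple: "poly2 (pderiv R) (\<xi> r0) r0 \<noteq> 0"
  shows "(\<xi> has_real_derivative
      - poly2 (map_poly pderiv R) (\<xi> r0) r0 / poly2 (pderiv R) (\<xi> r0) r0) (at r0)"
proof -
  obtain A where R_eq: "\<And>y r. poly2 R y r = (y - \<xi> r0) * poly2 A y r + poly2 R (\<xi> r0) r"
    and A: "\<And>r. poly2 A (\<xi> r0) r = poly2 (pderiv R) (\<xi> r0) r"
    by (rule poly2_factor_at[of R "\<xi> r0"]) blast
  let ?q = "\<lambda>r. (poly2 R (\<xi> r0) r - poly2 R (\<xi> r0) r0) / (r - r0)"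
  have "(?q \<longlongrightarrow> poly2 (map_poly pderiv R) (\<xi> r0) r0) (at r0)"
    using DERIV_poly2_snd[of R "\<xi> r0" r0] by (simp add: has_field_derivative_iff)
  moreover have A_lim: "((\<lambda>r. poly2 A (\<xi> r) r) \<longlongrightarrow> poly2 (pderiv R) (\<xi> r0) r0) (at r0)"
    unfolding A[symmetric] using cont I
    by (intro tendsto_intros) (metis at_within_open continuous_on)
  ultimately have lim: "((\<lambda>r. - ?q r / poly2 A (\<xi> r) r) \<longlongrightarrow>
      - poly2 (map_poly pderiv R) (\<xi> r0) r0 / poly2 (pderiv R) (\<xi> r0) r0) (at r0)"
    using simple by (intro tendsto_divide tendsto_minus)
  have "\<forall>\<^sub>F r in at r0. poly2 A (\<xi> r) r \<noteq> 0"
    using tendsto_imp_eventually_ne[OF A_lim simple] .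
  moreover have "\<forall>\<^sub>F r in at r0. r \<in> I" using I by (rule eventually_at_in_open')
  ultimately have "\<forall>\<^sub>F r in at r0. - ?q r / poly2 A (\<xi> r) r = (\<xi> r - \<xi> r0) / (r - r0)"
  proof eventually_elim
    case (elim r)
    then have "- (poly2 R (\<xi> r0) r - poly2 R (\<xi> r0) r0) = (\<xi> r - \<xi> r0) * poly2 A (\<xi> r) r"
      using R_eq[of "\<xi> r" r] root[of r] root[OF I(2)] by simp
    then have "- ?q r = (\<xi> r - \<xi> r0) * poly2 A (\<xi> r) r / (r - r0)" by (simp only: minus_divide_left)
    with elim show ?case by simp
  qed
  with lim show ?thesis unfolding has_field_derivative_iff by (rule Lim_transform_eventually)
qed

definition slice_roots :: "real poly poly \<Rightarrow> real \<Rightarrow> real set" where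
  "slice_roots R r = {y. poly2 R y r = 0}"

lemma slice_roots_iff [simp]: "y \<in> slice_roots R r \<longleftrightarrow> poly2 R y r = 0"
  by (simp add: slice_roots_def)

lemma finite_slice_roots:
  assumes "poly (lead_coeff R) r \<noteq> 0"
  shows "finite (slice_roots R r)"
proof -
  have "coeff (map_poly (\<lambda>c. poly c r) R) (degree R) \<noteq> 0"
    using assms by (simp add: coeff_map_poly)
  then have "map_poly (\<lambda>c. poly c r) R \<noteq> 0" by auto
  from poly_roots_finite[OF this] show ?thesis by (simp add: slice_roots_def poly2_eq_poly_map_poly)
qed

lemma norm_poly_root_le:
  fixes p :: "'a::real_normed_field poly"
  assumes "poly p x = 0" "p \<noteq> 0"
  shows "norm x \<le> 1 + (\<Sum>k<degree p. norm (coeff p k)) / norm (lead_coeff p)"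
proof (cases "norm x \<le> 1")
  case True
  have "0 \<le> (\<Sum>k<degree p. norm (coeff p k)) / norm (lead_coeff p)"
    by (intro divide_nonneg_nonneg sum_nonneg) auto
  with True show ?thesis by linarith
next
  case False
  let ?n = "degree p" and ?C = "\<Sum>k<degree p. norm (coeff p k)"
  have "lead_coeff p * x ^ ?n = - (\<Sum>k<?n. coeff p k * x ^ k)"
    using assms(1)
    by (simp add: poly_altdef lessThan_Suc_atMost[symmetric] eq_neg_iff_add_eq_0 add.commute)
  from arg_cong[OF this, of norm]
  have "norm (lead_coeff p) * norm x ^ ?n = norm (\<Sum>k<?n. coeff p k * x ^ k)"
    by (simp add: norm_mult norm_power)
  also have "\<dots> \<le> (\<Sum>k<?n. norm (coeff p k) * norm x ^ k)"
    by (rule order_trans[OF norm_sum]) (simp add: norm_mult norm_power)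
  also have "\<dots> \<le> (\<Sum>k<?n. norm (coeff p k) * norm x ^ (?n - 1))"
    using False by (intro sum_mono mult_left_mono power_increasing) auto
  also have "\<dots> = ?C * norm x ^ (?n - 1)" by (simp add: sum_distrib_right)
  finally have "norm (lead_coeff p) * norm x ^ ?n \<le> ?C * norm x ^ (?n - 1)" .
  moreover have "?n \<noteq> 0"
  proof
    assume "?n = 0"
    then obtain c where "p = [:c:]" by (rule degree_eq_zeroE)
    with assms show False by simp
  qed
  then have "norm x ^ ?n = norm x * norm x ^ (?n - 1)" by (metis power_eq_if)
  ultimately have "(norm (lead_coeff p) * norm x) * norm x ^ (?n - 1) \<le> ?C * norm x ^ (?n - 1)"
    by (simp add: mult.assoc)
  moreover have "0 < norm x ^ (?n - 1)" using False by (intro zero_less_power) linarith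
  ultimately have "norm (lead_coeff p) * norm x \<le> ?C" by (rule mult_right_le_imp_le)
  then have "norm x \<le> ?C / norm (lead_coeff p)" using assms(2) by (simp add: field_simps)
  then show ?thesis by simp
qed

lemma eventually_slice_roots_bounded:
  assumes "poly (lead_coeff R) r0 \<noteq> 0"
  obtains M where "\<forall>\<^sub>F r in nhds r0. slice_roots R r \<subseteq> {-M..M}"
proof -
  let ?b = "\<lambda>r. 1 + (\<Sum>k<degree R. \<bar>poly (coeff R k) r\<bar>) / \<bar>poly (lead_coeff R) r\<bar>"
  have poly_lim: "((\<lambda>r. poly p r) \<longlongrightarrow> poly p r0) (nhds r0)" for p
    by (intro tendsto_intros filterlim_ident)
  have "(?b \<longlongrightarrow> ?b r0) (nhds r0)" using assms by (intro tendsto_intros poly_lim) auto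
  then have "\<forall>\<^sub>F r in nhds r0. ?b r < ?b r0 + 1" by (rule order_tendstoD) simp
  moreover have "\<forall>\<^sub>F r in nhds r0. poly (lead_coeff R) r \<noteq> 0"
    by (rule tendsto_imp_eventually_ne[OF poly_lim assms])
  ultimately have "\<forall>\<^sub>F r in nhds r0. slice_roots R r \<subseteq> {- (?b r0 + 1)..?b r0 + 1}"
  proof eventually_elim
    case (elim r)
    let ?p = "map_poly (\<lambda>c. poly c r) R"
    have lc: "coeff ?p (degree R) \<noteq> 0" using elim(2) by (simp add: coeff_map_poly)
    then have "degree ?p = degree R" by (intro antisym map_poly_degree_leq le_degree)
    moreover have "?p \<noteq> 0" using lc by auto
    ultimately have "\<bar>y\<bar> \<le> ?b r" if "y \<in> slice_roots R r" for y
      using norm_poly_root_le[of ?p y] that by (simp add: poly2_eq_poly_map_poly coeff_map_poly)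
    with elim(1) show ?case by (fastforce simp: abs_le_iff)
  qed
  then show thesis by (rule that)
qed

lemma slice_roots_upper_semicontinuous:
  assumes lc: "poly (lead_coeff R) r0 \<noteq> 0" and "\<eta> > 0"
  shows "\<forall>\<^sub>F r in nhds r0. slice_roots R r \<subseteq> (\<Union>y\<in>slice_roots R r0. ball y \<eta>)"
proof -
  obtain M where M: "\<forall>\<^sub>F r in nhds r0. slice_roots R r \<subseteq> {-M..M}"
    using eventually_slice_roots_bounded[OF lc] .
  define K where "K = {-M..M} - (\<Union>y\<in>slice_roots R r0. ball y \<eta>)"
  define W where "W = {p. poly2 R (snd p) (fst p) \<noteq> 0}"
  have "compact K" unfolding K_def by (intro compact_diff) auto
  moreover have "open W" unfolding W_def by (intro open_Collect_neq continuous_intros)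
  moreover have "{r0} \<times> K \<subseteq> W" using \<open>\<eta> > 0\<close> by (auto simp: K_def W_def)
  ultimately obtain U where U: "r0 \<in> U" "open U" "U \<times> K \<subseteq> W"
    using Elementary_Topology.tube_lemma[of K W r0] by blast
  have "\<forall>\<^sub>F r in nhds r0. r \<in> U" using U by (intro eventually_nhds_in_open)
  with M show ?thesis
  proof eventually_elim
    case (elim r)
    then have "slice_roots R r \<inter> K = {}" using U(3) by (auto simp: W_def)
    with elim show ?case unfolding K_def by blast
  qed
qed

lemma eventually_poly2_nonzero_ball:
  fixes R :: "real poly poly"
  assumes "poly2 R y0 r0 \<noteq> 0"
  obtains e where "e > 0" "\<forall>\<^sub>F r in nhds r0. \<forall>y\<in>ball y0 e. poly2 R y r \<noteq> 0"
proof -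
  have "((\<lambda>p. poly2 R (fst p) (snd p)) \<longlongrightarrow> poly2 R y0 r0) (nhds (y0, r0))"
    by (intro tendsto_intros) (auto simp: nhds_prod intro: filterlim_fst filterlim_snd)
  then have "\<forall>\<^sub>F p in nhds y0 \<times>\<^sub>F nhds r0. poly2 R (fst p) (snd p) \<noteq> 0"
    unfolding nhds_prod[symmetric] using assms by (rule tendsto_imp_eventually_ne)
  then obtain P Q where PQ: "\<forall>\<^sub>F y in nhds y0. P y" "\<forall>\<^sub>F r in nhds r0. Q r"
    "\<And>y r. P y \<Longrightarrow> Q r \<Longrightarrow> poly2 R y r \<noteq> 0"
    unfolding eventually_prod_filter by auto
  obtain e where e: "e > 0" "\<And>y. y \<in> ball y0 e \<Longrightarrow> P y"
    using PQ(1) unfolding eventually_nhds_metric by (auto simp: dist_commute)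
  have "\<forall>\<^sub>F r in nhds r0. \<forall>y\<in>ball y0 e. poly2 R y r \<noteq> 0"
    using PQ(2) by (rule eventually_mono) (use PQ(3) e(2) in blast)
  with e(1) show thesis by (rule that)
qed

lemma simple_root_unique:
  assumes "poly2 (pderiv R) y0 r0 \<noteq> 0"
  obtains e where "e > 0" "\<forall>\<^sub>F r in nhds r0. \<forall>y\<in>ball y0 e \<inter> slice_roots R r.
    \<forall>y'\<in>ball y0 e \<inter> slice_roots R r. y = y'"
proof -
  obtain e where "e > 0"
    and e: "\<forall>\<^sub>F r in nhds r0. \<forall>y\<in>ball y0 e. poly2 (pderiv R) y r \<noteq> 0"
    using eventually_poly2_nonzero_ball[OF assms] .
  from e have "\<forall>\<^sub>F r in nhds r0. \<forall>y\<in>ball y0 e \<inter> slice_roots R r.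
    \<forall>y'\<in>ball y0 e \<inter> slice_roots R r. y = y'"
  proof eventually_elim
    case (elim r)
    have no_lt: "\<not> y < y'"
      if roots: "y \<in> ball y0 e \<inter> slice_roots R r" "y' \<in> ball y0 e \<inter> slice_roots R r" for y y'
    proof
      assume "y < y'"
      have "continuous_on {y..y'} (\<lambda>y. poly2 R y r)"
        by (intro continuous_intros)
      moreover have "((\<lambda>y. poly2 R y r) has_derivative (*) (poly2 (pderiv R) x r)) (at x)" for x
        using DERIV_poly2_fst by (simp add: has_field_derivative_def)
      ultimately obtain x where x: "y < x" "x < y'" "(*) (poly2 (pderiv R) x r) = (\<lambda>v. 0)"
        using Rolle_deriv[of y y' "\<lambda>y. poly2 R y r" "\<lambda>x. (*) (poly2 (pderiv R) x r)"] roots \<open>y < y'\<close>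
        by auto
      have "x \<in> ball y0 e" using x roots by (auto simp: dist_real_def abs_less_iff)
      moreover have "poly2 (pderiv R) x r = 0" using fun_cong[OF x(3), of 1] by simp
      ultimately show False using elim by blast
    qed
    show ?case using no_lt by (meson linorder_neqE)
  qed
  with \<open>e > 0\<close> show thesis by (rule that)
qed

lemma simple_root_persists:
  fixes R :: "real poly poly"
  assumes root: "poly2 R y0 r0 = 0" and simple: "poly2 (pderiv R) y0 r0 \<noteq> 0" and "\<eta> > 0"
  shows "\<forall>\<^sub>F r in nhds r0. \<exists>y\<in>ball y0 \<eta>. poly2 R y r = 0"
proof -
  define p where "p y r = poly2 (pderiv R) y0 r0 * poly2 R y r" for y r
  have p_cont: "continuous_on S (\<lambda>y. p y r)" for S r
    unfolding p_def by (intro continuous_intros)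
  have p_lim: "((\<lambda>r. p y r) \<longlongrightarrow> p y r0) (nhds r0)" for y
    unfolding p_def by (intro tendsto_intros filterlim_ident)
  have "((\<lambda>y. p y r0) has_real_derivative poly2 (pderiv R) y0 r0 * poly2 (pderiv R) y0 r0) (at y0)"
    unfolding p_def by (rule DERIV_cmult[OF DERIV_poly2_fst])
  moreover have "0 < poly2 (pderiv R) y0 r0 * poly2 (pderiv R) y0 r0"
    using simple by (simp add: zero_less_mult_iff linorder_neq_iff) linarith
  moreover have "p y0 r0 = 0" using root by (simp add: p_def)
  ultimately obtain d d' where d: "d > 0" "\<And>h. 0 < h \<Longrightarrow> h < d \<Longrightarrow> 0 < p (y0 + h) r0"
    and d': "d' > 0" "\<And>h. 0 < h \<Longrightarrow> h < d' \<Longrightarrow> p (y0 - h) r0 < 0"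
    using DERIV_pos_inc_right[of "\<lambda>y. p y r0"] DERIV_pos_inc_left[of "\<lambda>y. p y r0"] by metis
  define h where "h = min \<eta> (min d d') / 2"
  have h: "0 < h" "h < \<eta>" "h < d" "h < d'" using \<open>\<eta> > 0\<close> d(1) d'(1) by (auto simp: h_def)
  have "\<forall>\<^sub>F r in nhds r0. 0 < p (y0 + h) r" "\<forall>\<^sub>F r in nhds r0. p (y0 - h) r < 0"
    using order_tendstoD[OF p_lim] d(2)[OF h(1,3)] d'(2)[OF h(1,4)] by blast+
  then show ?thesis
  proof eventually_elim
    case (elim r)
    then obtain y where "y0 - h \<le> y" "y \<le> y0 + h" "p y r = 0"
      using IVT'[of "\<lambda>y. p y r" "y0 - h" 0 "y0 + h", OF _ _ _ p_cont] h(1) by auto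
    then show ?case
      using h(2) simple by (intro bexI[of _ y]) (auto simp: p_def dist_real_def abs_less_iff)
  qed
qed

lemma simple_root_continues:
  assumes "poly2 R y0 r0 = 0" "poly2 (pderiv R) y0 r0 \<noteq> 0"
  shows "\<forall>\<^sub>F \<eta> in at_right 0. \<forall>\<^sub>F r in nhds r0. \<exists>!y. y \<in> ball y0 \<eta> \<inter> slice_roots R r"
proof -
  obtain e where "e > 0" and unique: "\<forall>\<^sub>F r in nhds r0. \<forall>y\<in>ball y0 e \<inter> slice_roots R r.
      \<forall>y'\<in>ball y0 e \<inter> slice_roots R r. y = y'"
    using simple_root_unique[OF assms(2)] .
  from eventually_at_right_real[OF \<open>e > 0\<close>] show ?thesis
  proof eventually_elim
    case (elim \<eta>)
    then have "0 < \<eta>" and sub: "ball y0 \<eta> \<subseteq> ball y0 e" by auto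
    from simple_root_persists[OF assms \<open>0 < \<eta>\<close>] unique show ?case
    proof eventually_elim
      case (elim r)
      from elim(1) obtain y where "y \<in> ball y0 \<eta> \<inter> slice_roots R r" by auto
      moreover have "y' = y" if "y' \<in> ball y0 \<eta> \<inter> slice_roots R r" for y'
        using elim(2) that calculation sub by blast
      ultimately show ?case by blast
    qed
  qed
qed

lemma unique_nearby_points_bij:
  fixes Y Z :: "real set"
  assumes unique: "\<And>y. y \<in> Y \<Longrightarrow> \<exists>!z. z \<in> ball y \<eta> \<inter> Z"
    and covered: "Z \<subseteq> (\<Union>y\<in>Y. ball y \<eta>)"
    and gap: "\<And>y y'. y \<in> Y \<Longrightarrow> y' \<in> Y \<Longrightarrow> y < y' \<Longrightarrow> 2 * \<eta> \<le> y' - y"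
  shows "\<exists>h. bij_betw h Y Z \<and> strict_mono_on Y h \<and> (\<forall>y\<in>Y. h y \<in> ball y \<eta>)"
proof -
  define h where "h y = (THE z. z \<in> ball y \<eta> \<inter> Z)" for y
  have h: "h y \<in> ball y \<eta> \<inter> Z" if "y \<in> Y" for y
    unfolding h_def by (rule theI'[OF unique[OF that]])
  have h_eq: "h y = z" if "y \<in> Y" "z \<in> ball y \<eta> \<inter> Z" for y z
    using unique[OF that(1)] h[OF that(1)] that(2) by blast
  have "strict_mono_on Y h"
  proof (rule strict_mono_onI)
    fix y y' assume "y \<in> Y" "y' \<in> Y" "y < y'"
    then show "h y < h y'"
      using gap[of y y'] h[of y] h[of y'] by (auto simp: dist_real_def abs_less_iff)
  qed
  moreover have "h ` Y = Z"
  proof (intro equalityI subsetI)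
    fix z assume "z \<in> Z"
    then show "z \<in> h ` Y" using covered h_eq by blast
  qed (use h in auto)
  ultimately show ?thesis
    using h by (intro exI[of _ h]) (auto simp: bij_betw_def strict_mono_on_imp_inj_on)
qed

lemma eventually_at_right_half_gaps:
  fixes Y :: "real set"
  assumes "finite Y"
  shows "\<forall>\<^sub>F \<eta> in at_right 0. \<forall>y\<in>Y. \<forall>y'\<in>Y. y < y' \<longrightarrow> 2 * \<eta> \<le> y' - y"
proof (intro eventually_ball_finite assms ballI)
  fix y y' assume "y \<in> Y" "y' \<in> Y"
  show "\<forall>\<^sub>F \<eta> in at_right 0. y < y' \<longrightarrow> 2 * \<eta> \<le> y' - y"
  proof (cases "y < y'")
    case True
    then have "0 < (y' - y) / 2" by simp
    from eventually_at_right_real[OF this] show ?thesis by eventually_elim auto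
  qed simp
qed

lemma slice_roots_stable:
  assumes lc: "poly (lead_coeff R) r0 \<noteq> 0"
    and simple: "\<And>y. poly2 R y r0 = 0 \<Longrightarrow> poly2 (pderiv R) y r0 \<noteq> 0" and "\<eta> > 0"
  shows "\<forall>\<^sub>F r in nhds r0. \<exists>h. bij_betw h (slice_roots R r0) (slice_roots R r) \<and>
    strict_mono_on (slice_roots R r0) h \<and> (\<forall>y\<in>slice_roots R r0. h y \<in> ball y \<eta>)"
proof -
  let ?Y = "slice_roots R r0"
  have fin: "finite ?Y" by (rule finite_slice_roots[OF lc])
  have "\<forall>\<^sub>F \<zeta> in at_right 0. (\<forall>y\<in>?Y. \<forall>\<^sub>F r in nhds r0. \<exists>!z. z \<in> ball y \<zeta> \<inter> slice_roots R r) \<and>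
      (\<forall>y\<in>?Y. \<forall>y'\<in>?Y. y < y' \<longrightarrow> 2 * \<zeta> \<le> y' - y) \<and> \<zeta> \<in> {0<..<\<eta>}"
    by (intro eventually_conj eventually_ball_finite fin ballI simple_root_continues
        eventually_at_right_half_gaps eventually_at_right_real \<open>\<eta> > 0\<close>) (auto dest: simple)
  from eventually_happens'[OF trivial_limit_at_right_real this] obtain \<zeta> where
    unique: "\<forall>y\<in>?Y. \<forall>\<^sub>F r in nhds r0. \<exists>!z. z \<in> ball y \<zeta> \<inter> slice_roots R r"
    and gap: "\<forall>y\<in>?Y. \<forall>y'\<in>?Y. y < y' \<longrightarrow> 2 * \<zeta> \<le> y' - y" and \<zeta>: "\<zeta> \<in> {0<..<\<eta>}" by blast
  then have "0 < \<zeta>" by simp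
  have "\<forall>\<^sub>F r in nhds r0. (\<forall>y\<in>?Y. \<exists>!z. z \<in> ball y \<zeta> \<inter> slice_roots R r) \<and>
      slice_roots R r \<subseteq> (\<Union>y\<in>?Y. ball y \<zeta>)"
    by (intro eventually_conj eventually_ball_finite fin unique
        slice_roots_upper_semicontinuous lc \<open>0 < \<zeta>\<close>)
  then show ?thesis
  proof eventually_elim
    case (elim r)
    then obtain h where "bij_betw h ?Y (slice_roots R r)" "strict_mono_on ?Y h"
      "\<forall>y\<in>?Y. h y \<in> ball y \<zeta>"
      using unique_nearby_points_bij[of ?Y \<zeta> "slice_roots R r"] gap by blast
    moreover from this(3) have "\<forall>y\<in>?Y. h y \<in> ball y \<eta>" using \<zeta> by auto
    ultimately show ?case by blast
  qed
qed

lemma sorted_list_of_set_image: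
  assumes "finite A" "strict_mono_on A h"
  shows "sorted_list_of_set (h ` A) = map h (sorted_list_of_set A)"
proof (rule sorted_distinct_set_unique)
  have "sorted_wrt (<) (map h (sorted_list_of_set A))"
    unfolding sorted_wrt_map using strict_sorted_list_of_set[of A]
    by (rule sorted_wrt_mono_rel[rotated]) (use assms in \<open>auto intro: strict_mono_onD\<close>)
  then show "sorted (map h (sorted_list_of_set A))" "distinct (map h (sorted_list_of_set A))"
    by (simp_all add: strict_sorted_iff)
qed (use assms in simp_all)

lemma sorted_slice_roots_stable:
  assumes lc: "poly (lead_coeff R) r0 \<noteq> 0"
    and simple: "\<And>y. poly2 R y r0 = 0 \<Longrightarrow> poly2 (pderiv R) y r0 \<noteq> 0" and "\<eta> > 0"
  defines "L \<equiv> \<lambda>r. sorted_list_of_set (slice_roots R r)"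
  shows "\<forall>\<^sub>F r in nhds r0. length (L r) = length (L r0) \<and>
    (\<forall>i<length (L r0). L r ! i \<in> ball (L r0 ! i) \<eta>)"
proof (rule eventually_mono[OF slice_roots_stable[OF lc _ \<open>\<eta> > 0\<close>]])
  fix r
  assume "\<exists>h. bij_betw h (slice_roots R r0) (slice_roots R r) \<and>
    strict_mono_on (slice_roots R r0) h \<and> (\<forall>y\<in>slice_roots R r0. h y \<in> ball y \<eta>)"
  then obtain h where h: "bij_betw h (slice_roots R r0) (slice_roots R r)"
    "strict_mono_on (slice_roots R r0) h" "\<forall>y\<in>slice_roots R r0. h y \<in> ball y \<eta>" by blast
  have fin: "finite (slice_roots R r0)" by (rule finite_slice_roots[OF lc])
  have "L r = map h (L r0)"
    using sorted_list_of_set_image[OF fin h(2)] h(1) by (simp add: L_def bij_betw_def)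
  moreover have "set (L r0) = slice_roots R r0" using fin by (simp add: L_def)
  ultimately show "length (L r) = length (L r0) \<and> (\<forall>i<length (L r0). L r ! i \<in> ball (L r0 ! i) \<eta>)"
    using h(3) nth_mem[of _ "L r0"] by auto
qed (rule simple)

definition root_branches :: "real poly poly \<Rightarrow> real set \<Rightarrow> (real \<Rightarrow> real) set \<Rightarrow> bool" where
  "root_branches R I \<Xi> \<longleftrightarrow> finite \<Xi> \<and> (\<forall>\<xi>\<in>\<Xi>. continuous_on I \<xi>) \<and>
    (\<forall>r\<in>I. slice_roots R r = (\<lambda>\<xi>. \<xi> r) ` \<Xi>)"

lemma simple_roots_root_branches:
  assumes I: "open I" "connected I" and lc: "\<And>r. r \<in> I \<Longrightarrow> poly (lead_coeff R) r \<noteq> 0"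
    and simple: "\<And>r y. r \<in> I \<Longrightarrow> poly2 R y r = 0 \<Longrightarrow> poly2 (pderiv R) y r \<noteq> 0"
  shows "\<exists>\<Xi>. root_branches R I \<Xi>"
proof -
  define L where "L r = sorted_list_of_set (slice_roots R r)" for r
  have stable: "\<forall>\<^sub>F r in at r0 within I. length (L r) = length (L r0) \<and>
      (\<forall>i<length (L r0). L r ! i \<in> ball (L r0 ! i) \<eta>)" if "r0 \<in> I" "\<eta> > 0" for r0 \<eta>
    unfolding L_def
    by (rule filter_leD[OF at_within_le_nhds sorted_slice_roots_stable[OF lc simple]])
      (use that in auto)
  have "\<forall>\<^sub>F r' in at r within I. length (L r) = length (L r')" if "r \<in> I" for r
    using stable[OF that zero_less_one] by (rule eventually_mono) simp
  then have "length (L r) = length (L r')" if "r \<in> I" "r' \<in> I" for r r'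
    using connected_local_const[OF I(2) that, of "\<lambda>r. length (L r)"] by blast
  then obtain N where N: "\<And>r. r \<in> I \<Longrightarrow> length (L r) = N" by metis
  have "continuous_on I (\<lambda>r. L r ! i)" if "i < N" for i
    unfolding continuous_on_def
  proof (intro ballI tendstoI)
    fix r0 \<eta> :: real assume r0: "r0 \<in> I" and "\<eta> > 0"
    from stable[OF this] show "\<forall>\<^sub>F r in at r0 within I. dist (L r ! i) (L r0 ! i) < \<eta>"
      by (rule eventually_mono) (use N[OF r0] \<open>i < N\<close> in \<open>simp add: dist_commute\<close>)
  qed
  moreover have "slice_roots R r = (\<lambda>i. L r ! i) ` {..<N}" if "r \<in> I" for r
  proof -
    have "set (L r) = slice_roots R r"
      unfolding L_def using finite_slice_roots[OF lc[OF that]] by simp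
    then show ?thesis using N[OF that] by (auto simp: set_conv_nth)
  qed
  ultimately have "root_branches R I ((\<lambda>i r. L r ! i) ` {..<N})"
    unfolding root_branches_def by (auto simp: image_image)
  then show ?thesis ..
qed

lemma poly_ideal_pseudo_generator:
  fixes R S :: "'a::idom poly"
  assumes "R \<noteq> 0"
  shows "\<exists>T U V. T \<noteq> 0 \<and> T = U * R + V * S \<and>
    (\<exists>a. a \<noteq> 0 \<and> T dvd smult a R) \<and> (\<exists>b. b \<noteq> 0 \<and> T dvd smult b S)"
proof -
  define I where "I T \<longleftrightarrow> T \<noteq> 0 \<and> (\<exists>U V. T = U * R + V * S)" for T
  have "I R" unfolding I_def using assms by (auto intro: exI[of _ 1] exI[of _ 0])
  then obtain T where T: "I T" and minimal: "\<And>T'. I T' \<Longrightarrow> degree T \<le> degree T'"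
    using ex_has_least_nat[of I R degree] by auto
  obtain U V where T_eq: "T = U * R + V * S" and T_nz: "T \<noteq> 0" using T by (auto simp: I_def)
  have divides: "\<exists>a. a \<noteq> 0 \<and> T dvd smult a W" if W: "W = A * R + B * S" for W A B
  proof -
    obtain a q where a: "a \<noteq> 0" "smult a W = T * q + pseudo_mod W T"
      using pseudo_mod(1)[OF T_nz, of W] by blast
    then have "pseudo_mod W T = smult a W - T * q" by simp
    also have "\<dots> = (smult a A - U * q) * R + (smult a B - V * q) * S"
      unfolding W T_eq by (simp add: algebra_simps smult_add_right)
    finally have "pseudo_mod W T \<noteq> 0 \<Longrightarrow> I (pseudo_mod W T)" unfolding I_def by blast
    then have "pseudo_mod W T = 0"
      using minimal[of "pseudo_mod W T"] pseudo_mod(2)[OF T_nz, of W] by fastforce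
    with a show ?thesis by auto
  qed
  from divides[of R 1 0] divides[of S 0 1] T_eq T_nz show ?thesis
    by (intro exI[of _ T] exI[of _ U] exI[of _ V]) simp
qed

lemma prime_elem_poly_bezout:
  fixes R S :: "'a::idom poly"
  assumes prime: "prime_elem R" and deg: "degree R > 0" and ndvd: "\<not> R dvd S"
  shows "\<exists>U V d. d \<noteq> 0 \<and> U * R + V * S = [:d:]"
proof -
  have R_nz: "R \<noteq> 0" using deg by auto
  from poly_ideal_pseudo_generator[OF this, of S] obtain T U V a b where
    T: "T \<noteq> 0" "T = U * R + V * S" and a: "a \<noteq> 0" "T dvd smult a R"
    and b: "b \<noteq> 0" "T dvd smult b S" by blast
  have "\<not> R dvd T"
  proof
    assume "R dvd T"
    then have "R dvd [:b:] * S" using b(2) dvd_trans by fastforce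
    then have "R dvd [:b:]" using prime ndvd prime_elem_dvd_mult_iff by blast
    then have "degree R \<le> degree [:b:]" using b(1) by (intro dvd_imp_degree_le) auto
    with deg show False by simp
  qed
  moreover obtain q where q: "smult a R = T * q" using a(2) by (auto elim: dvdE)
  then have "R dvd T * q" by (metis dvd_smult dvd_refl)
  ultimately obtain w where w: "q = R * w"
    using prime prime_elem_dvd_mult_iff by (blast elim: dvdE)
  have "R * ([:a:] - T * w) = 0" using q w by (simp add: algebra_simps)
  then have a_eq: "[:a:] = T * w" using R_nz by simp
  then have "w \<noteq> 0" using a(1) by auto
  then have "degree T = 0"
    using arg_cong[OF a_eq, of degree] T(1) by (simp add: degree_mult_eq)
  then obtain d where "T = [:d:]" by (rule degree_eq_zeroE)
  with T show ?thesis by (intro exI[of _ U] exI[of _ V] exI[of _ d]) auto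
qed

lemma eventually_poly_nonzero:
  fixes p :: "'a::{idom,t1_space} poly"
  assumes "p \<noteq> 0"
  shows "\<forall>\<^sub>F x in at a within S. poly p x \<noteq> 0"
proof -
  have "finite ({x. poly p x = 0} - {a})" using poly_roots_finite[OF assms] by simp
  then have "open (- ({x. poly p x = 0} - {a}))" by (intro open_Compl finite_imp_closed)
  then have "\<forall>\<^sub>F x in nhds a. x \<in> - ({x. poly p x = 0} - {a})"
    by (intro eventually_nhds_in_open) auto
  then show ?thesis by (auto simp: eventually_at_filter elim: eventually_mono)
qed

lemma prime_elem_eventually_no_common_root:
  assumes "prime_elem R" "degree R > 0" "\<not> R dvd S"
  shows "\<forall>\<^sub>F r in at a within A. slice_roots R r \<inter> slice_roots S r = {}"
proof -
  obtain U V d where d: "d \<noteq> 0" "U * R + V * S = [:d:]"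
    using prime_elem_poly_bezout[OF assms] by blast
  from eventually_poly_nonzero[OF d(1)] show ?thesis
  proof eventually_elim
    case (elim r)
    have "poly2 S y r \<noteq> 0" if "poly2 R y r = 0" for y
      using arg_cong[OF d(2), of "\<lambda>W. poly2 W y r"] elim that by auto
    then show ?case by (auto simp: disjoint_iff)
  qed
qed

lemma dvd_map_pderiv_imp_zero:
  fixes R :: "'a::{idom,semiring_char_0} poly poly"
  assumes "R dvd map_poly pderiv R"
  shows "map_poly pderiv R = 0"
proof (rule ccontr)
  assume nz: "map_poly pderiv R \<noteq> 0"
  obtain W where W: "map_poly pderiv R = R * W" using assms by (auto elim: dvdE)
  then have "R \<noteq> 0" "W \<noteq> 0" using nz by auto
  then have "degree R + degree W = degree (map_poly pderiv R)" by (simp add: W degree_mult_eq)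
  also have "\<dots> \<le> degree R" by (rule map_poly_degree_leq)
  finally obtain c where "W = [:c:]" by (auto elim: degree_eq_zeroE)
  then have "pderiv (coeff R k) = coeff R k * c" for k
    using arg_cong[OF W, of "\<lambda>p. coeff p k"] by (simp add: coeff_map_poly)
  then have "coeff R k dvd pderiv (coeff R k)" for k by simp
  then have "pderiv (coeff R k) = 0" for k by (simp add: pderiv_eq_0_iff)
  then have "map_poly pderiv R = 0" by (simp add: poly_eq_iff[of _ 0] coeff_map_poly)
  with nz show False ..
qed

lemma prime_elem_eventually_regular:
  fixes R :: "real poly poly"
  assumes prime: "prime_elem R" and deg: "degree R > 0"
  defines "R\<^sub>r \<equiv> map_poly pderiv R"
  shows "\<forall>\<^sub>F r in at a within A. poly (lead_coeff R) r \<noteq> 0 \<and>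
    slice_roots R r \<inter> slice_roots (pderiv R) r = {} \<and>
    (R\<^sub>r = 0 \<or> slice_roots R r \<inter> slice_roots R\<^sub>r r = {})"
proof (intro eventually_conj)
  show "\<forall>\<^sub>F r in at a within A. poly (lead_coeff R) r \<noteq> 0"
    by (rule eventually_poly_nonzero) (use deg in auto)
  show "\<forall>\<^sub>F r in at a within A. slice_roots R r \<inter> slice_roots (pderiv R) r = {}"
    by (rule prime_elem_eventually_no_common_root[OF prime deg]) (use deg in simp)
  show "\<forall>\<^sub>F r in at a within A. R\<^sub>r = 0 \<or> slice_roots R r \<inter> slice_roots R\<^sub>r r = {}"
  proof (cases "R\<^sub>r = 0")
    case False
    then have "\<not> R dvd R\<^sub>r" using dvd_map_pderiv_imp_zero unfolding R\<^sub>r_def by blast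
    from prime_elem_eventually_no_common_root[OF prime deg this] show ?thesis
      by (rule eventually_mono) blast
  qed simp
qed

lemma continuous_nonzero_sign:
  fixes f :: "'a::topological_space \<Rightarrow> real"
  assumes "connected S" "continuous_on S f" "\<And>x. x \<in> S \<Longrightarrow> f x \<noteq> 0"
  shows "(\<forall>x\<in>S. f x > 0) \<or> (\<forall>x\<in>S. f x < 0)"
proof (rule ccontr)
  assume "\<not> ?thesis"
  then obtain x y where xy: "x \<in> S" "f x \<le> 0" "y \<in> S" "f y \<ge> 0" by force
  have "connected (f ` S)" using assms(2,1) by (rule connected_continuous_image)
  then have "0 \<in> f ` S" by (rule connectedD_interval) (use xy in auto)
  with assms(3) show False by auto
qed

definition monotonic_on :: "'a::order set \<Rightarrow> ('a \<Rightarrow> 'b::order) \<Rightarrow> bool" where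
  "monotonic_on A f \<longleftrightarrow> mono_on A f \<or> antimono_on A f"

lemma monotonic_on_subset: "monotonic_on A f \<Longrightarrow> B \<subseteq> A \<Longrightarrow> monotonic_on B f"
  unfolding monotonic_on_def by (meson monotone_on_subset)

lemma DERIV_nonneg_imp_mono_on:
  fixes f :: "real \<Rightarrow> real"
  assumes "connected I" "\<And>x. x \<in> I \<Longrightarrow> (f has_real_derivative f' x) (at x)"
    "\<And>x. x \<in> I \<Longrightarrow> 0 \<le> f' x"
  shows "mono_on I f"
proof (rule mono_onI)
  fix r s assume rs: "r \<in> I" "s \<in> I" "r \<le> s"
  have "{r..s} \<subseteq> I" by (rule connected_contains_Icc[OF assms(1) rs(1,2)])
  with assms(2,3) show "f r \<le> f s" by (intro DERIV_nonneg_imp_nondecreasing[OF rs(3)]) force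
qed

lemma regular_branch_monotonic:
  fixes R :: "real poly poly"
  defines "R\<^sub>r \<equiv> map_poly pderiv R"
  assumes I: "open I" "connected I" and cont: "continuous_on I \<xi>"
    and root: "\<And>r. r \<in> I \<Longrightarrow> poly2 R (\<xi> r) r = 0"
    and simple: "\<And>r. r \<in> I \<Longrightarrow> poly2 (pderiv R) (\<xi> r) r \<noteq> 0"
    and regular: "R\<^sub>r = 0 \<or> (\<forall>r\<in>I. poly2 R\<^sub>r (\<xi> r) r \<noteq> 0)"
  shows "monotonic_on I \<xi>"
proof -
  define D where "D r = - poly2 R\<^sub>r (\<xi> r) r / poly2 (pderiv R) (\<xi> r) r" for r
  have D: "(\<xi> has_real_derivative D r) (at r)" if "r \<in> I" for r
    unfolding D_def R\<^sub>r_def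
    by (rule implicit_function_DERIV[OF root I(1) that cont simple[OF that]])
  have "(\<forall>r\<in>I. D r \<ge> 0) \<or> (\<forall>r\<in>I. D r \<le> 0)"
  proof (cases "R\<^sub>r = 0")
    case False
    have "continuous_on I D"
      unfolding D_def using cont simple by (intro continuous_intros) auto
    moreover have "D r \<noteq> 0" if "r \<in> I" for r
      using simple[OF that] regular False that by (simp add: D_def)
    ultimately show ?thesis using continuous_nonzero_sign[OF I(2), of D] by (meson less_imp_le)
  qed (simp add: D_def)
  then show ?thesis
  proof
    assume "\<forall>r\<in>I. D r \<ge> 0"
    then have "mono_on I \<xi>" using DERIV_nonneg_imp_mono_on[OF I(2) D] by blast
    then show ?thesis by (simp add: monotonic_on_def)
  next
    assume "\<forall>r\<in>I. D r \<le> 0"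
    then have "mono_on I (\<lambda>r. - \<xi> r)"
      by (intro DERIV_nonneg_imp_mono_on[OF I(2), of _ "\<lambda>r. - D r"] DERIV_minus D) auto
    then show ?thesis by (simp add: monotonic_on_def monotone_on_def)
  qed
qed

definition monotonic_root_branches :: "real poly poly \<Rightarrow> real set \<Rightarrow> (real \<Rightarrow> real) set \<Rightarrow> bool" where
  "monotonic_root_branches R I \<Xi> \<longleftrightarrow> root_branches R I \<Xi> \<and> (\<forall>\<xi>\<in>\<Xi>. monotonic_on I \<xi>)"

lemma monotonic_root_branches_subset:
  assumes "monotonic_root_branches R I \<Xi>" "J \<subseteq> I"
  shows "monotonic_root_branches R J \<Xi>"
  using assms monotonic_on_subset[OF _ assms(2)] continuous_on_subset[OF _ assms(2)]
  unfolding monotonic_root_branches_def root_branches_def by blast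

lemma eventually_at_right_intervalE:
  fixes a :: "'a::{linordered_field,linorder_topology}"
  assumes "\<forall>\<^sub>F x in at_right a. P x"
  obtains b where "b > a" "\<And>x. x \<in> {a<..<b} \<Longrightarrow> P x"
  using assms that unfolding eventually_at_right_field by (metis greaterThanLessThan_iff)

lemma prime_monotonic_root_branches:
  assumes prime: "prime_elem R"
  shows "\<exists>b>a. \<exists>\<Xi>. monotonic_root_branches R {a<..<b} \<Xi>"
proof (cases "degree R = 0")
  case True
  then obtain d where d: "R = [:d:]" by (rule degree_eq_zeroE)
  then have "d \<noteq> 0" using prime by auto
  from eventually_poly_nonzero[OF this] obtain b where "b > a" "\<And>r. r \<in> {a<..<b} \<Longrightarrow> poly d r \<noteq> 0"
    by (rule eventually_at_right_intervalE) blast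
  then show ?thesis
    by (intro exI[of _ b] exI[of _ "{}"])
      (auto simp: monotonic_root_branches_def root_branches_def d slice_roots_def)
next
  case False
  then have deg: "degree R > 0" by simp
  let ?R\<^sub>r = "map_poly pderiv R"
  obtain b where "b > a" and regular: "\<And>r. r \<in> {a<..<b} \<Longrightarrow> poly (lead_coeff R) r \<noteq> 0 \<and>
      slice_roots R r \<inter> slice_roots (pderiv R) r = {} \<and>
      (?R\<^sub>r = 0 \<or> slice_roots R r \<inter> slice_roots ?R\<^sub>r r = {})"
    by (rule eventually_at_right_intervalE[OF prime_elem_eventually_regular[OF prime deg]]) blast
  have "\<exists>\<Xi>. root_branches R {a<..<b} \<Xi>"
    by (rule simple_roots_root_branches) (use regular in \<open>auto simp: disjoint_iff\<close>)
  then obtain \<Xi> where \<Xi>: "root_branches R {a<..<b} \<Xi>" ..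
  have "monotonic_on {a<..<b} \<xi>" if "\<xi> \<in> \<Xi>" for \<xi>
  proof (rule regular_branch_monotonic)
    show "continuous_on {a<..<b} \<xi>" using \<Xi> that by (simp add: root_branches_def)
    show root: "poly2 R (\<xi> r) r = 0" if "r \<in> {a<..<b}" for r
      using \<Xi> \<open>\<xi> \<in> \<Xi>\<close> that unfolding root_branches_def slice_roots_def by blast
    show "poly2 (pderiv R) (\<xi> r) r \<noteq> 0" if "r \<in> {a<..<b}" for r
      using root[OF that] regular[OF that] by (auto simp: disjoint_iff)
    show "?R\<^sub>r = 0 \<or> (\<forall>r\<in>{a<..<b}. poly2 ?R\<^sub>r (\<xi> r) r \<noteq> 0)"
      using root regular by (metis disjoint_iff slice_roots_iff)
  qed auto
  with \<Xi> \<open>b > a\<close> show ?thesis unfolding monotonic_root_branches_def by blast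
qed

theorem eventually_monotonic_root_branches:
  assumes "R \<noteq> 0"
  shows "\<forall>\<^sub>F b in at_right a. \<exists>\<Xi>. monotonic_root_branches R {a<..<b} \<Xi>"
  using assms
proof (induction R rule: prime_divisors_induct)
  case (unit R)
  then obtain S where "1 = R * S" by (auto elim: dvdE)
  then have "poly2 R y r * poly2 S y r = 1" for y r by (metis poly2_1 poly2_mult)
  then have "poly2 R y r \<noteq> 0" for y r by (metis mult_zero_left zero_neq_one)
  then have "monotonic_root_branches R {a<..<b} {}" for b
    by (simp add: monotonic_root_branches_def root_branches_def slice_roots_def)
  then show ?case by (intro always_eventually) blast
next
  case (factor p S)
  obtain c \<Theta> where "c > a" and \<Theta>: "monotonic_root_branches p {a<..<c} \<Theta>"
    using prime_monotonic_root_branches factor.hyps prime_imp_prime_elem by blast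
  have "S \<noteq> 0" using factor.prems by auto
  from factor.IH[OF this] eventually_at_right_real[OF \<open>c > a\<close>] show ?case
  proof eventually_elim
    case (elim b)
    then obtain \<Xi> where "monotonic_root_branches S {a<..<b} \<Xi>" by blast
    moreover have "monotonic_root_branches p {a<..<b} \<Theta>"
      by (rule monotonic_root_branches_subset[OF \<Theta>]) (use elim(2) in auto)
    moreover have "slice_roots (p * S) r = slice_roots p r \<union> slice_roots S r" for r by auto
    ultimately have "monotonic_root_branches (p * S) {a<..<b} (\<Theta> \<union> \<Xi>)"
      unfolding monotonic_root_branches_def root_branches_def by (auto simp del: slice_roots_iff)
    then show ?case ..
  qed
qed simp

section \<open>Algebraic germs\<close>

definition algebraic_germ :: "(real \<Rightarrow> real) \<Rightarrow> bool" where
  "algebraic_germ k \<longleftrightarrow> (\<exists>S. S \<noteq> 0 \<and> (\<forall>\<^sub>F r in at_right 0. poly2 S (k r) r = 0))"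

lemma real_elimination_poly: "real_elimination (poly :: real poly \<Rightarrow> real \<Rightarrow> real)"
  by unfold_locales (auto intro: exI[of _ "[:_:]"])

lemma algebraic_family_degree_reduction:
  fixes R :: "'n::finite \<Rightarrow> real poly poly" and \<xi> :: "'n \<Rightarrow> real \<Rightarrow> real"
  shows "\<exists>M q. degree_reduction poly \<xi> {r. \<forall>j. poly2 (R j) (\<xi> j r) r = 0}
    (\<Prod>j\<in>UNIV. lead_coeff (R j)) M q"
proof -
  interpret real_elimination "poly :: real poly \<Rightarrow> real \<Rightarrow> real" \<xi> by (rule real_elimination_poly)
  define M where "M = (\<Sum>j\<in>UNIV. degree (R j))"
  have degree_le_M: "degree (R j) \<le> M" for j
    unfolding M_def by (rule member_le_sum) auto
  define q where "q j r = poly (- (\<Prod>i\<in>UNIV - {j}. lead_coeff (R i))) r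
      * (\<Sum>k<degree (R j). poly (coeff (R j) k) r * \<xi> j r ^ (k + (Suc M - degree (R j))))" for j r
  have "degree_reduction poly \<xi> {r. \<forall>j. poly2 (R j) (\<xi> j r) r = 0} (\<Prod>j\<in>UNIV. lead_coeff (R j)) M q"
  proof
    fix j
    have "(\<lambda>r. \<xi> j r ^ (k + (Suc M - degree (R j)))) \<in> polys_le M" if "k < degree (R j)" for k
    proof -
      have "(k + (Suc M - degree (R j))) * 1 \<le> M" using that degree_le_M[of j] by simp
      from polys_le_power[OF polys_le_var[OF order_refl]] polys_le_mono[OF this]
      show ?thesis by blast
    qed
    then show "q j \<in> polys_le M"
      unfolding q_def by (intro polys_le_scale polys_le_sum) auto
  next
    fix r j assume "r \<in> {r. \<forall>j. poly2 (R j) (\<xi> j r) r = 0}"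
    then have "poly2 (R j) (\<xi> j r) r = 0" by simp
    then have top: "poly (lead_coeff (R j)) r * \<xi> j r ^ degree (R j)
        = - (\<Sum>k<degree (R j). poly (coeff (R j) k) r * \<xi> j r ^ k)"
      by (simp add: poly2_altdef lessThan_Suc_atMost[symmetric] eq_neg_iff_add_eq_0 add.commute)
    have "poly (\<Prod>j\<in>UNIV. lead_coeff (R j)) r * \<xi> j r ^ Suc M
        = poly (\<Prod>i\<in>UNIV - {j}. lead_coeff (R i)) r
          * ((poly (lead_coeff (R j)) r * \<xi> j r ^ degree (R j)) * \<xi> j r ^ (Suc M - degree (R j)))"
      using degree_le_M[of j]
      by (simp del: power_Suc add: prod.remove[of UNIV j] power_add[symmetric] mult_ac)
    also have "\<dots> = q j r"
      unfolding top q_def by (simp add: sum_distrib_left sum_negf power_add mult_ac)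
    finally show "poly (\<Prod>j\<in>UNIV. lead_coeff (R j)) r * \<xi> j r ^ Suc M = q j r" .
  qed
  then show ?thesis by blast
qed

lemma algebraic_germ_polyfun:
  fixes p :: "real^'n \<Rightarrow> real" and \<xi> :: "'n \<Rightarrow> real \<Rightarrow> real"
  assumes germ: "\<And>j. algebraic_germ (\<xi> j)" and p: "polyfun p"
  shows "algebraic_germ (\<lambda>r. p (\<chi> j. \<xi> j r))"
proof -
  obtain R where R: "\<And>j. R j \<noteq> 0" "\<And>j. \<forall>\<^sub>F r in at_right 0. poly2 (R j) (\<xi> j r) r = 0"
    using germ unfolding algebraic_germ_def by metis
  let ?l = "\<Prod>j\<in>UNIV. lead_coeff (R j)" and ?S = "{r. \<forall>j. poly2 (R j) (\<xi> j r) r = 0}"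
  obtain M q where reduction: "degree_reduction poly \<xi> ?S ?l M q"
    using algebraic_family_degree_reduction[of \<xi> R] by blast
  interpret real_elimination poly \<xi> by (rule real_elimination_poly)
  interpret degree_reduction poly \<xi> ?S ?l M q by (rule reduction)
  obtain d where "poly_deg_le d p" using p by (auto simp: polyfun_def)
  from polys_le_algebraic[OF poly_deg_le_polys_le[OF this]] obtain P where "P \<noteq> 0"
    and P: "\<forall>r\<in>?S. poly ?l r \<noteq> 0 \<longrightarrow> poly2 P (p (\<chi> j. \<xi> j r)) r = 0"
    unfolding poly2_altdef by blast
  have "\<forall>\<^sub>F r in at_right 0. poly ?l r \<noteq> 0"
    by (rule eventually_poly_nonzero) (simp add: R(1))
  moreover have "\<forall>\<^sub>F r in at_right 0. r \<in> ?S"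
    using R(2) by (simp add: eventually_all_finite)
  ultimately have "\<forall>\<^sub>F r in at_right 0. poly2 P (p (\<chi> j. \<xi> j r)) r = 0"
    by eventually_elim (use P in blast)
  with \<open>P \<noteq> 0\<close> show ?thesis unfolding algebraic_germ_def by blast
qed

lemma algebraic_germ_poly2D:
  assumes "algebraic_germ (\<lambda>r. poly2 q (k r) r)" "degree q > 0"
  shows "algebraic_germ k"
proof -
  obtain S where "S \<noteq> 0" "\<forall>\<^sub>F r in at_right 0. poly2 S (poly2 q (k r) r) r = 0"
    using assms(1) unfolding algebraic_germ_def by blast
  then show ?thesis
    unfolding algebraic_germ_def using assms(2)
    by (intro exI[of _ "pcompose S q"]) (simp add: pcompose_eq_0_iff poly2_pcompose)
qed

lemma poly2_reflect_poly:
  fixes y :: "'a::field"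
  assumes "y \<noteq> 0"
  shows "poly2 (reflect_poly R) y r = y ^ degree R * poly2 R (inverse y) r"
proof (induction R)
  case (pCons c R)
  show ?case
  proof (cases "R = 0")
    case False
    then show ?thesis
      using pCons.IH assms by (simp add: reflect_poly_pCons' poly2_def poly_monom field_simps)
  qed (simp add: poly2_def)
qed simp

lemma algebraic_germ_inverse:
  assumes "algebraic_germ k" "\<forall>\<^sub>F r in at_right 0. k r \<noteq> 0"
  shows "algebraic_germ (\<lambda>r. inverse (k r))"
proof -
  obtain S where S: "S \<noteq> 0" "\<forall>\<^sub>F r in at_right 0. poly2 S (k r) r = 0"
    using assms(1) unfolding algebraic_germ_def by blast
  from S(2) assms(2) have "\<forall>\<^sub>F r in at_right 0. poly2 (reflect_poly S) (inverse (k r)) r = 0"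
    by eventually_elim (simp add: poly2_reflect_poly)
  with S(1) show ?thesis
    unfolding algebraic_germ_def by (intro exI[of _ "reflect_poly S"]) simp
qed

lemma connected_sgn_constant:
  fixes u v :: "'a::topological_space \<Rightarrow> real"
  assumes S: "connected S" and cont: "continuous_on S u" "continuous_on S v"
    and exclusive: "\<And>x. x \<in> S \<Longrightarrow> u x = 0 \<longleftrightarrow> v x \<noteq> 0"
  shows "\<exists>\<sigma>. \<forall>x\<in>S. sgn (u x) = \<sigma>"
proof -
  let ?U = "{x \<in> S. u x = 0}" and ?V = "{x \<in> S. v x = 0}"
  have "closedin (top_of_set S) ?U" "closedin (top_of_set S) ?V"
    by (intro continuous_closedin_preimage_constant cont)+
  moreover have "?U \<inter> ?V = {}" "S \<subseteq> ?U \<union> ?V" using exclusive by auto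
  ultimately have "?V = {} \<or> ?U = {}" using S unfolding connected_closedin by blast
  then show ?thesis
  proof
    assume "?V = {}"
    then have "\<forall>x\<in>S. sgn (u x) = 0" using exclusive by auto
    then show ?thesis ..
  next
    assume "?U = {}"
    then have "u x \<noteq> 0" if "x \<in> S" for x using that by blast
    from continuous_nonzero_sign[OF S cont(1) this] show ?thesis by (metis sgn_pos sgn_neg)
  qed
qed

lemma algebraic_germ_sgn_eventually_const:
  assumes "\<epsilon> > 0" "continuous_on {0<..<\<epsilon>} k" "algebraic_germ k"
  shows "\<exists>\<sigma>. \<forall>\<^sub>F r in at_right 0. sgn (k r) = \<sigma>"
proof -
  obtain S where S: "S \<noteq> 0" "\<forall>\<^sub>F r in at_right 0. poly2 S (k r) r = 0"
    using assms(3) unfolding algebraic_germ_def by blast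
  obtain n T where S_eq: "S = [:0, 1:] ^ n * T" and "\<not> [:0, 1:] dvd T"
    using order_decomp[OF S(1), of 0] by auto
  then have T: "coeff T 0 \<noteq> 0" using poly_eq_0_iff_dvd[of T 0] by (simp add: poly_0_coeff_0)
  have "\<forall>\<^sub>F r in at_right 0. poly2 S (k r) r = 0 \<and> poly (coeff T 0) r \<noteq> 0 \<and> r \<in> {0<..<\<epsilon>}"
    by (intro eventually_conj S eventually_poly_nonzero T eventually_at_right_real assms(1))
  then obtain \<epsilon>' where "\<epsilon>' > 0" and nearby: "\<And>r. r \<in> {0<..<\<epsilon>'} \<Longrightarrow>
      poly2 S (k r) r = 0 \<and> poly (coeff T 0) r \<noteq> 0 \<and> r \<in> {0<..<\<epsilon>}"
    by (rule eventually_at_right_intervalE) blast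
  have cont: "continuous_on {0<..<\<epsilon>'} k"
    by (rule continuous_on_subset[OF assms(2)]) (use nearby in blast)
  have "\<exists>\<sigma>. \<forall>r\<in>{0<..<\<epsilon>'}. sgn (k r) = \<sigma>"
  proof (rule connected_sgn_constant[where v = "\<lambda>r. poly2 T (k r) r"])
    fix r assume r: "r \<in> {0<..<\<epsilon>'}"
    have "poly2 T 0 r = poly (coeff T 0) r" by (simp add: poly2_def poly_0_coeff_0)
    with nearby[OF r] show "k r = 0 \<longleftrightarrow> poly2 T (k r) r \<noteq> 0" by (auto simp: S_eq)
  qed (auto intro!: continuous_intros cont)
  then obtain \<sigma> where "\<forall>r\<in>{0<..<\<epsilon>'}. sgn (k r) = \<sigma>" ..
  then have "\<forall>\<^sub>F r in at_right 0. sgn (k r) = \<sigma>"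
    by (intro eventually_mono[OF eventually_at_right_real[OF \<open>\<epsilon>' > 0\<close>]]) blast
  then show ?thesis ..
qed

lemma smult_monom_decomp:
  fixes p :: "'a::idom poly poly"
  assumes "p \<noteq> 0"
  obtains n q where "p = smult (monom 1 n) q" "map_poly (\<lambda>c. coeff c 0) q \<noteq> 0"
proof -
  define P where "P n \<longleftrightarrow> (\<exists>k. coeff (coeff p k) n \<noteq> 0)" for n
  define n where "n = (LEAST n. P n)"
  have "\<exists>n. P n" using assms unfolding P_def by (metis poly_eqI coeff_0)
  then have n: "P n" and least: "\<And>m. m < n \<Longrightarrow> \<not> P m"
    unfolding n_def by (auto intro: LeastI dest: not_less_Least)
  define q where "q = map_poly (poly_shift n) p"
  have "p = smult (monom 1 n) q"
    using least
    by (intro poly_eqI) (auto simp: q_def P_def coeff_map_poly coeff_monom_mult coeff_poly_shift)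
  moreover obtain k where "coeff (coeff p k) n \<noteq> 0" using n by (auto simp: P_def)
  then have "coeff (map_poly (\<lambda>c. coeff c 0) q) k \<noteq> 0"
    by (simp add: q_def coeff_map_poly coeff_poly_shift)
  then have "map_poly (\<lambda>c. coeff c 0) q \<noteq> 0" by auto
  ultimately show thesis by (rule that)
qed

lemma poly2_split_constant:
  "poly2 R y r = poly (map_poly (\<lambda>c. coeff c 0) R) y + r * poly2 (map_poly (poly_shift 1) R) y r"
proof (induction R)
  case (pCons c R)
  have "c = pCons (coeff c 0) (poly_shift 1 c)"
    by (rule poly_eqI) (simp add: coeff_pCons coeff_poly_shift split: nat.split)
  then have "poly c r = coeff c 0 + r * poly (poly_shift 1 c) r" by (metis poly_pCons)
  then show ?case using pCons.IH by (simp add: map_poly_pCons algebra_simps)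
qed simp

lemma algebraic_germ_lowest_order:
  assumes "algebraic_germ y"
  obtains p Q where "p \<noteq> 0" "\<forall>\<^sub>F r in at_right 0. poly p (y r) = - (r * poly2 Q (y r) r)"
proof -
  obtain S where S: "S \<noteq> 0" "\<forall>\<^sub>F r in at_right 0. poly2 S (y r) r = 0"
    using assms unfolding algebraic_germ_def by blast
  obtain n T where S_eq: "S = smult (monom 1 n) T" and nz: "map_poly (\<lambda>c. coeff c 0) T \<noteq> 0"
    using smult_monom_decomp[OF S(1)] by blast
  from S(2) eventually_at_right_less[of 0]
  have "\<forall>\<^sub>F r in at_right 0. poly (map_poly (\<lambda>c. coeff c 0) T) (y r)
      = - (r * poly2 (map_poly (poly_shift 1) T) (y r) r)"
    by eventually_elim (simp add: S_eq poly_monom poly2_split_constant[of T] eq_neg_iff_add_eq_0)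
  with nz show thesis by (rule that)
qed

lemma algebraic_germ_power_le:
  assumes "algebraic_germ y" and y_lim: "(y \<longlongrightarrow> 0) (at_right 0)"
  obtains m C where "C > 0" "\<forall>\<^sub>F r in at_right 0. \<bar>y r\<bar> ^ m \<le> C * r"
proof -
  let ?F = "at_right (0::real)"
  obtain p Q where p_nz: "p \<noteq> 0" and pQ: "\<forall>\<^sub>F r in ?F. poly p (y r) = - (r * poly2 Q (y r) r)"
    by (rule algebraic_germ_lowest_order[OF assms(1)])
  obtain m g where p_eq: "p = [:0, 1:] ^ m * g" and "\<not> [:0, 1:] dvd g"
    using order_decomp[OF p_nz, of 0] by auto
  then have g_0: "poly g 0 \<noteq> 0" using poly_eq_0_iff_dvd[of g 0] by simp
  define B where "B = \<bar>poly2 Q 0 0\<bar> + 1"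
  have "((\<lambda>r. \<bar>poly2 Q (y r) r\<bar>) \<longlongrightarrow> \<bar>poly2 Q 0 0\<bar>) ?F"
    by (intro tendsto_intros y_lim tendsto_ident_at)
  then have Q_less: "\<forall>\<^sub>F r in ?F. \<bar>poly2 Q (y r) r\<bar> < B"
    by (rule order_tendstoD) (simp add: B_def)
  define c where "c = \<bar>poly g 0\<bar> / 2"
  have "c > 0" "c < \<bar>poly g 0\<bar>" using g_0 by (auto simp: c_def)
  have "((\<lambda>r. \<bar>poly g (y r)\<bar>) \<longlongrightarrow> \<bar>poly g 0\<bar>) ?F" by (intro tendsto_intros y_lim)
  from order_tendstoD(1)[OF this \<open>c < \<bar>poly g 0\<bar>\<close>] pQ Q_less eventually_at_right_less[of 0]
  have "\<forall>\<^sub>F r in ?F. \<bar>y r\<bar> ^ m \<le> B / c * r"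
  proof eventually_elim
    case (elim r)
    have "y r ^ m * poly g (y r) = - (r * poly2 Q (y r) r)" using elim(2) by (simp add: p_eq)
    from arg_cong[OF this, of abs]
    have "\<bar>y r\<bar> ^ m * \<bar>poly g (y r)\<bar> = r * \<bar>poly2 Q (y r) r\<bar>"
      using elim(4) by (simp add: abs_mult power_abs)
    moreover have "\<bar>y r\<bar> ^ m * c \<le> \<bar>y r\<bar> ^ m * \<bar>poly g (y r)\<bar>"
      using elim(1) by (intro mult_left_mono) auto
    moreover have "r * \<bar>poly2 Q (y r) r\<bar> \<le> r * B" using elim by (intro mult_left_mono) auto
    ultimately show ?case using \<open>c > 0\<close> by (simp add: field_simps)
  qed
  moreover have "B / c > 0" using \<open>c > 0\<close> by (simp add: B_def add_nonneg_pos)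
  ultimately show thesis using that by blast
qed

lemma algebraic_germ_powr_upper_bound:
  assumes "algebraic_germ y" "(y \<longlongrightarrow> 0) (at_right 0)"
  shows "\<exists>\<delta>>0. \<forall>\<^sub>F r in at_right 0. \<bar>y r\<bar> \<le> r powr \<delta>"
proof -
  obtain m C where "C > 0" and bound: "\<forall>\<^sub>F r in at_right 0. \<bar>y r\<bar> ^ m \<le> C * r"
    using algebraic_germ_power_le[OF assms] .
  have small: "\<forall>\<^sub>F r in at_right 0. C * r < r powr (1 / 2)" using \<open>C > 0\<close> by real_asymp
  have "m \<noteq> 0"
  proof
    assume "m = 0"
    have "\<forall>\<^sub>F r::real in at_right 0. r powr (1 / 2) < 1" by real_asymp
    with bound small have "\<forall>\<^sub>F r::real in at_right 0. False"
      by eventually_elim (simp add: \<open>m = 0\<close>)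
    then show False by simp
  qed
  from bound small eventually_at_right_less[of 0]
  have "\<forall>\<^sub>F r in at_right 0. \<bar>y r\<bar> \<le> r powr (1 / (2 * real m))"
  proof eventually_elim
    case (elim r)
    then have "\<bar>y r\<bar> ^ m \<le> r powr (1 / 2)" by linarith
    also have "\<dots> = (r powr (1 / (2 * real m))) ^ m" using \<open>m \<noteq> 0\<close> elim by (simp add: powr_power)
    finally show ?case using \<open>m \<noteq> 0\<close> by (simp add: power_mono_iff)
  qed
  then show ?thesis using \<open>m \<noteq> 0\<close> by (intro exI[of _ "1 / (2 * real m)"]) simp
qed

lemma algebraic_germ_powr_lower_bound:
  assumes "algebraic_germ k" and large: "\<And>C. \<forall>\<^sub>F r in at_right 0. k r > C * r\<^sup>2"
  shows "\<exists>\<delta>>0. \<forall>\<^sub>F r in at_right 0. r powr (2 - \<delta>) \<le> k r"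
proof -
  let ?F = "at_right (0::real)"
  have pos: "\<forall>\<^sub>F r in ?F. k r > 0" using large[of 0] by simp
  obtain S where "S \<noteq> 0" "\<forall>\<^sub>F r in ?F. poly2 S (k r) r = 0"
    using assms(1) unfolding algebraic_germ_def by blast
  from this(2) eventually_at_right_less[of 0]
  have "\<forall>\<^sub>F r in ?F. poly2 S (poly2 [:0, monom 1 2:] (k r / r\<^sup>2) r) r = 0"
    by eventually_elim (simp add: poly_monom)
  with \<open>S \<noteq> 0\<close> have "algebraic_germ (\<lambda>r. poly2 [:0, monom 1 2:] (k r / r\<^sup>2) r)"
    unfolding algebraic_germ_def by blast
  then have "algebraic_germ (\<lambda>r. k r / r\<^sup>2)" by (rule algebraic_germ_poly2D) simp
  moreover have "\<forall>\<^sub>F r in ?F. k r / r\<^sup>2 \<noteq> 0"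
    using pos eventually_at_right_less[of 0] by eventually_elim simp
  ultimately have "algebraic_germ (\<lambda>r. inverse (k r / r\<^sup>2))" by (rule algebraic_germ_inverse)
  moreover have "((\<lambda>r. inverse (k r / r\<^sup>2)) \<longlongrightarrow> 0) ?F"
  proof (rule tendstoI)
    fix e :: real assume "e > 0"
    from large[of "1 / e"] pos show "\<forall>\<^sub>F r in ?F. dist (inverse (k r / r\<^sup>2)) 0 < e"
      by eventually_elim (use \<open>e > 0\<close> in \<open>simp add: dist_real_def field_simps\<close>)
  qed
  ultimately obtain \<delta> where "\<delta> > 0" and \<delta>: "\<forall>\<^sub>F r in ?F. \<bar>inverse (k r / r\<^sup>2)\<bar> \<le> r powr \<delta>"
    using algebraic_germ_powr_upper_bound by blast
  from \<delta> pos eventually_at_right_less[of 0] have "\<forall>\<^sub>F r in ?F. r powr (2 - \<delta>) \<le> k r"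
  proof eventually_elim
    case (elim r)
    then have "r\<^sup>2 \<le> r powr \<delta> * k r" by (simp add: field_simps)
    moreover have "r powr (2 - \<delta>) * r powr \<delta> = r\<^sup>2"
      using elim(3) by (simp add: powr_add[symmetric])
    ultimately have "r powr (2 - \<delta>) * r powr \<delta> \<le> k r * r powr \<delta>" by (simp add: mult.commute)
    then show ?case using elim(3) by simp
  qed
  with \<open>\<delta> > 0\<close> show ?thesis by blast
qed

section \<open>Algebraic minimizers\<close>

lemma continuous_attains_min_of_bounded_sublevel:
  fixes f :: "'a::heine_borel \<Rightarrow> real"
  assumes cont: "continuous_on UNIV f" and bdd: "bounded {x. f x \<le> f a}"
  shows "\<exists>x. \<forall>y. f x \<le> f y"
proof -
  have "closed {x. f x \<le> f a}" by (intro closed_Collect_le cont continuous_intros)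
  with bdd have "compact {x. f x \<le> f a}" by (simp add: compact_eq_bounded_closed)
  then obtain x where x: "f x \<le> f a" "\<And>y. f y \<le> f a \<Longrightarrow> f x \<le> f y"
    using continuous_attains_inf[of "{x. f x \<le> f a}" f] continuous_on_subset[OF cont] by auto
  have "f x \<le> f y" for y using x(1) x(2)[of y] by linarith
  then show ?thesis by blast
qed

locale penalty_method =
  fixes F G H T :: "'a::heine_borel \<Rightarrow> real"
  assumes continuous_F: "continuous_on UNIV F" and continuous_G: "continuous_on UNIV G"
    and continuous_H: "continuous_on UNIV H" and continuous_T: "continuous_on UNIV T"
    and G_nonneg: "0 \<le> G x" and H_nonneg: "0 \<le> H x" and T_nonneg: "0 \<le> T x"
    and T_coercive: "bounded {x. T x \<le> c}"
begin

definition penalized :: "real \<Rightarrow> real \<Rightarrow> 'a \<Rightarrow> real" where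
  "penalized r e x = e * H x + (F x - r)\<^sup>2 + G x + e\<^sup>2 * T x"

lemma penalized_minimizer_exists:
  assumes "e > 0"
  shows "\<exists>x. \<forall>y. penalized r e x \<le> penalized r e y"
proof (rule continuous_attains_min_of_bounded_sublevel)
  show "continuous_on UNIV (penalized r e)"
    unfolding penalized_def
    by (intro continuous_intros continuous_F continuous_G continuous_H continuous_T)
  fix a
  have "T x \<le> penalized r e a / e\<^sup>2" if "penalized r e x \<le> penalized r e a" for x
  proof -
    have "0 \<le> e * H x" "0 \<le> (F x - r)\<^sup>2" "0 \<le> G x" using G_nonneg H_nonneg assms by simp_all
    with that have "e\<^sup>2 * T x \<le> penalized r e a" unfolding penalized_def[of r e x] by linarith
    then show ?thesis using assms by (simp add: field_simps)
  qed
  then have "{x. penalized r e x \<le> penalized r e a} \<subseteq> {x. T x \<le> penalized r e a / e\<^sup>2}" by blast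
  then show "bounded {x. penalized r e x \<le> penalized r e a}"
    by (rule bounded_subset[OF T_coercive])
qed

lemma penalized_minimizer_penalty_le:
  assumes "e > 0" "\<And>y. penalized r e x \<le> penalized r e y" "F x0 = r" "G x0 = 0"
  shows "(F x - r)\<^sup>2 + G x \<le> e * H x0 + e\<^sup>2 * T x0"
proof -
  have "0 \<le> e * H x" "0 \<le> e\<^sup>2 * T x" using assms(1) H_nonneg T_nonneg by simp_all
  then show ?thesis using assms(2)[of x0] assms(3,4) by (simp add: penalized_def)
qed

lemma penalized_minimizers_subsequence:
  assumes bdd: "bounded {x. G x \<le> 1}" and e: "\<And>n. 0 < e n" "e \<longlonglongrightarrow> 0"
    and minimal: "\<And>n y. penalized r (e n) (x n) \<le> penalized r (e n) y"
    and feasible: "F x0 = r" "G x0 = 0"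
  obtains l \<phi> where "strict_mono (\<phi> :: nat \<Rightarrow> nat)" "(\<lambda>n. x (\<phi> n)) \<longlonglongrightarrow> l"
proof -
  have "(\<lambda>n. e n * H x0 + (e n)\<^sup>2 * T x0) \<longlonglongrightarrow> 0"
    using e(2) by (auto intro!: tendsto_eq_intros)
  from order_tendstoD(2)[OF this zero_less_one]
  obtain N where N: "\<And>n. n \<ge> N \<Longrightarrow> e n * H x0 + (e n)\<^sup>2 * T x0 < 1"
    by (auto simp: eventually_sequentially)
  have "x (n + N) \<in> {x. G x \<le> 1}" for n
    using penalized_minimizer_penalty_le[OF e(1) minimal feasible, of "n + N"] N[of "n + N"]
      zero_le_power2[of "F (x (n + N)) - r"]
    unfolding mem_Collect_eq by linarith
  moreover have "seq_compact {x. G x \<le> 1}"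
    by (intro bounded_closed_imp_seq_compact bdd closed_Collect_le continuous_G continuous_intros)
  ultimately obtain l \<psi> where "strict_mono \<psi>" "((\<lambda>n. x (n + N)) \<circ> \<psi>) \<longlonglongrightarrow> l"
    unfolding seq_compact_def by meson
  then show thesis by (intro that[of "\<lambda>n. \<psi> n + N" l]) (auto simp: strict_mono_def o_def)
qed

lemma limit_of_penalized_minimizers:
  assumes e: "\<And>n. 0 < e n" "e \<longlonglongrightarrow> 0" and x_lim: "x \<longlonglongrightarrow> l"
    and minimal: "\<And>n y. penalized r (e n) (x n) \<le> penalized r (e n) y"
    and feasible: "F x0 = r" "G x0 = 0"
  shows "F l = r" "G l = 0" "\<And>y. F y = r \<Longrightarrow> G y = 0 \<Longrightarrow> H l \<le> H y"
proof -
  have compose_lim: "(\<lambda>n. f (x n)) \<longlonglongrightarrow> f l" if "continuous_on UNIV f" for f :: "'a \<Rightarrow> real"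
    using continuous_on_tendsto_compose[OF that x_lim] by simp
  have "(F l - r)\<^sup>2 + G l \<le> 0"
  proof (rule LIMSEQ_le)
    show "(\<lambda>n. (F (x n) - r)\<^sup>2 + G (x n)) \<longlonglongrightarrow> (F l - r)\<^sup>2 + G l"
      by (intro tendsto_intros compose_lim continuous_F continuous_G)
    show "(\<lambda>n. e n * H x0 + (e n)\<^sup>2 * T x0) \<longlonglongrightarrow> 0"
      using e(2) by (auto intro!: tendsto_eq_intros)
  qed (use penalized_minimizer_penalty_le[OF e(1) minimal feasible] in blast)
  then show "F l = r" "G l = 0"
    using G_nonneg[of l] by (simp_all add: add_nonneg_eq_0_iff order_antisym_conv)
  fix y assume y: "F y = r" "G y = 0"
  have "H (x n) \<le> H y + e n * T y" for n
  proof -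
    have "0 \<le> (e n)\<^sup>2 * T (x n)" using T_nonneg by simp
    then have "e n * H (x n) \<le> e n * (H y + e n * T y)"
      using minimal[of n y] y G_nonneg[of "x n"] zero_le_power2[of "F (x n) - r"]
      by (simp add: penalized_def power2_eq_square algebra_simps)
    then show ?thesis using e(1)[of n] by simp
  qed
  moreover have "(\<lambda>n. H y + e n * T y) \<longlonglongrightarrow> H y + 0 * T y" by (intro tendsto_intros e(2))
  ultimately have "H l \<le> H y + 0 * T y" using LIMSEQ_le[OF compose_lim[OF continuous_H]] by blast
  then show "H l \<le> H y" by simp
qed

end

lemma bounded_vec_le:
  fixes S :: "(real^'n) set"
  assumes "\<And>x j. x \<in> S \<Longrightarrow> \<bar>x $ j\<bar> \<le> B"
  shows "bounded S"
proof (rule boundedI)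
  fix x assume "x \<in> S"
  have "norm x \<le> (\<Sum>j\<in>UNIV. \<bar>x $ j\<bar>)" by (rule norm_le_l1_cart)
  also have "\<dots> \<le> (\<Sum>j\<in>(UNIV :: 'n set). B)" by (intro sum_mono assms \<open>x \<in> S\<close>)
  finally show "norm x \<le> (\<Sum>j\<in>(UNIV :: 'n set). B)" .
qed

definition even_power_sum :: "nat \<Rightarrow> real^'n \<Rightarrow> real" where
  "even_power_sum d x = (\<Sum>j\<in>UNIV. (x $ j) ^ (2 * Suc d))"

lemma even_power_sum_nonneg: "0 \<le> even_power_sum d x"
  unfolding even_power_sum_def by (intro sum_nonneg zero_le_even_power) simp

lemma bounded_even_power_sum_le: "bounded {x :: real^'n. even_power_sum d x \<le> c}"
proof (rule bounded_vec_le)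
  fix x :: "real^'n" and j assume "x \<in> {x. even_power_sum d x \<le> c}"
  moreover have "(x $ j) ^ (2 * Suc d) \<le> even_power_sum d x"
    unfolding even_power_sum_def
    by (rule member_le_sum) (simp_all add: zero_le_even_power del: power_Suc mult_Suc_right)
  ultimately have "\<bar>x $ j\<bar> ^ (2 * Suc d) \<le> c" by (simp add: power_even_abs)
  moreover have "\<bar>x $ j\<bar> \<le> max 1 (\<bar>x $ j\<bar> ^ (2 * Suc d))"
    using power_increasing[of 1 "2 * Suc d" "\<bar>x $ j\<bar>"] by (cases "\<bar>x $ j\<bar> \<le> 1") auto
  ultimately show "\<bar>x $ j\<bar> \<le> max 1 c" by linarith
qed

lemma GDERIV_even_power_sum:
  "GDERIV (even_power_sum d) x :> (\<chi> j. real (2 * Suc d) * (x $ j) ^ Suc (2 * d))"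
proof -
  have "((\<lambda>t. t ^ (2 * Suc d)) has_real_derivative real (2 * Suc d) * t ^ Suc (2 * d)) (at t)"
    for t :: real
    using DERIV_pow[of "2 * Suc d" t] by simp
  from GDERIV_sum[OF GDERIV_DERIV_compose[OF GDERIV_vec_nth this]]
  have "GDERIV (even_power_sum d) x :>
      (\<Sum>j\<in>UNIV. (real (2 * Suc d) * (x $ j) ^ Suc (2 * d)) *\<^sub>R axis j 1)"
    unfolding even_power_sum_def .
  also have "(\<Sum>j\<in>UNIV. (real (2 * Suc d) * (x $ j) ^ Suc (2 * d)) *\<^sub>R axis j 1)
      = (\<chi> j. real (2 * Suc d) * (x $ j) ^ Suc (2 * d))"
    by (simp add: vec_eq_iff axis_def if_distrib sum.delta cong: if_cong)
  finally show ?thesis .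
qed

locale polynomial_penalty =
  fixes F G H :: "real^'n \<Rightarrow> real" and DF DG DH :: "real^'n \<Rightarrow> real^'n" and d :: nat
  assumes GDERIV_F: "GDERIV F x :> DF x" and GDERIV_G: "GDERIV G x :> DG x"
    and GDERIV_H: "GDERIV H x :> DH x"
    and degree_F: "poly_deg_le d F" and degree_DF: "poly_deg_le d (\<lambda>x. DF x $ j)"
    and degree_DG: "poly_deg_le d (\<lambda>x. DG x $ j)" and degree_DH: "poly_deg_le d (\<lambda>x. DH x $ j)"
    and G_nonneg: "0 \<le> G x" and H_nonneg: "0 \<le> H x"
begin

sublocale penalty_method F G H "even_power_sum d"
  by unfold_locales
    (auto intro: GDERIV_continuous_on GDERIV_F GDERIV_G GDERIV_H GDERIV_even_power_sum
      G_nonneg H_nonneg even_power_sum_nonneg bounded_even_power_sum_le)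

text \<open>The term \<open>e\<^sup>2 x\<^sub>j ^ (2 d + 1)\<close> coming from the coercive part dominates the right-hand side,
  which has degree \<open>2 d\<close>; this is what makes elimination applicable.\<close>

definition critical :: "real \<Rightarrow> real \<Rightarrow> real^'n \<Rightarrow> bool" where
  "critical r e x \<longleftrightarrow> (\<forall>j. e\<^sup>2 * real (2 * Suc d) * (x $ j) ^ Suc (2 * d) =
    - (e * DH x $ j + 2 * (F x - r) * DF x $ j + DG x $ j))"

lemma GDERIV_penalized:
  "GDERIV (penalized r e) x :> e *\<^sub>R DH x + (2 * (F x - r)) *\<^sub>R DF x + DG x
    + e\<^sup>2 *\<^sub>R (\<chi> j. real (2 * Suc d) * (x $ j) ^ Suc (2 * d))"
proof -
  have const_mult: "GDERIV (\<lambda>x. c * f x) x :> c *\<^sub>R Df" if "GDERIV f x :> Df" for c f Df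
    using GDERIV_mult[OF GDERIV_const[of c] that] by simp
  have "((\<lambda>t::real. t\<^sup>2) has_real_derivative 2 * t) (at t)" for t
    using DERIV_pow[of 2 t] by simp
  from GDERIV_DERIV_compose[OF GDERIV_diff[OF GDERIV_F GDERIV_const] this]
  have "GDERIV (\<lambda>x. (F x - r)\<^sup>2) x :> (2 * (F x - r)) *\<^sub>R DF x" by simp
  then show ?thesis
    unfolding penalized_def
    by (intro GDERIV_add const_mult GDERIV_H GDERIV_G GDERIV_even_power_sum)
qed

lemma penalized_minimizer_critical:
  assumes "\<And>y. penalized r e x \<le> penalized r e y"
  shows "critical r e x"
  unfolding critical_def
proof
  fix j
  from GDERIV_global_min[OF GDERIV_penalized assms]
  have "(e *\<^sub>R DH x + (2 * (F x - r)) *\<^sub>R DF x + DG x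
      + e\<^sup>2 *\<^sub>R (\<chi> j. real (2 * Suc d) * (x $ j) ^ Suc (2 * d))) $ j = 0" by simp
  then have "e * DH x $ j + 2 * (F x - r) * DF x $ j + DG x $ j
      + e\<^sup>2 * (real (2 * Suc d) * (x $ j) ^ Suc (2 * d)) = 0"
    unfolding vector_add_component vector_scaleR_component vec_lambda_beta real_scaleR_def .
  then show "e\<^sup>2 * real (2 * Suc d) * (x $ j) ^ Suc (2 * d) =
      - (e * DH x $ j + 2 * (F x - r) * DF x $ j + DG x $ j)"
    unfolding mult.assoc by linarith
qed

definition ev :: "real poly poly \<Rightarrow> (real^'n) \<times> real \<times> real \<Rightarrow> real" where
  "ev c = (\<lambda>(x, r, e). poly2 c e r)"

definition coord :: "'n \<Rightarrow> (real^'n) \<times> real \<times> real \<Rightarrow> real" where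
  "coord j = (\<lambda>(x, r, e). x $ j)"

sublocale real_elimination ev coord
  by unfold_locales (auto simp: ev_def intro: exI[of _ "[:[:_:]:]"])

lemma poly_deg_le_fst_polys_le: "poly_deg_le k f \<Longrightarrow> (\<lambda>(x, r, e). f x) \<in> polys_le k"
  using poly_deg_le_polys_le[of k f] by (simp add: coord_def case_prod_unfold)

lemma critical_degree_reduction:
  "degree_reduction ev coord {(x, r, e). critical r e x} [:0, 0, [:real (2 * Suc d):]:] (2 * d)
    (\<lambda>j (x, r, e). - (e * DH x $ j + 2 * (F x - r) * DF x $ j + DG x $ j))"
proof
  fix j
  have level: "(\<lambda>(x, r, e). F x - r) \<in> polys_le d"
    using polys_le_add[OF poly_deg_le_fst_polys_le[OF degree_F] polys_le_ev[of "[:[:0, -1:]:]"]]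
    by (simp add: ev_def case_prod_unfold)
  have mono: "polys_le d \<subseteq> polys_le (2 * d)" by (rule polys_le_mono) simp
  have "(\<lambda>(x, r, e). e * DH x $ j) \<in> polys_le (2 * d)"
    using polys_le_scale[OF poly_deg_le_fst_polys_le[OF degree_DH], of "[:0, 1:]"] mono
    by (auto simp: ev_def case_prod_unfold)
  moreover have "(\<lambda>(x, r, e). 2 * (F x - r) * DF x $ j) \<in> polys_le (2 * d)"
    using polys_le_scale[OF polys_le_mult[OF level poly_deg_le_fst_polys_le[OF degree_DF]],
        of "[:[:2:]:]"]
    by (simp add: ev_def case_prod_unfold mult.assoc del: right_diff_distrib_numeral flip: mult_2)
  moreover have "(\<lambda>(x, r, e). DG x $ j) \<in> polys_le (2 * d)"
    using poly_deg_le_fst_polys_le[OF degree_DG] mono by blast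
  ultimately have "(\<lambda>s. ev [:[:-1:]:] s * ((\<lambda>(x, r, e). e * DH x $ j) s
      + (\<lambda>(x, r, e). 2 * (F x - r) * DF x $ j) s + (\<lambda>(x, r, e). DG x $ j) s)) \<in> polys_le (2 * d)"
    by (intro polys_le_scale polys_le_add)
  then show "(\<lambda>(x, r, e). - (e * DH x $ j + 2 * (F x - r) * DF x $ j + DG x $ j))
      \<in> polys_le (2 * d)"
    by (simp add: ev_def case_prod_unfold)
next
  fix s :: "(real^'n) \<times> real \<times> real" and j
  assume "s \<in> {(x, r, e). critical r e x}"
  then show "ev [:0, 0, [:real (2 * Suc d):]:] s * coord j s ^ Suc (2 * d)
      = (case s of (x, r, e) \<Rightarrow> - (e * DH x $ j + 2 * (F x - r) * DF x $ j + DG x $ j))"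
    by (auto simp: critical_def ev_def coord_def power2_eq_square mult_ac simp del: power_Suc)
qed

lemma critical_limit_algebraic:
  obtains R where "R \<noteq> 0" "\<And>r e x l. (\<And>n. critical r (e n) (x n)) \<Longrightarrow> (\<And>n. e n \<noteq> 0) \<Longrightarrow>
    e \<longlonglongrightarrow> 0 \<Longrightarrow> x \<longlonglongrightarrow> l \<Longrightarrow> poly2 R (l $ j) r = 0"
proof -
  from degree_reduction.polys_le_algebraic[OF critical_degree_reduction polys_le_var[OF order_refl]]
  obtain p where "p \<noteq> 0" and p: "\<forall>s\<in>{(x, r, e). critical r e x}.
      ev [:0, 0, [:real (2 * Suc d):]:] s \<noteq> 0 \<longrightarrow> (\<Sum>k\<le>degree p. ev (coeff p k) s * coord j s ^ k) = 0"
    by blast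
  obtain n q where p_eq: "p = smult (monom 1 n) q" and R_nz: "map_poly (\<lambda>c. coeff c 0) q \<noteq> 0"
    using smult_monom_decomp[OF \<open>p \<noteq> 0\<close>] by blast
  have nonzero: "(\<Sum>k\<le>degree q. poly2 (coeff q k) e r * (x $ j) ^ k) = 0"
    if "critical r e x" "e \<noteq> 0" for r e x
  proof -
    have "0 = (\<Sum>k\<le>degree p. ev (coeff p k) (x, r, e) * coord j (x, r, e) ^ k)"
      using bspec[OF p, of "(x, r, e)"] that by (simp add: ev_def)
    also have "\<dots> = e ^ n * (\<Sum>k\<le>degree q. poly2 (coeff q k) e r * (x $ j) ^ k)"
      by (simp add: p_eq monom_eq_0_iff ev_def coord_def sum_distrib_left mult.assoc)
        (simp add: poly2_def poly_monom)
    finally show ?thesis using \<open>e \<noteq> 0\<close> by simp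
  qed
  have "poly2 (map_poly (\<lambda>c. coeff c 0) q) (l $ j) r = 0"
    if critical: "\<And>n. critical r (e n) (x n)" "\<And>n. e n \<noteq> 0" and lim: "e \<longlonglongrightarrow> 0" "x \<longlonglongrightarrow> l" for r e x l
  proof -
    have "(\<lambda>n. \<Sum>k\<le>degree q. poly2 (coeff q k) (e n) r * (x n $ j) ^ k)
        \<longlonglongrightarrow> (\<Sum>k\<le>degree q. poly2 (coeff q k) 0 r * (l $ j) ^ k)"
      by (intro tendsto_intros lim)
    then have "(\<Sum>k\<le>degree q. poly2 (coeff q k) 0 r * (l $ j) ^ k) = 0"
      by (simp add: nonzero critical LIMSEQ_const_iff)
    moreover have "poly2 c 0 r = poly (coeff c 0) r" for c by (simp add: poly2_def poly_0_coeff_0)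
    ultimately show ?thesis by (simp add: poly2_eq_sum[OF map_poly_degree_leq] coeff_map_poly)
  qed
  with R_nz show thesis by (rule that)
qed

theorem algebraic_constrained_minimizer:
  assumes bdd: "bounded {x. G x \<le> 1}"
  obtains R where "\<And>j. R j \<noteq> 0" "\<And>r x0. F x0 = r \<Longrightarrow> G x0 = 0 \<Longrightarrow>
    \<exists>x. F x = r \<and> G x = 0 \<and> (\<forall>j. poly2 (R j) (x $ j) r = 0) \<and>
      (\<forall>y. F y = r \<longrightarrow> G y = 0 \<longrightarrow> H x \<le> H y)"
proof -
  have "\<forall>j. \<exists>R. R \<noteq> 0 \<and> (\<forall>r e x l. (\<forall>n. critical r (e n) (x n)) \<longrightarrow> (\<forall>n. e n \<noteq> 0) \<longrightarrow>
      e \<longlonglongrightarrow> 0 \<longrightarrow> x \<longlonglongrightarrow> l \<longrightarrow> poly2 R (l $ j) r = 0)"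
    by (meson critical_limit_algebraic)
  from choice[OF this] obtain R where R: "\<And>j. R j \<noteq> 0"
    "\<And>j r e x l. (\<And>n. critical r (e n) (x n)) \<Longrightarrow> (\<And>n. e n \<noteq> 0) \<Longrightarrow>
      e \<longlonglongrightarrow> 0 \<Longrightarrow> x \<longlonglongrightarrow> l \<Longrightarrow> poly2 (R j) (l $ j) r = 0"
    by blast
  have "\<exists>x. F x = r \<and> G x = 0 \<and> (\<forall>j. poly2 (R j) (x $ j) r = 0) \<and>
      (\<forall>y. F y = r \<longrightarrow> G y = 0 \<longrightarrow> H x \<le> H y)" if feasible: "F x0 = r" "G x0 = 0" for r x0
  proof -
    define e where "e n = inverse (real (Suc n))" for n
    have e: "0 < e n" for n by (simp add: e_def)
    have e_lim: "e \<longlonglongrightarrow> 0" unfolding e_def by (rule LIMSEQ_inverse_real_of_nat)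
    obtain x where minimal: "\<And>n y. penalized r (e n) (x n) \<le> penalized r (e n) y"
      using penalized_minimizer_exists[OF e] by metis
    obtain l \<phi> where \<phi>: "strict_mono \<phi>" and x_lim: "(\<lambda>n. x (\<phi> n)) \<longlonglongrightarrow> l"
      by (rule penalized_minimizers_subsequence[OF bdd e e_lim minimal feasible])
    have e_lim': "(\<lambda>n. e (\<phi> n)) \<longlonglongrightarrow> 0"
      using LIMSEQ_subseq_LIMSEQ[OF e_lim \<phi>] by (simp add: o_def)
    have "poly2 (R j) (l $ j) r = 0" for j
      by (rule R(2)[OF penalized_minimizer_critical[OF minimal] _ e_lim' x_lim])
        (use e in \<open>simp add: less_imp_neq[symmetric]\<close>)
    with limit_of_penalized_minimizers[OF e e_lim' x_lim minimal feasible] show ?thesis by blast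
  qed
  with R(1) that show thesis by blast
qed

end

theorem polyfun_algebraic_constrained_minimizer:
  fixes F G H :: "real^'n \<Rightarrow> real"
  assumes poly: "polyfun F" "polyfun G" "polyfun H"
    and nonneg: "\<And>x. 0 \<le> G x" "\<And>x. 0 \<le> H x" and bdd: "bounded {x. G x \<le> 1}"
  obtains R where "\<And>j. R j \<noteq> 0" "\<And>r x0. F x0 = r \<Longrightarrow> G x0 = 0 \<Longrightarrow>
    \<exists>x. F x = r \<and> G x = 0 \<and> (\<forall>j. poly2 (R j) (x $ j) r = 0) \<and>
      (\<forall>y. F y = r \<longrightarrow> G y = 0 \<longrightarrow> H x \<le> H y)"
proof -
  obtain DF DG DH where DF: "\<forall>x. GDERIV F x :> DF x" "\<forall>j. polyfun (\<lambda>x. DF x $ j)"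
    and DG: "\<forall>x. GDERIV G x :> DG x" "\<forall>j. polyfun (\<lambda>x. DG x $ j)"
    and DH: "\<forall>x. GDERIV H x :> DH x" "\<forall>j. polyfun (\<lambda>x. DH x $ j)"
    using poly[THEN polyfun_GDERIV] by blast
  let ?A = "insert F (\<Union>j. {\<lambda>x. DF x $ j, \<lambda>x. DG x $ j, \<lambda>x. DH x $ j})"
  have "\<exists>d. \<forall>f\<in>?A. poly_deg_le d f"
    by (rule polyfun_uniform_degree) (use poly DF DG DH in auto)
  then obtain d where "\<forall>f\<in>?A. poly_deg_le d f" ..
  then interpret polynomial_penalty F G H DF DG DH d
    using DF DG DH nonneg by unfold_locales auto
  show thesis by (rule algebraic_constrained_minimizer[OF bdd that])
qed

section \<open>The Lojasiewicz inequality on a box\<close>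

lemma monotonic_on_antimono_compose:
  assumes "monotonic_on A f" "antimono_on B g" "f ` A \<subseteq> B"
  shows "monotonic_on A (\<lambda>x. g (f x))"
  using assms unfolding monotonic_on_def monotone_on_def by blast

lemma monotonic_coordinates_variation:
  fixes x :: "real \<Rightarrow> real^'n"
  assumes mono: "\<And>j. monotonic_on I (\<lambda>r. x r $ j)"
    and bound: "\<And>r j. r \<in> I \<Longrightarrow> \<bar>x r $ j\<bar> \<le> B"
  obtains V where "\<And>r s. r \<in> I \<Longrightarrow> s \<in> I \<Longrightarrow> r \<le> s \<Longrightarrow> norm (x s - x r) \<le> V s - V r"
    "\<And>r. r \<in> I \<Longrightarrow> \<bar>V r\<bar> \<le> real CARD('n) * B"
proof -
  define \<sigma> where "\<sigma> j = (if mono_on I (\<lambda>r. x r $ j) then 1 else -1 :: real)" for j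
  define V where "V r = (\<Sum>j\<in>UNIV. \<sigma> j * x r $ j)" for r
  have "norm (x s - x r) \<le> V s - V r" if rs: "r \<in> I" "s \<in> I" "r \<le> s" for r s
  proof -
    have "\<bar>(x s - x r) $ j\<bar> = \<sigma> j * x s $ j - \<sigma> j * x r $ j" for j
      using mono[of j] rs unfolding monotonic_on_def \<sigma>_def by (auto dest: monotone_onD)
    moreover have "norm (x s - x r) \<le> (\<Sum>j\<in>UNIV. \<bar>(x s - x r) $ j\<bar>)" by (rule norm_le_l1_cart)
    ultimately show ?thesis by (simp only: V_def sum_subtractf)
  qed
  moreover have "\<bar>V r\<bar> \<le> real CARD('n) * B" if "r \<in> I" for r
  proof -
    have "\<bar>V r\<bar> \<le> (\<Sum>j\<in>UNIV. \<bar>\<sigma> j * x r $ j\<bar>)" unfolding V_def by (rule sum_abs)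
    also have "\<dots> \<le> (\<Sum>j\<in>(UNIV::'n set). B)"
      using bound[OF that] by (intro sum_mono) (simp add: \<sigma>_def abs_mult)
    finally show ?thesis by simp
  qed
  ultimately show thesis by (rule that)
qed

lemma locally_increasing_imp_mono_on:
  fixes g :: "real \<Rightarrow> real"
  assumes "connected I"
    and local: "\<And>x. x \<in> I \<Longrightarrow>
      \<forall>\<^sub>F y in nhds x. y \<in> I \<longrightarrow> (y \<le> x \<longrightarrow> g y \<le> g x) \<and> (x \<le> y \<longrightarrow> g x \<le> g y)"
  shows "mono_on I g"
proof (rule mono_onI)
  fix r s assume rs: "r \<in> I" "s \<in> I" "r \<le> s"
  have sub: "{r..s} \<subseteq> I" by (rule connected_contains_Icc[OF assms(1) rs(1,2)])
  have "r \<le> r \<longrightarrow> s \<le> s \<longrightarrow> g r \<le> g s"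
    using rs(3)
  proof (rule Bolzano[where P = "\<lambda>a b. r \<le> a \<longrightarrow> b \<le> s \<longrightarrow> g a \<le> g b"])
    fix x assume "r \<le> x" "x \<le> s"
    then have "x \<in> I" using sub by auto
    then obtain d where "d > 0" and d: "\<And>y. dist y x < d \<Longrightarrow> y \<in> I \<Longrightarrow>
        (y \<le> x \<longrightarrow> g y \<le> g x) \<and> (x \<le> y \<longrightarrow> g x \<le> g y)"
      using local[of x] unfolding eventually_nhds_metric by blast
    have "g a \<le> g b" if "a \<le> x" "x \<le> b" "b - a < d" "r \<le> a" "b \<le> s" for a b
    proof -
      have "a \<in> I" "b \<in> I" using sub that by auto
      then have "g a \<le> g x" "g x \<le> g b" using d[of a] d[of b] that by (auto simp: dist_real_def)
      then show ?thesis by linarith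
    qed
    then show "\<exists>d>0. \<forall>a b. a \<le> x \<and> x \<le> b \<and> b - a < d \<longrightarrow> r \<le> a \<longrightarrow> b \<le> s \<longrightarrow> g a \<le> g b"
      using \<open>d > 0\<close> by blast
  qed auto
  then show "g r \<le> g s" by simp
qed

lemma abs_ln_diff_le:
  fixes x y :: real
  assumes "0 < x" "x / 2 \<le> y"
  shows "\<bar>ln y - ln x\<bar> \<le> 2 * \<bar>y - x\<bar> / x"
proof (cases "y \<le> x")
  case True
  have "ln x - ln y \<le> (x - y) / y" using assms by (intro ln_diff_le) auto
  also have "\<dots> \<le> (x - y) / (x / 2)" using assms True by (intro divide_left_mono) auto
  finally show ?thesis using True assms by (simp add: abs_if mult.commute)
next
  case False
  have "ln y - ln x \<le> (y - x) / x" using assms False by (intro ln_diff_le) auto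
  also have "\<dots> \<le> 2 * (y - x) / x" using assms False by (intro divide_right_mono) auto
  finally show ?thesis using False assms by (simp add: abs_if)
qed

lemma logarithmic_growth_mono_on:
  fixes V :: "real \<Rightarrow> real"
  assumes I: "connected I" "I \<subseteq> {0<..}" and mono: "mono_on I V"
    and growth: "\<And>r. r \<in> I \<Longrightarrow> \<forall>\<^sub>F s in nhds r. s \<in> I \<longrightarrow> \<bar>s - r\<bar> \<le> K * r * \<bar>V s - V r\<bar>"
  shows "mono_on I (\<lambda>r. 2 * K * V r - ln r)"
proof (rule locally_increasing_imp_mono_on[OF I(1)])
  fix r assume r: "r \<in> I"
  then have "r > 0" using I(2) by auto
  then have "\<forall>\<^sub>F s in nhds r. s \<in> {r/2<..}" by (intro eventually_nhds_in_open) auto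
  with growth[OF r] show "\<forall>\<^sub>F s in nhds r. s \<in> I \<longrightarrow>
      (s \<le> r \<longrightarrow> 2 * K * V s - ln s \<le> 2 * K * V r - ln r) \<and>
      (r \<le> s \<longrightarrow> 2 * K * V r - ln r \<le> 2 * K * V s - ln s)"
  proof (eventually_elim, intro impI)
    fix s assume close: "s \<in> I \<longrightarrow> \<bar>s - r\<bar> \<le> K * r * \<bar>V s - V r\<bar>" "s \<in> {r/2<..}" and s: "s \<in> I"
    have "\<bar>ln s - ln r\<bar> \<le> 2 * \<bar>s - r\<bar> / r" using close(2) \<open>r > 0\<close> by (intro abs_ln_diff_le) auto
    also have "\<dots> \<le> 2 * (K * r * \<bar>V s - V r\<bar>) / r"
      using close(1) s \<open>r > 0\<close> by (intro divide_right_mono mult_left_mono) auto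
    finally have "\<bar>ln s - ln r\<bar> \<le> 2 * K * \<bar>V s - V r\<bar>" using \<open>r > 0\<close> by simp
    moreover have "\<bar>V s - V r\<bar> = V r - V s" if "s \<le> r"
      using mono_onD[OF mono s r that] by simp
    moreover have "\<bar>V s - V r\<bar> = V s - V r" if "r \<le> s"
      using mono_onD[OF mono r s that] by simp
    ultimately show "(s \<le> r \<longrightarrow> 2 * K * V s - ln s \<le> 2 * K * V r - ln r) \<and>
        (r \<le> s \<longrightarrow> 2 * K * V r - ln r \<le> 2 * K * V s - ln s)"
      by (auto simp: right_diff_distrib)
  qed
qed

lemma no_bounded_logarithmic_growth:
  fixes V :: "real \<Rightarrow> real"
  assumes "\<epsilon> > 0" "K \<ge> 0" and mono: "mono_on {0<..<\<epsilon>} V"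
    and bound: "\<And>r. r \<in> {0<..<\<epsilon>} \<Longrightarrow> \<bar>V r\<bar> \<le> B"
    and growth: "\<And>r. r \<in> {0<..<\<epsilon>} \<Longrightarrow>
      \<forall>\<^sub>F s in nhds r. s \<in> {0<..<\<epsilon>} \<longrightarrow> \<bar>s - r\<bar> \<le> K * r * \<bar>V s - V r\<bar>"
  shows False
proof -
  define g where "g r = 2 * K * V r - ln r" for r
  have g_mono: "mono_on {0<..<\<epsilon>} g"
    unfolding g_def by (rule logarithmic_growth_mono_on[OF _ _ mono growth]) auto
  define Q where "Q = g (\<epsilon> / 2) + 2 * K * B"
  have "\<forall>\<^sub>F r in at_right 0. ln r < - Q" using ln_at_0 unfolding filterlim_at_bot_dense by blast
  moreover have "\<forall>\<^sub>F r in at_right 0. r \<in> {0<..<\<epsilon> / 2}"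
    using \<open>\<epsilon> > 0\<close> by (intro eventually_at_right_real) simp
  ultimately have "\<forall>\<^sub>F r in at_right (0::real). False"
  proof eventually_elim
    case (elim r)
    then have r: "r \<in> {0<..<\<epsilon>}" by auto
    have "g r \<le> g (\<epsilon> / 2)" using elim(2) \<open>\<epsilon> > 0\<close> by (intro mono_onD[OF g_mono]) auto
    moreover have "2 * K * (- V r) \<le> 2 * K * B"
      using bound[OF r] \<open>K \<ge> 0\<close> by (intro mult_left_mono) auto
    ultimately show False using elim(1) unfolding g_def Q_def mult_minus_right by linarith
  qed
  then show False by simp
qed

definition box_gradient_sq :: "real^'n \<Rightarrow> real^'n \<Rightarrow> real^'n \<Rightarrow> real^'n \<Rightarrow> real" where
  "box_gradient_sq a b x G = (\<Sum>j\<in>UNIV. (x $ j - a $ j) * (b $ j - x $ j) * (G $ j)\<^sup>2)"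

lemma polyfun_box_gradient_sq:
  assumes "\<And>j. polyfun (\<lambda>x. D x $ j)"
  shows "polyfun (\<lambda>x. box_gradient_sq a b x (D x))"
  unfolding box_gradient_sq_def
  by (intro polyfun_sum polyfun_mult polyfun_diff polyfun_const polyfun_power polyfun_vec_nth assms)

lemma mem_cube_iff: "x \<in> cbox (-1) (1 :: real^'n) \<longleftrightarrow> (\<forall>j. \<bar>x $ j\<bar> \<le> 1)"
proof -
  have "-1 \<le> t \<and> t \<le> 1 \<longleftrightarrow> \<bar>t\<bar> \<le> 1" for t :: real by linarith
  then show ?thesis by (simp add: mem_box_cart)
qed

lemma box_gradient_sq_cube:
  "box_gradient_sq (-1) 1 x G = (\<Sum>j\<in>UNIV. (1 - (x $ j)\<^sup>2) * (G $ j)\<^sup>2)"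
  by (simp add: box_gradient_sq_def power2_eq_square algebra_simps)

definition arccos_vec :: "real^'n \<Rightarrow> real^'n" where
  "arccos_vec x = (\<chi> j. arccos (x $ j))"

definition cos_vec :: "real^'n \<Rightarrow> real^'n" where
  "cos_vec y = (\<chi> j. cos (y $ j))"

lemma cos_vec_arccos_vec: "x \<in> cbox (-1) 1 \<Longrightarrow> cos_vec (arccos_vec x) = x"
  by (simp add: mem_cube_iff cos_vec_def arccos_vec_def vec_eq_iff cos_arccos_abs)

lemma abs_arccos_vec_le: "x \<in> cbox (-1) 1 \<Longrightarrow> \<bar>arccos_vec x $ j\<bar> \<le> pi"
  by (simp add: mem_cube_iff arccos_vec_def abs_le_iff arccos_lbound arccos_ubound)

lemma continuous_on_arccos_vec:
  assumes "continuous_on S x" "\<And>r. r \<in> S \<Longrightarrow> x r \<in> cbox (-1) 1"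
  shows "continuous_on S (\<lambda>r. arccos_vec (x r))"
  unfolding arccos_vec_def using assms
  by (intro continuous_intros) (auto simp: mem_cube_iff abs_le_iff)

lemma monotonic_on_arccos_vec:
  assumes "monotonic_on S (\<lambda>r. x r $ j)" "\<And>r. r \<in> S \<Longrightarrow> x r \<in> cbox (-1) 1"
  shows "monotonic_on S (\<lambda>r. arccos_vec (x r) $ j)"
  unfolding arccos_vec_def vec_lambda_beta
  by (rule monotonic_on_antimono_compose[OF assms(1), where B = "{-1..1}"])
    (use assms(2) in \<open>auto simp: mem_cube_iff monotone_on_def abs_le_iff intro!: arccos_le_arccos\<close>)

lemma cos_chart_eventually_lipschitz:
  assumes f: "GDERIV f x :> D" and x: "x \<in> cbox (-1) 1"
    and "M > 0" and less: "box_gradient_sq (-1) 1 x D < M\<^sup>2"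
  shows "\<forall>\<^sub>F y in nhds (arccos_vec x). \<bar>f (cos_vec y) - f x\<bar> \<le> M * norm (y - arccos_vec x)"
proof -
  let ?t = "arccos_vec x"
  define G where "G = (\<chi> j. - sin (?t $ j) * D $ j)"
  have "GDERIV (\<lambda>y. f (cos_vec y)) ?t :> G"
    unfolding cos_vec_def G_def
    by (rule GDERIV_coordinatewise[where \<phi> = "\<lambda>j. cos"])
      (use f cos_vec_arccos_vec[OF x] in \<open>auto simp: cos_vec_def\<close>)
  moreover have "(norm G)\<^sup>2 = box_gradient_sq (-1) 1 x D"
    unfolding power2_norm_eq_inner inner_vec_def box_gradient_sq_cube
    using cos_vec_arccos_vec[OF x, symmetric]
    by (simp add: G_def cos_vec_def vec_eq_iff sin_squared_eq power_mult_distrib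
        flip: power2_eq_square)
  then have "norm G < M" using less \<open>M > 0\<close> by (simp add: power2_less_imp_less)
  ultimately have "\<forall>\<^sub>F y in nhds ?t. \<bar>f (cos_vec y) - f (cos_vec ?t)\<bar> \<le> M * norm (y - ?t)"
    by (rule GDERIV_eventually_norm_diff_le)
  then show ?thesis by (simp add: cos_vec_arccos_vec[OF x])
qed

lemma level_curve_eventually_growth:
  fixes x :: "real \<Rightarrow> real^'n"
  assumes f: "GDERIV f (x r) :> D" and I: "open I" "r \<in> I" and cont: "continuous_on I x"
    and cube: "\<And>s. s \<in> I \<Longrightarrow> x s \<in> cbox (-1) 1" and level: "\<And>s. s \<in> I \<Longrightarrow> f (x s) = s"
    and "M > 0" "box_gradient_sq (-1) 1 (x r) D < M\<^sup>2"
  shows "\<forall>\<^sub>F s in nhds r. s \<in> I \<longrightarrow> \<bar>s - r\<bar> \<le> M * norm (arccos_vec (x s) - arccos_vec (x r))"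
proof -
  define t where "t s = arccos_vec (x s)" for s
  have "filterlim t (nhds (t r)) (nhds r)"
    using continuous_on_arccos_vec[OF cont cube] I
    by (simp add: t_def[abs_def] continuous_on_eq_continuous_at isCont_def tendsto_nhds_iff)
  with cos_chart_eventually_lipschitz[OF f cube[OF I(2)] assms(7,8)]
  have "\<forall>\<^sub>F s in nhds r. \<bar>f (cos_vec (t s)) - f (x r)\<bar> \<le> M * norm (t s - t r)"
    unfolding t_def by (rule eventually_compose_filterlim)
  then show ?thesis
  proof (eventually_elim, intro impI)
    fix s assume "\<bar>f (cos_vec (t s)) - f (x r)\<bar> \<le> M * norm (t s - t r)" "s \<in> I"
    then show "\<bar>s - r\<bar> \<le> M * norm (arccos_vec (x s) - arccos_vec (x r))"
      by (simp add: t_def cos_vec_arccos_vec cube level I(2))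
  qed
qed

text \<open>In the variable \<open>arccos_vec x\<close> the gradient along the curve is at most a multiple of \<open>r\<close>, so
  the curve, whose length is finite by monotonicity, would be longer than a multiple of \<open>- ln r\<close>.\<close>

lemma no_quadratic_gradient_decay:
  fixes f :: "real^'n \<Rightarrow> real" and x :: "real \<Rightarrow> real^'n"
  assumes "\<epsilon> > 0" and D: "\<And>x. GDERIV f x :> D x"
    and cont: "continuous_on {0<..<\<epsilon>} x" and mono: "\<And>j. monotonic_on {0<..<\<epsilon>} (\<lambda>r. x r $ j)"
    and cube: "\<And>r. r \<in> {0<..<\<epsilon>} \<Longrightarrow> x r \<in> cbox (-1) 1"
    and level: "\<And>r. r \<in> {0<..<\<epsilon>} \<Longrightarrow> f (x r) = r"
    and decay: "\<And>r. r \<in> {0<..<\<epsilon>} \<Longrightarrow> box_gradient_sq (-1) 1 (x r) (D (x r)) \<le> C * r\<^sup>2"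
  shows False
proof -
  let ?I = "{0<..<\<epsilon>}" and ?t = "\<lambda>r. arccos_vec (x r)"
  obtain V where V: "\<And>r s. r \<in> ?I \<Longrightarrow> s \<in> ?I \<Longrightarrow> r \<le> s \<Longrightarrow> norm (?t s - ?t r) \<le> V s - V r"
    and V_bound: "\<And>r. r \<in> ?I \<Longrightarrow> \<bar>V r\<bar> \<le> real CARD('n) * pi"
    using monotonic_coordinates_variation[OF monotonic_on_arccos_vec[OF mono cube]
        abs_arccos_vec_le[OF cube]] by blast
  have V_mono: "mono_on ?I V"
    using order_trans[OF norm_ge_zero V] by (intro mono_onI) simp
  have dist_le_V: "norm (?t s - ?t r) \<le> \<bar>V s - V r\<bar>" if "r \<in> ?I" "s \<in> ?I" for r s
    using V[OF that] V[OF that(2,1)] by (cases "r \<le> s") (auto simp: norm_minus_commute)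
  define K where "K = sqrt (max C 0) + 1"
  have "K > 0" "C < K\<^sup>2"
    by (auto simp: K_def power2_eq_square algebra_simps add_nonneg_pos max_def)
  have "\<forall>\<^sub>F s in nhds r. s \<in> ?I \<longrightarrow> \<bar>s - r\<bar> \<le> K * r * \<bar>V s - V r\<bar>" if r: "r \<in> ?I" for r
  proof -
    have "C * r\<^sup>2 < (K * r)\<^sup>2" using \<open>C < K\<^sup>2\<close> r by (simp add: power_mult_distrib)
    with decay[OF r] have "box_gradient_sq (-1) 1 (x r) (D (x r)) < (K * r)\<^sup>2" by linarith
    then have "\<forall>\<^sub>F s in nhds r. s \<in> ?I \<longrightarrow> \<bar>s - r\<bar> \<le> K * r * norm (?t s - ?t r)"
      using r \<open>K > 0\<close> by (intro level_curve_eventually_growth[OF D _ r cont cube level]) auto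
    then show ?thesis
    proof (eventually_elim, intro impI)
      fix s assume growth: "s \<in> ?I \<longrightarrow> \<bar>s - r\<bar> \<le> K * r * norm (?t s - ?t r)" and s: "s \<in> ?I"
      have "K * r * norm (?t s - ?t r) \<le> K * r * \<bar>V s - V r\<bar>"
        using dist_le_V[OF r s] r \<open>K > 0\<close> by (intro mult_left_mono) auto
      with growth s show "\<bar>s - r\<bar> \<le> K * r * \<bar>V s - V r\<bar>" by linarith
    qed
  qed
  then show False
    using no_bounded_logarithmic_growth[OF \<open>\<epsilon> > 0\<close> _ V_mono V_bound, of K] \<open>K > 0\<close> by simp
qed

lemma eventually_const_frequently:
  assumes "\<forall>\<^sub>F x in F. g x = c" "\<exists>\<^sub>F x in F. P (g x)"
  shows "\<forall>\<^sub>F x in F. P (g x)"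
proof -
  have "\<exists>\<^sub>F x in F. P c"
    using assms(2) by (rule frequently_rev_mp, intro eventually_mono[OF assms(1)]) simp
  from frequently_ex[OF this] have "P c" by simp
  with assms(1) show ?thesis by (auto elim: eventually_mono)
qed

locale algebraic_curve =
  fixes x :: "real \<Rightarrow> real^'n" and \<epsilon> :: real
  assumes \<epsilon>_pos: "\<epsilon> > 0" and continuous: "continuous_on {0<..<\<epsilon>} x"
    and monotonic: "monotonic_on {0<..<\<epsilon>} (\<lambda>r. x r $ j)"
    and algebraic: "algebraic_germ (\<lambda>r. x r $ j)"
begin

lemma algebraic_germ_polyfun_curve: "polyfun p \<Longrightarrow> algebraic_germ (\<lambda>r. p (x r))"
  using algebraic_germ_polyfun[of "\<lambda>j r. x r $ j", OF algebraic] by simp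

lemma sgn_polyfun_minus_poly_eventually_const:
  assumes "polyfun p"
  shows "\<exists>\<sigma>. \<forall>\<^sub>F r in at_right 0. sgn (p (x r) - poly c r) = \<sigma>"
proof (rule algebraic_germ_sgn_eventually_const[OF \<epsilon>_pos])
  show "continuous_on {0<..<\<epsilon>} (\<lambda>r. p (x r) - poly c r)"
    by (intro continuous_intros continuous_on_polyfun_compose assms continuous)
  have "algebraic_germ (\<lambda>r. poly2 [:c, 1:] (p (x r) - poly c r) r)"
    using algebraic_germ_polyfun_curve[OF assms] by simp
  then show "algebraic_germ (\<lambda>r. p (x r) - poly c r)" by (rule algebraic_germ_poly2D) simp
qed

lemma frequently_imp_eventually_sgn:
  assumes "polyfun p" "\<exists>\<^sub>F r in at_right 0. P (sgn (p (x r) - poly c r))"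
  shows "\<forall>\<^sub>F r in at_right 0. P (sgn (p (x r) - poly c r))"
proof -
  obtain \<sigma> where "\<forall>\<^sub>F r in at_right 0. sgn (p (x r) - poly c r) = \<sigma>"
    using sgn_polyfun_minus_poly_eventually_const[OF assms(1)] by blast
  from eventually_const_frequently[OF this assms(2)] show ?thesis .
qed

lemma frequently_in_cube_imp_eventually:
  assumes "\<exists>\<^sub>F r in at_right 0. x r \<in> cbox (-1) 1"
  shows "\<forall>\<^sub>F r in at_right 0. x r \<in> cbox (-1) 1"
proof -
  have "\<forall>\<^sub>F r in at_right 0. \<bar>x r $ j\<bar> \<le> 1" for j
  proof -
    have sgn_iff: "sgn ((x r $ j)\<^sup>2 - poly 1 r) \<le> 0 \<longleftrightarrow> \<bar>x r $ j\<bar> \<le> 1" for r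
      by (simp add: abs_square_le_1)
    have "\<exists>\<^sub>F r in at_right 0. \<bar>x r $ j\<bar> \<le> 1"
      using assms by (rule frequently_elim1) (simp add: mem_cube_iff)
    with frequently_imp_eventually_sgn[OF polyfun_power[OF polyfun_vec_nth[of j]],
        of "\<lambda>t. t \<le> 0" 2 1]
    show ?thesis unfolding sgn_iff .
  qed
  then show ?thesis by (simp add: mem_cube_iff eventually_all_finite)
qed

lemma frequently_level_imp_eventually:
  assumes "polyfun f" "\<exists>\<^sub>F r in at_right 0. f (x r) = r"
  shows "\<forall>\<^sub>F r in at_right 0. f (x r) = r"
  using frequently_imp_eventually_sgn[of f "\<lambda>t. t = 0" "[:0, 1:]"] assms by (simp add: sgn_0_0)

lemma gradient_exceeds_quadratic:
  assumes f: "polyfun f" and D: "\<And>y. GDERIV f y :> D y" "\<And>j. polyfun (\<lambda>y. D y $ j)"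
    and cube: "\<forall>\<^sub>F r in at_right 0. x r \<in> cbox (-1) 1"
    and level: "\<forall>\<^sub>F r in at_right 0. f (x r) = r"
  shows "\<forall>\<^sub>F r in at_right 0. box_gradient_sq (-1) 1 (x r) (D (x r)) > C * r\<^sup>2"
proof -
  define h where "h y = box_gradient_sq (-1) 1 y (D y)" for y
  have "polyfun h" unfolding h_def by (rule polyfun_box_gradient_sq[OF D(2)])
  have sgn_iff: "sgn (h (x r) - poly [:0, 0, C:] r) > 0 \<longleftrightarrow> h (x r) > C * r\<^sup>2" for r
    by (simp add: power2_eq_square mult_ac)
  have "\<exists>\<^sub>F r in at_right 0. h (x r) > C * r\<^sup>2"
  proof (rule ccontr)
    assume "\<not> ?thesis"
    then have "\<forall>\<^sub>F r in at_right 0. h (x r) \<le> C * r\<^sup>2" by (simp add: frequently_def not_less)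
    then have "\<forall>\<^sub>F r in at_right 0.
        h (x r) \<le> C * r\<^sup>2 \<and> f (x r) = r \<and> x r \<in> cbox (-1) 1 \<and> r \<in> {0<..<\<epsilon>}"
      using level cube eventually_at_right_real[OF \<epsilon>_pos] by (simp add: eventually_conj_iff)
    then obtain \<epsilon>' where "\<epsilon>' > 0" and nearby: "\<And>r. r \<in> {0<..<\<epsilon>'} \<Longrightarrow>
        h (x r) \<le> C * r\<^sup>2 \<and> f (x r) = r \<and> x r \<in> cbox (-1) 1 \<and> r \<in> {0<..<\<epsilon>}"
      by (rule eventually_at_right_intervalE) blast
    have sub: "{0<..<\<epsilon>'} \<subseteq> {0<..<\<epsilon>}" using nearby by blast
    show False
      by (rule no_quadratic_gradient_decay[OF \<open>\<epsilon>' > 0\<close> D(1) continuous_on_subset[OF continuous sub]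
            monotonic_on_subset[OF monotonic sub], of C])
        (use nearby in \<open>simp_all add: h_def\<close>)
  qed
  with frequently_imp_eventually_sgn[OF \<open>polyfun h\<close>, of "\<lambda>t. t > 0" "[:0, 0, C:]"]
  show ?thesis unfolding sgn_iff unfolding h_def .
qed

theorem gradient_powr_bound:
  assumes f: "polyfun f" and D: "\<And>y. GDERIV f y :> D y" "\<And>j. polyfun (\<lambda>y. D y $ j)"
  shows "\<exists>\<delta>>0. \<forall>\<^sub>F r in at_right 0. x r \<in> cbox (-1) 1 \<and> f (x r) = r \<longrightarrow>
    r powr (2 - \<delta>) \<le> box_gradient_sq (-1) 1 (x r) (D (x r))"
proof (cases "\<exists>\<^sub>F r in at_right 0. x r \<in> cbox (-1) 1 \<and> f (x r) = r")
  case False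
  then have "\<forall>\<^sub>F r in at_right 0. \<not> (x r \<in> cbox (-1) 1 \<and> f (x r) = r)"
    by (simp add: frequently_def)
  then show ?thesis by (intro exI[of _ 1] conjI) (auto elim: eventually_mono)
next
  case True
  have "\<forall>\<^sub>F r in at_right 0. x r \<in> cbox (-1) 1"
    by (intro frequently_in_cube_imp_eventually frequently_elim1[OF True]) blast
  moreover have "\<forall>\<^sub>F r in at_right 0. f (x r) = r"
    by (intro frequently_level_imp_eventually f frequently_elim1[OF True]) blast
  ultimately have "\<And>C. \<forall>\<^sub>F r in at_right 0. box_gradient_sq (-1) 1 (x r) (D (x r)) > C * r\<^sup>2"
    by (rule gradient_exceeds_quadratic[OF f D])
  moreover have "algebraic_germ (\<lambda>r. box_gradient_sq (-1) 1 (x r) (D (x r)))"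
    by (intro algebraic_germ_polyfun_curve polyfun_box_gradient_sq D(2))
  ultimately obtain \<delta> where "\<delta> > 0"
    "\<forall>\<^sub>F r in at_right 0. r powr (2 - \<delta>) \<le> box_gradient_sq (-1) 1 (x r) (D (x r))"
    using algebraic_germ_powr_lower_bound by blast
  then show ?thesis by (intro exI[of _ \<delta>] conjI) (auto elim: eventually_mono)
qed

end

definition circle_defect :: "real^('n::finite + 'n) \<Rightarrow> real" where
  "circle_defect x = (\<Sum>j\<in>UNIV. ((x $ Inl j)\<^sup>2 + (x $ Inr j)\<^sup>2 - 1)\<^sup>2)"

lemma polyfun_circle_defect: "polyfun circle_defect"
  unfolding circle_defect_def
  by (intro polyfun_sum polyfun_power polyfun_diff polyfun_add polyfun_const polyfun_vec_nth)

lemma circle_defect_nonneg: "0 \<le> circle_defect x"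
  unfolding circle_defect_def by (intro sum_nonneg) auto

lemma circle_defect_eq_0_iff:
  "circle_defect x = 0 \<longleftrightarrow> (\<forall>j. (x $ Inr j)\<^sup>2 = 1 - (x $ Inl j)\<^sup>2)"
proof -
  have "circle_defect x = 0 \<longleftrightarrow> (\<forall>j. (x $ Inl j)\<^sup>2 + (x $ Inr j)\<^sup>2 - 1 = 0)"
    unfolding circle_defect_def by (subst sum_nonneg_eq_0_iff) auto
  then show ?thesis by (simp add: algebra_simps)
qed

lemma bounded_circle_defect_le_1: "bounded {x :: real^('n::finite + 'n). circle_defect x \<le> 1}"
proof (rule bounded_vec_le)
  fix x :: "real^('n + 'n)" and i assume "x \<in> {x. circle_defect x \<le> 1}"
  moreover have "((x $ Inl j)\<^sup>2 + (x $ Inr j)\<^sup>2 - 1)\<^sup>2 \<le> circle_defect x" for j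
    unfolding circle_defect_def by (rule member_le_sum) auto
  ultimately have "((x $ Inl j)\<^sup>2 + (x $ Inr j)\<^sup>2 - 1)\<^sup>2 \<le> 1" for j
    using order_trans by blast
  then have sum_le: "(x $ Inl j)\<^sup>2 + (x $ Inr j)\<^sup>2 \<le> 2" for j
    by (simp add: abs_square_le_1 abs_le_iff)
  have "(x $ i)\<^sup>2 \<le> 2\<^sup>2"
  proof (cases i)
    case (Inl j)
    have "(x $ Inl j)\<^sup>2 \<le> 4" using sum_le[of j] zero_le_power2[of "x $ Inr j"] by linarith
    then show ?thesis by (simp add: Inl)
  next
    case (Inr j)
    have "(x $ Inr j)\<^sup>2 \<le> 4" using sum_le[of j] zero_le_power2[of "x $ Inl j"] by linarith
    then show ?thesis by (simp add: Inr)
  qed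
  then show "\<bar>x $ i\<bar> \<le> 2" using abs_le_square_iff[of "x $ i" 2] by simp
qed

text \<open>Writing \<open>1 - x\<^sub>j\<^sup>2\<close> as the square of a further coordinate turns the cube into a product of
  circles and makes the objective nonnegative everywhere.\<close>

lemma cube_algebraic_minimizer:
  fixes f :: "real^'n \<Rightarrow> real"
  assumes f: "polyfun f" and D: "\<And>j. polyfun (\<lambda>x. D x $ j)"
  obtains R :: "'n \<Rightarrow> real poly poly" where "\<And>j. R j \<noteq> 0"
    "\<And>u. u \<in> cbox (-1) 1 \<Longrightarrow> \<exists>x\<in>cbox (-1) 1. f x = f u \<and> (\<forall>j. poly2 (R j) (x $ j) (f u) = 0) \<and>
      box_gradient_sq (-1) 1 x (D x) \<le> box_gradient_sq (-1) 1 u (D u)"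
proof -
  define U where "U x = (\<chi> j. x $ Inl j)" for x :: "real^('n + 'n)"
  define H where "H x = (\<Sum>j\<in>UNIV. (x $ Inr j)\<^sup>2 * (D (U x) $ j)\<^sup>2)" for x :: "real^('n + 'n)"
  have U: "polyfun (\<lambda>x. U x $ j)" for j by (auto simp: U_def)
  have H: "polyfun H" unfolding H_def
    by (intro polyfun_sum polyfun_mult polyfun_power polyfun_vec_nth polyfun_compose[OF D U])
  have H_nonneg: "0 \<le> H x" for x by (auto simp: H_def intro!: sum_nonneg)
  have H_eq: "H x = box_gradient_sq (-1) 1 (U x) (D (U x))" if "circle_defect x = 0" for x
    using that unfolding circle_defect_eq_0_iff H_def box_gradient_sq_cube by (simp add: U_def)
  obtain R where R: "\<And>i. R i \<noteq> 0" and minimizer: "\<And>r x0. f (U x0) = r \<Longrightarrow> circle_defect x0 = 0 \<Longrightarrow>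
    \<exists>x. f (U x) = r \<and> circle_defect x = 0 \<and> (\<forall>i. poly2 (R i) (x $ i) r = 0) \<and>
      (\<forall>y. f (U y) = r \<longrightarrow> circle_defect y = 0 \<longrightarrow> H x \<le> H y)"
    by (rule polyfun_algebraic_constrained_minimizer[OF polyfun_compose[OF f U]
          polyfun_circle_defect H circle_defect_nonneg H_nonneg bounded_circle_defect_le_1]) blast
  have "\<exists>x\<in>cbox (-1) 1. f x = f u \<and> (\<forall>j. poly2 (R (Inl j)) (x $ j) (f u) = 0) \<and>
      box_gradient_sq (-1) 1 x (D x) \<le> box_gradient_sq (-1) 1 u (D u)" if u: "u \<in> cbox (-1) 1" for u
  proof -
    define x0 where "x0 = (\<chi> i. case i of Inl j \<Rightarrow> u $ j | Inr j \<Rightarrow> sqrt (1 - (u $ j)\<^sup>2))"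
    have U_x0: "U x0 = u" by (simp add: U_def x0_def vec_eq_iff)
    have x0: "circle_defect x0 = 0"
      using u by (simp add: circle_defect_eq_0_iff x0_def mem_cube_iff abs_square_le_1)
    obtain x where x: "f (U x) = f u" "circle_defect x = 0"
      "\<And>i. poly2 (R i) (x $ i) (f u) = 0" "H x \<le> H x0"
      using minimizer[of x0 "f u"] x0 U_x0 by auto
    have "(x $ Inl j)\<^sup>2 \<le> 1" for j
      using x(2) zero_le_power2[of "x $ Inr j"] by (simp add: circle_defect_eq_0_iff)
    then have "U x \<in> cbox (-1) 1" by (simp add: U_def mem_cube_iff abs_square_le_1)
    with x H_eq[OF x(2)] H_eq[OF x0] U_x0 show ?thesis
      by (intro bexI[of _ "U x"]) (auto simp: U_def)
  qed
  with R show thesis by (intro that[of "\<lambda>j. R (Inl j)"]) auto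
qed

lemma uniform_monotonic_root_branches:
  fixes R :: "'n::finite \<Rightarrow> real poly poly"
  assumes "\<And>j. R j \<noteq> 0"
  obtains b \<Xi> where "b > a" "\<And>j. monotonic_root_branches (R j) {a<..<b} (\<Xi> j)"
proof -
  have "\<forall>\<^sub>F b in at_right a. (\<forall>j. \<exists>\<Xi>. monotonic_root_branches (R j) {a<..<b} \<Xi>) \<and> b > a"
    using eventually_monotonic_root_branches[OF assms] eventually_at_right_less[of a]
    by (intro eventually_conj) (simp_all add: eventually_all_finite)
  from eventually_happens'[OF trivial_limit_at_right_real this] that show thesis by metis
qed

lemma root_branches_algebraic_curve:
  assumes "\<epsilon> > 0" "\<And>j. R j \<noteq> 0" "\<And>j. monotonic_root_branches (R j) {0<..<\<epsilon>} (\<Xi> j)" "\<And>j. \<sigma> j \<in> \<Xi> j"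
  shows "algebraic_curve (\<lambda>r. \<chi> j. \<sigma> j r) \<epsilon>"
proof
  have branch: "continuous_on {0<..<\<epsilon>} (\<sigma> j)" "monotonic_on {0<..<\<epsilon>} (\<sigma> j)"
    "r \<in> {0<..<\<epsilon>} \<Longrightarrow> \<sigma> j r \<in> slice_roots (R j) r" for j r
    using assms(3)[of j] assms(4)[of j]
    unfolding monotonic_root_branches_def root_branches_def by auto
  show "continuous_on {0<..<\<epsilon>} (\<lambda>r. \<chi> j. \<sigma> j r)" by (intro continuous_on_vec_lambda branch(1))
  show "monotonic_on {0<..<\<epsilon>} (\<lambda>r. (\<chi> j. \<sigma> j r) $ j)" for j using branch(2) by simp
  have "\<forall>\<^sub>F r in at_right 0. poly2 (R j) (\<sigma> j r) r = 0" for j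
    using eventually_at_right_real[OF assms(1)] by (rule eventually_mono) (use branch(3) in simp)
  then show "algebraic_germ (\<lambda>r. (\<chi> j. \<sigma> j r) $ j)" for j
    using assms(2) unfolding algebraic_germ_def by auto
qed (rule assms(1))

lemma finite_positive_lower_bound:
  fixes f :: "'a \<Rightarrow> real"
  assumes "finite A" "\<And>a. a \<in> A \<Longrightarrow> f a > 0"
  obtains m where "m > 0" "\<And>a. a \<in> A \<Longrightarrow> m \<le> f a"
  using assms by (intro that[of "Min (insert 1 (f ` A))"]) auto

lemma uniform_powr_lower_bound:
  fixes k :: "'a \<Rightarrow> real \<Rightarrow> real"
  assumes fin: "finite A"
    and bound: "\<forall>a\<in>A. \<exists>\<delta>>0. \<forall>\<^sub>F r in at_right 0. P a r \<longrightarrow> r powr (p - \<delta>) \<le> k a r"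
  shows "\<exists>\<delta>>0. \<forall>\<^sub>F r in at_right 0. \<forall>a\<in>A. P a r \<longrightarrow> r powr (p - \<delta>) \<le> k a r"
proof -
  from bound obtain d where d: "\<forall>a\<in>A. d a > 0 \<and>
      (\<forall>\<^sub>F r in at_right 0. P a r \<longrightarrow> r powr (p - d a) \<le> k a r)"
    unfolding bchoice_iff by blast
  obtain \<delta> where \<delta>: "\<delta> > 0" "\<And>a. a \<in> A \<Longrightarrow> \<delta> \<le> d a"
    using finite_positive_lower_bound[OF fin, of d] d by blast
  have "\<forall>\<^sub>F r in at_right 0. (\<forall>a\<in>A. P a r \<longrightarrow> r powr (p - d a) \<le> k a r) \<and> r \<in> {0<..<1}"
    using d by (intro eventually_conj eventually_ball_finite fin eventually_at_right_real) auto
  then have "\<forall>\<^sub>F r in at_right 0. \<forall>a\<in>A. P a r \<longrightarrow> r powr (p - \<delta>) \<le> k a r"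
  proof eventually_elim
    case (elim r)
    have "r powr (p - \<delta>) \<le> r powr (p - d a)" if "a \<in> A" for a
      using \<delta>(2)[OF that] elim by (intro powr_mono') auto
    with elim show ?case by (meson order_trans)
  qed
  with \<delta>(1) show ?thesis by blast
qed

lemma root_branch_selection:
  fixes x :: "real^'n"
  assumes branches: "\<And>j. monotonic_root_branches (R j) I (\<Xi> j)" and "r \<in> I"
    and root: "\<And>j. poly2 (R j) (x $ j) r = 0"
  obtains \<sigma> where "\<sigma> \<in> PiE UNIV \<Xi>" "(\<chi> j. \<sigma> j r) = x"
proof -
  have "slice_roots (R j) r = (\<lambda>\<xi>. \<xi> r) ` \<Xi> j" for j
    using branches \<open>r \<in> I\<close> unfolding monotonic_root_branches_def root_branches_def by blast
  then have "x $ j \<in> (\<lambda>\<xi>. \<xi> r) ` \<Xi> j" for j using root by (metis slice_roots_iff)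
  then obtain \<sigma> where "\<And>j. \<sigma> j \<in> \<Xi> j" "\<And>j. x $ j = \<sigma> j r" unfolding image_iff by metis
  then show thesis by (intro that[of \<sigma>]) (auto simp: vec_eq_iff)
qed

lemma algebraic_points_gradient_powr_bound:
  fixes f :: "real^'n \<Rightarrow> real"
  assumes f: "polyfun f" and D: "\<And>x. GDERIV f x :> D x" "\<And>j. polyfun (\<lambda>x. D x $ j)"
    and R: "\<And>j. R j \<noteq> 0"
  shows "\<exists>\<delta>>0. \<forall>\<^sub>F r in at_right 0. \<forall>x\<in>cbox (-1) 1. f x = r \<longrightarrow> (\<forall>j. poly2 (R j) (x $ j) r = 0) \<longrightarrow>
    r powr (2 - \<delta>) \<le> box_gradient_sq (-1) 1 x (D x)"
proof -
  obtain \<epsilon> \<Xi> where "\<epsilon> > 0" and \<Xi>: "\<And>j. monotonic_root_branches (R j) {0<..<\<epsilon>} (\<Xi> j)"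
    by (rule uniform_monotonic_root_branches[of R 0, OF R]) blast
  let ?bound = "\<lambda>\<delta> r x. x \<in> cbox (-1) 1 \<and> f x = r \<longrightarrow>
      r powr (2 - \<delta>) \<le> box_gradient_sq (-1) 1 x (D x)"
  define curve where "curve \<sigma> r = (\<chi> j. \<sigma> j r)" for \<sigma> :: "'n \<Rightarrow> real \<Rightarrow> real" and r
  have fin: "finite (PiE UNIV \<Xi>)"
    using \<Xi> by (intro finite_PiE) (auto simp: monotonic_root_branches_def root_branches_def)
  have "\<forall>\<sigma>\<in>PiE UNIV \<Xi>. \<exists>\<delta>>0. \<forall>\<^sub>F r in at_right 0. ?bound \<delta> r (curve \<sigma> r)"
  proof
    fix \<sigma> assume "\<sigma> \<in> PiE UNIV \<Xi>"
    then have "\<And>j. \<sigma> j \<in> \<Xi> j" by auto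
    then interpret algebraic_curve "curve \<sigma>" \<epsilon>
      unfolding curve_def by (rule root_branches_algebraic_curve[of \<epsilon> R \<Xi> \<sigma>, OF \<open>\<epsilon> > 0\<close> R \<Xi>])
    show "\<exists>\<delta>>0. \<forall>\<^sub>F r in at_right 0. ?bound \<delta> r (curve \<sigma> r)"
      by (rule gradient_powr_bound[OF f D])
  qed
  from uniform_powr_lower_bound[OF fin this]
  obtain \<delta> where "\<delta> > 0"
    and "\<forall>\<^sub>F r in at_right 0. \<forall>\<sigma>\<in>PiE UNIV \<Xi>. ?bound \<delta> r (curve \<sigma> r)" by blast
  from this(2) eventually_at_right_real[OF \<open>\<epsilon> > 0\<close>]
  have "\<forall>\<^sub>F r in at_right 0. \<forall>x\<in>cbox (-1) 1. f x = r \<longrightarrow> (\<forall>j. poly2 (R j) (x $ j) r = 0) \<longrightarrow>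
      r powr (2 - \<delta>) \<le> box_gradient_sq (-1) 1 x (D x)"
  proof (eventually_elim, intro ballI impI)
    fix r x assume bound: "\<forall>\<sigma>\<in>PiE UNIV \<Xi>. ?bound \<delta> r (curve \<sigma> r)"
      and "r \<in> {0<..<\<epsilon>}" and x: "x \<in> cbox (-1) 1" "f x = r" and "\<forall>j. poly2 (R j) (x $ j) r = 0"
    then obtain \<sigma> where \<sigma>: "\<sigma> \<in> PiE UNIV \<Xi>" "curve \<sigma> r = x"
      unfolding curve_def by (auto intro: root_branch_selection[of R "{0<..<\<epsilon>}" \<Xi> r x, OF \<Xi>])
    from bspec[OF bound \<sigma>(1)] x show "r powr (2 - \<delta>) \<le> box_gradient_sq (-1) 1 x (D x)"
      by (simp add: \<sigma>(2))
  qed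
  with \<open>\<delta> > 0\<close> show ?thesis by blast
qed

theorem cube_Lojasiewicz:
  fixes f :: "real^'n \<Rightarrow> real"
  assumes f: "polyfun f" and D: "\<And>x. GDERIV f x :> D x" "\<And>j. polyfun (\<lambda>x. D x $ j)"
  shows "\<exists>\<delta>>0. \<forall>\<^sub>F r in at_right 0. \<forall>u\<in>cbox (-1) 1. f u = r \<longrightarrow>
    r powr (2 - \<delta>) \<le> box_gradient_sq (-1) 1 u (D u)"
proof -
  obtain R where R: "\<And>j::'n. R j \<noteq> 0" and minimizer: "\<And>u. u \<in> cbox (-1) 1 \<Longrightarrow>
    \<exists>x\<in>cbox (-1) 1. f x = f u \<and> (\<forall>j. poly2 (R j) (x $ j) (f u) = 0) \<and>
      box_gradient_sq (-1) 1 x (D x) \<le> box_gradient_sq (-1) 1 u (D u)"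
    by (rule cube_algebraic_minimizer[OF f D(2)]) blast
  from algebraic_points_gradient_powr_bound[of f D R, OF f D R] obtain \<delta> where "\<delta> > 0"
    and bound: "\<forall>\<^sub>F r in at_right 0. \<forall>x\<in>cbox (-1) 1. f x = r \<longrightarrow>
      (\<forall>j. poly2 (R j) (x $ j) r = 0) \<longrightarrow> r powr (2 - \<delta>) \<le> box_gradient_sq (-1) 1 x (D x)" by blast
  from bound have "\<forall>\<^sub>F r in at_right 0. \<forall>u\<in>cbox (-1) 1. f u = r \<longrightarrow>
      r powr (2 - \<delta>) \<le> box_gradient_sq (-1) 1 u (D u)"
    by (rule eventually_mono) (use minimizer order_trans in blast)
  with \<open>\<delta> > 0\<close> show ?thesis by blast
qed

definition box_chart :: "real^'n \<Rightarrow> real^'n \<Rightarrow> real^'n \<Rightarrow> real^'n" where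
  "box_chart a b u = (\<chi> j. (a $ j + b $ j) / 2 + (b $ j - a $ j) / 2 * u $ j)"

lemma polyfun_box_chart: "polyfun (\<lambda>u. box_chart a b u $ j)"
  unfolding box_chart_def vec_lambda_beta
  by (intro polyfun_add polyfun_mult polyfun_const polyfun_vec_nth)

lemma GDERIV_box_chart:
  assumes "GDERIV f (box_chart a b u) :> D"
  shows "GDERIV (\<lambda>u. f (box_chart a b u)) u :> (\<chi> j. (b $ j - a $ j) / 2 * D $ j)"
proof -
  have "((\<lambda>t. (a $ j + b $ j) / 2 + (b $ j - a $ j) / 2 * t) has_real_derivative
      (b $ j - a $ j) / 2) (at t)" for j t
    by (auto intro!: derivative_eq_intros)
  then show ?thesis
    using assms unfolding box_chart_def by (rule GDERIV_coordinatewise)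
qed

lemma box_gradient_sq_box_chart:
  "box_gradient_sq (-1) 1 u (\<chi> j. (b $ j - a $ j) / 2 * G $ j)
    = box_gradient_sq a b (box_chart a b u) G"
  unfolding box_gradient_sq_def
  by (intro sum.cong refl) (simp add: box_chart_def power2_eq_square field_simps)

lemma box_chart_surj:
  assumes "x \<in> cbox a b"
  obtains u where "u \<in> cbox (-1) 1" "box_chart a b u = x"
proof
  let ?u = "\<chi> j. (2 * x $ j - (a $ j + b $ j)) / (b $ j - a $ j)"
  have x: "a $ j \<le> x $ j" "x $ j \<le> b $ j" for j using assms by (auto simp: mem_box_cart)
  have "\<bar>2 * x $ j - (a $ j + b $ j)\<bar> \<le> \<bar>b $ j - a $ j\<bar>" for j
    using x[of j] by linarith
  then show "?u \<in> cbox (-1) 1" by (simp add: mem_cube_iff abs_divide divide_le_eq_1)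
  have "(a $ j + b $ j) / 2 + (b $ j - a $ j) / 2 * ?u $ j = x $ j" for j
  proof (cases "a $ j = b $ j")
    case True
    then show ?thesis using x[of j] by simp
  qed (simp add: field_simps)
  then show "box_chart a b ?u = x" by (simp add: box_chart_def vec_eq_iff)
qed

theorem box_Lojasiewicz:
  fixes f :: "real^'n \<Rightarrow> real"
  assumes f: "polyfun f" and D: "\<And>x. GDERIV f x :> D x" "\<And>j. polyfun (\<lambda>x. D x $ j)"
  shows "\<exists>\<delta>>0. \<exists>\<epsilon>>0. \<forall>x\<in>cbox a b. v < f x \<longrightarrow> f x < v + \<epsilon> \<longrightarrow>
    (f x - v) powr (2 - \<delta>) \<le> box_gradient_sq a b x (D x)"
proof -
  define F where "F u = f (box_chart a b u) - v" for u
  define DF where "DF u = (\<chi> j. (b $ j - a $ j) / 2 * D (box_chart a b u) $ j)" for u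
  have "polyfun F"
    unfolding F_def by (intro polyfun_diff polyfun_const polyfun_compose[OF f polyfun_box_chart])
  moreover have "GDERIV F u :> DF u" for u
    using GDERIV_diff[OF GDERIV_box_chart[OF D(1), of a b u] GDERIV_const[of v u]]
    unfolding F_def[abs_def] DF_def diff_0_right .
  moreover have "polyfun (\<lambda>u. DF u $ j)" for j
    unfolding DF_def vec_lambda_beta
    by (intro polyfun_mult polyfun_const polyfun_compose[OF D(2) polyfun_box_chart])
  ultimately obtain \<delta> where "\<delta> > 0" and "\<forall>\<^sub>F r in at_right 0. \<forall>u\<in>cbox (-1) 1. F u = r \<longrightarrow>
      r powr (2 - \<delta>) \<le> box_gradient_sq (-1) 1 u (DF u)"
    using cube_Lojasiewicz[of F DF] by blast
  from this(2) obtain \<epsilon> where "\<epsilon> > 0" and cube: "\<And>r. r \<in> {0<..<\<epsilon>} \<Longrightarrow>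
      \<forall>u\<in>cbox (-1) 1. F u = r \<longrightarrow> r powr (2 - \<delta>) \<le> box_gradient_sq (-1) 1 u (DF u)"
    by (rule eventually_at_right_intervalE) blast
  have "(f x - v) powr (2 - \<delta>) \<le> box_gradient_sq a b x (D x)"
    if x: "x \<in> cbox a b" "v < f x" "f x < v + \<epsilon>" for x
  proof -
    obtain u where u: "u \<in> cbox (-1) 1" "box_chart a b u = x" by (rule box_chart_surj[OF x(1)])
    have "(f x - v) powr (2 - \<delta>) \<le> box_gradient_sq (-1) 1 u (DF u)"
      using cube[of "f x - v"] x(2,3) u by (simp add: F_def)
    also have "\<dots> = box_gradient_sq a b x (D x)"
      unfolding DF_def box_gradient_sq_box_chart u(2) ..
    finally show ?thesis .
  qed
  with \<open>\<delta> > 0\<close> \<open>\<epsilon> > 0\<close> show ?thesis by blast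
qed

section \<open>Descent sequences\<close>

lemma powr_concave_diff:
  fixes x y s :: real
  assumes "0 < y" "y \<le> x" "0 < s" "s \<le> 1"
  shows "x powr (s - 1) * (x - y) \<le> x powr s / s - y powr s / s"
proof (cases "y = x")
  case False
  then have "y < x" using assms(2) by simp
  have "((\<lambda>t. t powr s / s) has_real_derivative t powr (s - 1)) (at t)" if "y \<le> t" for t
    using that assms(1,3) by (auto intro!: derivative_eq_intros)
  with \<open>y < x\<close> obtain t where t: "y < t" "t < x"
    "x powr s / s - y powr s / s = (x - y) * t powr (s - 1)"
    using MVT2[OF \<open>y < x\<close>, of "\<lambda>t. t powr s / s" "\<lambda>t. t powr (s - 1)"] by blast
  have "x powr (s - 1) \<le> t powr (s - 1)" using t assms by (intro powr_mono2') auto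
  then have "x powr (s - 1) * (x - y) \<le> t powr (s - 1) * (x - y)"
    using \<open>y < x\<close> by (intro mult_right_mono) auto
  then show ?thesis using t(3) by (simp add: mult.commute)
qed simp

text \<open>Concavity of \<open>t powr s\<close> turns the gradient inequality into
  \<open>d'\<^sup>2 \<le> d (\<phi> x - \<phi> y)\<close> with \<open>\<phi> t = (sqrt K / \<kappa>) (t powr s / s)\<close>, and the arithmetic-geometric mean
  inequality linearizes it so that it telescopes.\<close>

lemma Lojasiewicz_step:
  fixes x y d d' :: real
  assumes xy: "0 < y" "y \<le> x" and d: "0 \<le> d" and s: "0 < s" "s \<le> 1" and pos: "\<kappa> > 0" "K > 0"
    and descent: "\<kappa> * d'\<^sup>2 \<le> x - y" and gradient: "x powr (2 - 2 * s) \<le> K * d\<^sup>2"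
  shows "2 * d' \<le> d + (sqrt K / \<kappa> * (x powr s / s) - sqrt K / \<kappa> * (y powr s / s))"
proof -
  define A where "A = sqrt K / \<kappa> * (x powr s / s - y powr s / s)"
  have "y powr s \<le> x powr s" using xy s by (intro powr_mono2) auto
  then have diff_nonneg: "0 \<le> x powr s / s - y powr s / s" using s by (simp add: divide_right_mono)
  then have "A \<ge> 0" using pos by (simp add: A_def)
  have "(x powr (1 - s))\<^sup>2 \<le> (sqrt K * d)\<^sup>2"
    using gradient xy pos by (simp add: powr_power power_mult_distrib algebra_simps)
  then have root: "x powr (1 - s) \<le> sqrt K * d"
    by (rule power2_le_imp_le) (use pos d in simp)
  have "x - y = x powr (1 - s) * (x powr (s - 1) * (x - y))"
    using xy by (simp add: powr_add[symmetric] mult.assoc[symmetric])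
  also have "\<dots> \<le> (sqrt K * d) * (x powr s / s - y powr s / s)"
    using root powr_concave_diff[OF xy s] xy diff_nonneg pos d by (intro mult_mono) auto
  finally have "\<kappa> * d'\<^sup>2 \<le> (sqrt K * d) * (x powr s / s - y powr s / s)" using descent by linarith
  then have "d'\<^sup>2 \<le> d * A" using pos by (simp add: A_def field_simps)
  moreover have "0 \<le> (d - A)\<^sup>2" by simp
  ultimately have "(2 * d')\<^sup>2 \<le> (d + A)\<^sup>2" by (simp add: power2_eq_square algebra_simps)
  then have "2 * d' \<le> d + A" by (rule power2_le_imp_le) (use \<open>A \<ge> 0\<close> d in simp)
  then show ?thesis by (simp add: A_def right_diff_distrib)
qed

lemma summable_telescoping_bound:
  fixes d \<phi> :: "nat \<Rightarrow> real"
  assumes nonneg: "\<And>n. 0 \<le> d n" "\<And>n. 0 \<le> \<phi> n"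
    and step: "\<And>n. 2 * d (Suc n) \<le> d n + (\<phi> n - \<phi> (Suc n))"
  shows "summable d"
proof -
  have telescoped: "(\<Sum>i<n. d (Suc i)) + d n \<le> d 0 + (\<phi> 0 - \<phi> n)" for n
  proof (induction n)
    case (Suc n)
    with step[of n] show ?case by simp
  qed simp
  have "(\<Sum>i<n. d (Suc i)) \<le> d 0 + \<phi> 0" for n
    using telescoped[of n] nonneg(1)[of n] nonneg(2)[of n] by linarith
  then have "summable (\<lambda>i. d (Suc i))" by (intro summableI_nonneg_bounded nonneg)
  then show ?thesis by (simp add: summable_Suc_iff)
qed

lemma sufficient_descent_decseq:
  fixes r d :: "nat \<Rightarrow> real"
  assumes "\<kappa> \<ge> 0" "\<And>l. \<kappa> * (d l)\<^sup>2 \<le> r l - r (Suc l)"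
  shows "decseq r"
proof (rule decseq_SucI)
  fix l
  have "0 \<le> \<kappa> * (d l)\<^sup>2" using assms(1) by simp
  with assms(2)[of l] show "r (Suc l) \<le> r l" by linarith
qed

lemma descent_summable_if_limit_attained:
  fixes r d :: "nat \<Rightarrow> real"
  assumes nonneg: "\<And>l. 0 \<le> r l" and "\<kappa> > 0" and descent: "\<And>l. \<kappa> * (d l)\<^sup>2 \<le> r l - r (Suc l)"
    and "r N = 0"
  shows "summable d"
proof -
  have "decseq r" by (rule sufficient_descent_decseq[of \<kappa> d r, OF _ descent]) (use \<open>\<kappa> > 0\<close> in simp)
  then have "r (n + N) \<le> r N" for n by (rule decseqD) simp
  then have r_eq_0: "r (n + N) = 0" for n
    using nonneg \<open>r N = 0\<close> by (metis order_antisym)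
  have "d (n + N) = 0" for n
    using descent[of "n + N"] r_eq_0[of n] r_eq_0[of "Suc n"] \<open>\<kappa> > 0\<close> by (simp add: mult_le_0_iff)
  then have "summable (\<lambda>n. d (n + N))" by simp
  then show ?thesis by (simp add: summable_iff_shift)
qed

theorem Lojasiewicz_descent_summable:
  fixes r d :: "nat \<Rightarrow> real"
  assumes r: "\<And>l. 0 \<le> r l" "r \<longlonglongrightarrow> 0" and d: "\<And>l. 0 \<le> d l"
    and pos: "\<kappa> > 0" "K > 0" "\<epsilon> > 0" and \<delta>: "0 < \<delta>" "\<delta> \<le> 2"
    and descent: "\<And>l. \<kappa> * (d l)\<^sup>2 \<le> r l - r (Suc l)"
    and gradient: "\<And>l. 0 < r (Suc l) \<Longrightarrow> r (Suc l) < \<epsilon> \<Longrightarrow> r (Suc l) powr (2 - \<delta>) \<le> K * (d l)\<^sup>2"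
  shows "summable d"
proof (cases "\<exists>N. r N = 0")
  case True
  then show ?thesis using descent_summable_if_limit_attained[of r \<kappa> d] r(1) pos(1) descent by blast
next
  case False
  then have r_pos: "r l > 0" for l using r(1)[of l] by (metis less_eq_real_def)
  obtain N where N: "\<And>l. l \<ge> N \<Longrightarrow> r l < \<epsilon>"
    using order_tendstoD(2)[OF r(2) pos(3)] by (auto simp: eventually_sequentially)
  have "decseq r" by (rule sufficient_descent_decseq[of \<kappa> d r, OF _ descent]) (use pos(1) in simp)
  define s where "s = \<delta> / 2"
  define \<phi> where "\<phi> l = sqrt K / \<kappa> * (r (Suc l) powr s / s)" for l
  have "summable (\<lambda>n. d (n + N))"
  proof (rule summable_telescoping_bound[where \<phi> = "\<lambda>n. \<phi> (n + N)"])
    fix n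
    show "0 \<le> \<phi> (n + N)" using pos \<delta> by (simp add: \<phi>_def s_def)
    have "r (Suc (Suc (n + N))) \<le> r (Suc (n + N))" using \<open>decseq r\<close> by (rule decseq_SucD)
    moreover have "r (Suc (n + N)) powr (2 - 2 * s) \<le> K * (d (n + N))\<^sup>2"
      using gradient[of "n + N"] r_pos N[of "Suc (n + N)"] by (simp add: s_def)
    ultimately show "2 * d (Suc n + N) \<le> d (n + N) + (\<phi> (n + N) - \<phi> (Suc n + N))"
      using Lojasiewicz_step[of "r (Suc (Suc (n + N)))" "r (Suc (n + N))" "d (n + N)" s \<kappa> K
          "d (Suc (n + N))"] r_pos d \<delta> pos descent[of "Suc (n + N)"] by (simp add: \<phi>_def s_def)
  qed (rule d)
  then show ?thesis by (simp add: summable_iff_shift)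
qed

lemma normal_cone_limit:
  assumes "closed Z" and x: "x \<longlonglongrightarrow> x'" and v: "v \<longlonglongrightarrow> v'" and normal: "\<And>n. v n \<in> normal_cone Z (x n)"
  shows "v' \<in> normal_cone Z x'"
proof -
  have "x' \<in> Z"
    by (rule closed_sequentially[OF assms(1) _ x]) (use normal in \<open>auto simp: normal_cone_def\<close>)
  moreover have "v' \<bullet> (y - x') \<le> 0" if "y \<in> Z" for y
  proof (rule LIMSEQ_le_const2)
    show "(\<lambda>n. v n \<bullet> (y - x n)) \<longlonglongrightarrow> v' \<bullet> (y - x')" by (intro tendsto_intros x v)
    show "\<exists>N. \<forall>n\<ge>N. v n \<bullet> (y - x n) \<le> 0" using normal that by (auto simp: normal_cone_def)
  qed
  ultimately show ?thesis by (simp add: normal_cone_def)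
qed

lemma normal_cone_cbox_iff:
  fixes a b x v :: "real^'n"
  shows "v \<in> normal_cone (cbox a b) x \<longleftrightarrow>
    x \<in> cbox a b \<and> (\<forall>j. \<forall>t\<in>{a $ j..b $ j}. v $ j * (t - x $ j) \<le> 0)"
proof (intro iffI conjI allI ballI)
  fix j t assume v: "v \<in> normal_cone (cbox a b) x" and t: "t \<in> {a $ j..b $ j}"
  define y where "y = (\<chi> k. if k = j then t else x $ k)"
  have "y \<in> cbox a b" using v t by (auto simp: normal_cone_def y_def mem_box_cart)
  then have "v \<bullet> (y - x) \<le> 0" using v by (simp add: normal_cone_def)
  moreover have "y - x = axis j (t - x $ j)" by (auto simp: y_def vec_eq_iff axis_def)
  ultimately show "v $ j * (t - x $ j) \<le> 0" by (simp add: inner_axis)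
next
  assume "x \<in> cbox a b \<and> (\<forall>j. \<forall>t\<in>{a $ j..b $ j}. v $ j * (t - x $ j) \<le> 0)"
  then show "v \<in> normal_cone (cbox a b) x"
    by (auto simp: normal_cone_def inner_vec_def mem_box_cart intro!: sum_nonpos)
qed (simp add: normal_cone_def)

lemma box_gradient_sq_le:
  assumes "- G \<in> normal_cone (cbox a b) x"
  shows "box_gradient_sq a b x D \<le> (norm (b - a))\<^sup>2 * (norm (D - G))\<^sup>2"
proof -
  have "(x $ j - a $ j) * (b $ j - x $ j) * (D $ j)\<^sup>2 \<le> (norm (b - a))\<^sup>2 * ((D - G) $ j)\<^sup>2" for j
  proof -
    have x: "a $ j \<le> x $ j" "x $ j \<le> b $ j"
      and stationary: "\<And>t. t \<in> {a $ j..b $ j} \<Longrightarrow> 0 \<le> G $ j * (t - x $ j)"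
      using assms by (auto simp: normal_cone_cbox_iff mem_box_cart)
    have "0 \<le> G $ j * (a $ j - x $ j)" "0 \<le> G $ j * (b $ j - x $ j)"
      using stationary x by auto
    then have "x $ j = a $ j \<or> x $ j = b $ j \<or> G $ j = 0"
      using x by (auto simp: zero_le_mult_iff)
    then have "(x $ j - a $ j) * (b $ j - x $ j) * (D $ j)\<^sup>2
        = (x $ j - a $ j) * (b $ j - x $ j) * ((D - G) $ j)\<^sup>2" by auto
    also have "(x $ j - a $ j) * (b $ j - x $ j) \<le> norm (b - a) * norm (b - a)"
      using x component_le_norm_cart[of "b - a" j] by (intro mult_mono) auto
    finally show ?thesis by (simp add: mult_right_mono power2_eq_square)
  qed
  then have "box_gradient_sq a b x D \<le> (\<Sum>j\<in>UNIV. (norm (b - a))\<^sup>2 * ((D - G) $ j)\<^sup>2)"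
    unfolding box_gradient_sq_def by (rule sum_mono)
  also have "\<dots> = (norm (b - a))\<^sup>2 * (norm (D - G))\<^sup>2"
    unfolding power2_norm_eq_inner[of "D - G"] inner_vec_def
    by (simp add: sum_distrib_left power2_eq_square)
  finally show ?thesis .
qed

lemma summable_steps_converge:
  fixes z :: "nat \<Rightarrow> 'a::banach"
  assumes "summable d" "\<And>l. norm (z (Suc l) - z l) \<le> d l"
  shows "convergent z"
proof -
  have "summable (\<lambda>l. z (Suc l) - z l)" by (rule summable_comparison_test'[OF assms])
  then have "convergent (\<lambda>n. z n - z 0)"
    by (simp add: summable_iff_convergent sum_lessThan_telescope)
  then show ?thesis using convergent_add_const_right_iff[of z "- z 0"] by simp
qed

locale box_descent_sequence =
  fixes f :: "real^'n \<Rightarrow> real" and D :: "real^'n \<Rightarrow> real^'n" and a b :: "real^'n"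
    and z :: "nat \<Rightarrow> real^'n" and d :: "nat \<Rightarrow> real" and \<kappa> K :: real
  assumes polyfun_f: "polyfun f" and GDERIV_f: "GDERIV f x :> D x"
    and polyfun_D: "polyfun (\<lambda>x. D x $ j)"
    and in_box: "z l \<in> cbox a b" and step_le: "norm (z (Suc l) - z l) \<le> d l"
    and \<kappa>_pos: "\<kappa> > 0" and descent: "\<kappa> * (d l)\<^sup>2 \<le> f (z l) - f (z (Suc l))"
    and relative_error:
      "\<exists>G. - G \<in> normal_cone (cbox a b) (z (Suc l)) \<and> norm (D (z (Suc l)) - G) \<le> K * d l"
begin

lemma step_nonneg: "0 \<le> d l"
  using step_le[of l] norm_ge_zero order_trans by blast

lemma value_converges:
  obtains v where "(\<lambda>l. f (z l)) \<longlonglongrightarrow> v" "\<And>l. v \<le> f (z l)"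
proof -
  have "decseq (\<lambda>l. f (z l))"
    by (rule sufficient_descent_decseq[of \<kappa> d, OF _ descent]) (use \<kappa>_pos in simp)
  moreover obtain B where "\<And>x. x \<in> cbox a b \<Longrightarrow> B \<le> f x"
    using continuous_attains_inf[OF compact_cbox _ continuous_on_polyfun[OF polyfun_f]] in_box
    by blast
  then have "\<And>l. B \<le> f (z l)" using in_box by blast
  ultimately show thesis using decseq_convergent that by metis
qed

lemma box_gradient_sq_le_step:
  "box_gradient_sq a b (z (Suc l)) (D (z (Suc l))) \<le> (norm (b - a))\<^sup>2 * (K * d l)\<^sup>2"
proof -
  obtain G where G: "- G \<in> normal_cone (cbox a b) (z (Suc l))" "norm (D (z (Suc l)) - G) \<le> K * d l"
    using relative_error by blast
  have "box_gradient_sq a b (z (Suc l)) (D (z (Suc l)))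
      \<le> (norm (b - a))\<^sup>2 * (norm (D (z (Suc l)) - G))\<^sup>2" by (rule box_gradient_sq_le[OF G(1)])
  also have "\<dots> \<le> (norm (b - a))\<^sup>2 * (K * d l)\<^sup>2"
    using G(2) by (intro mult_left_mono power_mono) auto
  finally show ?thesis .
qed

lemma summable_steps: "summable d"
proof -
  obtain v where v: "(\<lambda>l. f (z l)) \<longlonglongrightarrow> v" "\<And>l. v \<le> f (z l)" by (rule value_converges) blast
  from box_Lojasiewicz[OF polyfun_f GDERIV_f polyfun_D] obtain \<delta> \<epsilon> where "\<delta> > 0" "\<epsilon> > 0"
    and Lojasiewicz: "\<And>x. x \<in> cbox a b \<Longrightarrow> v < f x \<Longrightarrow> f x < v + \<epsilon> \<Longrightarrow>
      (f x - v) powr (2 - \<delta>) \<le> box_gradient_sq a b x (D x)" by blast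
  define M where "M = (norm (b - a))\<^sup>2 * K\<^sup>2 + 1"
  have "M > 0" unfolding M_def by (intro add_nonneg_pos) auto
  show ?thesis
  proof (rule Lojasiewicz_descent_summable
      [where r = "\<lambda>l. f (z l) - v" and \<delta> = "min \<delta> 2" and \<epsilon> = "min \<epsilon> 1"])
    show "(\<lambda>l. f (z l) - v) \<longlonglongrightarrow> 0" using v(1) by (simp add: LIM_zero)
    fix l assume small: "0 < f (z (Suc l)) - v" "f (z (Suc l)) - v < min \<epsilon> 1"
    have "(f (z (Suc l)) - v) powr (2 - min \<delta> 2) \<le> (f (z (Suc l)) - v) powr (2 - \<delta>)"
      using small by (intro powr_mono') auto
    also have "\<dots> \<le> box_gradient_sq a b (z (Suc l)) (D (z (Suc l)))"
      using small by (intro Lojasiewicz in_box) auto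
    also have "\<dots> \<le> (norm (b - a))\<^sup>2 * (K * d l)\<^sup>2" by (rule box_gradient_sq_le_step)
    also have "\<dots> \<le> M * (d l)\<^sup>2" by (simp add: M_def power_mult_distrib algebra_simps)
    finally show "(f (z (Suc l)) - v) powr (2 - min \<delta> 2) \<le> M * (d l)\<^sup>2" .
  qed (use v step_nonneg \<kappa>_pos descent \<open>M > 0\<close> \<open>\<delta> > 0\<close> \<open>\<epsilon> > 0\<close> in auto)
qed

theorem converges_to_critical_point:
  "\<exists>x\<in>cbox a b. z \<longlonglongrightarrow> x \<and> (\<exists>G. GDERIV f x :> G \<and> - G \<in> normal_cone (cbox a b) x)"
proof -
  obtain x where x: "z \<longlonglongrightarrow> x"
    using summable_steps_converge[OF summable_steps step_le] by (auto simp: convergent_def)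
  obtain G where G: "\<And>l. - G l \<in> normal_cone (cbox a b) (z (Suc l))"
    "\<And>l. norm (D (z (Suc l)) - G l) \<le> K * d l" using relative_error by metis
  have "(\<lambda>l. K * d l) \<longlonglongrightarrow> 0"
    using tendsto_mult_left[OF summable_LIMSEQ_zero[OF summable_steps], of K] by simp
  then have "(\<lambda>l. D (z (Suc l)) - G l) \<longlonglongrightarrow> 0"
    by (rule Lim_null_comparison[rotated]) (use G(2) in auto)
  moreover have "(\<lambda>l. D (z (Suc l))) \<longlonglongrightarrow> D x"
    by (intro vec_tendstoI tendsto_polyfun[OF polyfun_D] LIMSEQ_Suc x)
  ultimately have "(\<lambda>l. D (z (Suc l)) - (D (z (Suc l)) - G l)) \<longlonglongrightarrow> D x - 0" by (intro tendsto_diff)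
  then have "(\<lambda>l. - G l) \<longlonglongrightarrow> - D x" by (intro tendsto_minus) simp
  from normal_cone_limit[OF closed_cbox LIMSEQ_Suc[OF x] this G(1)]
  have "- D x \<in> normal_cone (cbox a b) x" .
  moreover from this have "x \<in> cbox a b" by (simp add: normal_cone_def)
  ultimately show ?thesis using x GDERIV_f by blast
qed

end

section \<open>Projected block steps\<close>

definition projected_step :: "'a::euclidean_space set \<Rightarrow> real \<Rightarrow> 'a \<Rightarrow> 'a \<Rightarrow> 'a" where
  "projected_step Z c w D = closest_point Z (w - (1 / c) *\<^sub>R D)"

definition sufficient_decrease ::
    "('a::real_inner \<Rightarrow> real) \<Rightarrow> real \<Rightarrow> real \<Rightarrow> 'a \<Rightarrow> 'a \<Rightarrow> 'a \<Rightarrow> bool" where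
  "sufficient_decrease f \<alpha> c w D u \<longleftrightarrow>
    f u + \<alpha> / 2 * (norm (u - w))\<^sup>2 \<le> f w + D \<bullet> (u - w) + c / 2 * (norm (u - w))\<^sup>2"

definition block_gradient :: "('n::finite \<Rightarrow> nat) \<Rightarrow> nat \<Rightarrow> real^'n \<Rightarrow> real^'n" where
  "block_gradient blk i G = (\<chi> j. if blk j = i then G $ j else 0)"

lemma projected_step_normal_cone:
  assumes "closed Z" "convex Z" "Z \<noteq> {}" "c > 0"
  shows "- (c *\<^sub>R (projected_step Z c w D - w) + D) \<in> normal_cone Z (projected_step Z c w D)"
proof -
  let ?p = "projected_step Z c w D"
  have "(w - (1 / c) *\<^sub>R D - ?p) \<bullet> (y - ?p) \<le> 0" if "y \<in> Z" for y
    unfolding projected_step_def by (rule closest_point_dot[OF assms(2,1) that])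
  moreover have "- (c *\<^sub>R (?p - w) + D) = c *\<^sub>R (w - (1 / c) *\<^sub>R D - ?p)"
    using assms(4) by (simp add: algebra_simps)
  moreover have "?p \<in> Z" unfolding projected_step_def by (rule closest_point_in_set[OF assms(1,3)])
  ultimately show ?thesis
    using assms(4) by (auto simp: normal_cone_def mult_le_0_iff)
qed

lemma sufficient_decrease_projected_step:
  assumes Z: "closed Z" "convex Z" "w \<in> Z" and "c > 0"
    and decrease: "sufficient_decrease f \<alpha> c w D (projected_step Z c w D)"
  shows "f (projected_step Z c w D) + \<alpha> / 2 * (norm (projected_step Z c w D - w))\<^sup>2 \<le> f w"
proof -
  let ?p = "projected_step Z c w D"
  have "- (c *\<^sub>R (?p - w) + D) \<bullet> (w - ?p) \<le> 0"
    using projected_step_normal_cone[OF Z(1,2) _ \<open>c > 0\<close>, of w D] Z(3)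
    by (auto simp: normal_cone_def)
  then have "D \<bullet> (?p - w) + c * (norm (?p - w))\<^sup>2 \<le> 0"
    by (simp add: power2_norm_eq_inner inner_diff_left inner_diff_right inner_commute algebra_simps)
  moreover have "0 \<le> c / 2 * (norm (?p - w))\<^sup>2" using \<open>c > 0\<close> by simp
  ultimately show ?thesis using decrease by (simp add: sufficient_decrease_def)
qed

lemma backtracking_constant_le:
  fixes \<beta> :: real
  assumes "\<beta> > 0" "\<And>c. M \<le> c \<Longrightarrow> ok c" "\<And>k'. k' < k \<Longrightarrow> \<not> ok (\<beta> ^ k' * c0)"
  shows "\<beta> ^ k * c0 \<le> max c0 (\<beta> * M)"
proof (cases k)
  case (Suc k')
  then have "\<not> M \<le> \<beta> ^ k' * c0" using assms(2,3) by blast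
  then have "\<beta> * (\<beta> ^ k' * c0) \<le> \<beta> * M" using assms(1) by (intro mult_left_mono) auto
  then show ?thesis by (simp add: Suc mult.assoc)
qed simp

lemma GDERIV_upd_blk:
  fixes f :: "real^'n \<Rightarrow> real"
  assumes "GDERIV f w :> G"
  shows "GDERIV (\<lambda>x. f (upd_blk blk i w x)) w :> block_gradient blk i G"
proof -
  define \<phi> where "\<phi> j t = (if blk j = i then t else w $ j)" for j and t :: real
  have "(\<phi> j has_real_derivative (if blk j = i then 1 else 0)) (at t)" for j t
    unfolding \<phi>_def[abs_def] by (cases "blk j = i") simp_all
  moreover have "upd_blk blk i w x = (\<chi> j. \<phi> j (x $ j))" for x
    by (simp add: upd_blk_def \<phi>_def)
  moreover have "(\<chi> j. \<phi> j (w $ j)) = w" by (simp add: \<phi>_def vec_eq_iff)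
  ultimately have "GDERIV (\<lambda>x. f (upd_blk blk i w x)) w :>
      (\<chi> j. (if blk j = i then 1 else 0) * G $ j)"
    using GDERIV_coordinatewise[where \<phi> = \<phi> and x = w and f = f] assms by simp
  moreover have "(\<chi> j. (if blk j = i then 1 else 0) * G $ j) = block_gradient blk i G"
    by (simp add: block_gradient_def vec_eq_iff)
  ultimately show ?thesis by simp
qed

lemma GDERIV_unique:
  assumes "GDERIV f x :> D" "GDERIV f x :> E"
  shows "D = E"
proof -
  have "(\<lambda>h. h \<bullet> D) = (\<lambda>h. h \<bullet> E)"
    using has_derivative_unique[OF assms[unfolded gderiv_def]] .
  then have "(D - E) \<bullet> D = (D - E) \<bullet> E" by metis
  then have "(D - E) \<bullet> (D - E) = 0" by (simp add: inner_diff_right)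
  then show ?thesis by simp
qed

lemma projected_step_unchanged:
  fixes a b :: "real^'n"
  assumes w: "w \<in> cbox a b" and "c > 0" and "D $ j = 0"
  shows "projected_step (cbox a b) c w D $ j = w $ j"
proof -
  let ?p = "projected_step (cbox a b) c w D"
  have "- (c *\<^sub>R (?p - w) + D) \<in> normal_cone (cbox a b) ?p"
    by (rule projected_step_normal_cone) (use w \<open>c > 0\<close> in auto)
  moreover have "w $ j \<in> {a $ j..b $ j}" using w by (auto simp: mem_box_cart)
  ultimately have "(- (c *\<^sub>R (?p - w) + D)) $ j * (w $ j - ?p $ j) \<le> 0"
    unfolding normal_cone_cbox_iff by blast
  then have "- (c * (?p $ j - w $ j)) * (w $ j - ?p $ j) \<le> 0" by (simp add: assms(3))
  then have "c * (w $ j - ?p $ j)\<^sup>2 \<le> 0" by (simp add: power2_eq_square algebra_simps)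
  then show ?thesis using \<open>c > 0\<close> by (simp add: mult_le_0_iff)
qed

lemma block_stepE:
  fixes f :: "real^'n \<Rightarrow> real"
  assumes step: "block_step f (cbox a b) blk \<alpha> \<beta> c0 i w w'" and G: "GDERIV f w :> G"
    and w: "w \<in> cbox a b" and pos: "\<beta> > 0" "c0 > 0"
  obtains k where "w' = projected_step (cbox a b) (\<beta> ^ k * c0) w (block_gradient blk i G)"
    "sufficient_decrease f \<alpha> (\<beta> ^ k * c0) w (block_gradient blk i G) w'"
    "\<And>k'. k' < k \<Longrightarrow> \<not> sufficient_decrease f \<alpha> (\<beta> ^ k' * c0) w (block_gradient blk i G)
      (projected_step (cbox a b) (\<beta> ^ k' * c0) w (block_gradient blk i G))"
proof -
  let ?D = "block_gradient blk i G" and ?Z = "cbox a b"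
  have update: "upd_blk blk i w (closest_point ?Z (w - (1 / c) *\<^sub>R ?D)) = projected_step ?Z c w ?D"
    if "c > 0" for c
    using projected_step_unchanged[OF w that, of ?D]
    by (auto simp: upd_blk_def vec_eq_iff projected_step_def block_gradient_def)
  have c_pos: "\<beta> ^ k * c0 > 0" for k using pos by simp
  obtain D where D: "GDERIV (\<lambda>x. f (upd_blk blk i w x)) w :> D" and
    "let cand = (\<lambda>c. upd_blk blk i w (closest_point ?Z (w - (1 / c) *\<^sub>R D)));
         ok = (\<lambda>c. f (cand c) + \<alpha> / 2 * (norm (cand c - w))\<^sup>2
                \<le> f w + D \<bullet> (cand c - w) + c / 2 * (norm (cand c - w))\<^sup>2)
     in \<exists>k. ok (\<beta> ^ k * c0) \<and> (\<forall>k'<k. \<not> ok (\<beta> ^ k' * c0)) \<and> w' = cand (\<beta> ^ k * c0)"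
    using step unfolding block_step_def by blast
  moreover have "D = ?D" by (rule GDERIV_unique[OF D GDERIV_upd_blk[OF G]])
  ultimately obtain k where "w' = projected_step ?Z (\<beta> ^ k * c0) w ?D"
    "sufficient_decrease f \<alpha> (\<beta> ^ k * c0) w ?D (projected_step ?Z (\<beta> ^ k * c0) w ?D)"
    "\<And>k'. k' < k \<Longrightarrow>
      \<not> sufficient_decrease f \<alpha> (\<beta> ^ k' * c0) w ?D (projected_step ?Z (\<beta> ^ k' * c0) w ?D)"
    unfolding Let_def sufficient_decrease_def by (auto simp: update c_pos)
  then show thesis by (intro that) auto
qed

locale lipschitz_gradient_on_box =
  fixes f :: "real^'n \<Rightarrow> real" and D :: "real^'n \<Rightarrow> real^'n" and a b :: "real^'n" and L :: real
  assumes gradient: "GDERIV f x :> D x" and lipschitz: "L-lipschitz_on (cbox a b) D"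
begin

lemma sufficient_decrease_of_large_constant:
  assumes w: "w \<in> cbox a b" and "c > 0" and c: "2 * L + \<alpha> \<le> c"
  shows "sufficient_decrease f \<alpha> c w (block_gradient blk i (D w))
    (projected_step (cbox a b) c w (block_gradient blk i (D w)))"
proof -
  define p where "p = projected_step (cbox a b) c w (block_gradient blk i (D w))"
  have "p \<in> cbox a b"
    unfolding p_def projected_step_def using w by (intro closest_point_in_set) auto
  then have "f p \<le> f w + D w \<bullet> (p - w) + L * (norm (p - w))\<^sup>2"
    by (intro GDERIV_lipschitz_descent[OF gradient lipschitz convex_box(1) w])
  moreover have "block_gradient blk i (D w) \<bullet> (p - w) = D w \<bullet> (p - w)"
    unfolding inner_vec_def p_def
    by (rule sum.cong)
      (use projected_step_unchanged[OF w \<open>c > 0\<close>] in \<open>auto simp: block_gradient_def\<close>)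
  moreover have "(L + \<alpha> / 2) * (norm (p - w))\<^sup>2 \<le> c / 2 * (norm (p - w))\<^sup>2"
    using c by (intro mult_right_mono) auto
  ultimately show ?thesis
    unfolding p_def[symmetric] by (simp add: sufficient_decrease_def distrib_right)
qed

lemma block_step_properties:
  assumes pos: "\<alpha> > 0" "\<beta> > 1" "c0 > 0" and w: "w \<in> cbox a b"
    and step: "block_step f (cbox a b) blk \<alpha> \<beta> c0 i w w'"
  shows "w' \<in> cbox a b" and "\<And>j. blk j \<noteq> i \<Longrightarrow> w' $ j = w $ j"
    and "f w' + \<alpha> / 2 * (norm (w' - w))\<^sup>2 \<le> f w"
    and "\<exists>c>0. c \<le> max c0 (\<beta> * (2 * L + \<alpha>)) \<and>
      - (c *\<^sub>R (w' - w) + block_gradient blk i (D w)) \<in> normal_cone (cbox a b) w'"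
proof -
  let ?Z = "cbox a b" and ?D = "block_gradient blk i (D w)"
  have Z: "closed ?Z" "convex ?Z" "?Z \<noteq> {}" using w by auto
  obtain k where w': "w' = projected_step ?Z (\<beta> ^ k * c0) w ?D"
    and decrease: "sufficient_decrease f \<alpha> (\<beta> ^ k * c0) w ?D w'"
    and minimal: "\<And>k'. k' < k \<Longrightarrow>
      \<not> sufficient_decrease f \<alpha> (\<beta> ^ k' * c0) w ?D (projected_step ?Z (\<beta> ^ k' * c0) w ?D)"
    using block_stepE[OF step gradient w _ pos(3)] pos(2) by auto
  have c_pos: "\<beta> ^ k * c0 > 0" for k using pos by simp
  show "w' \<in> ?Z" unfolding w' projected_step_def by (rule closest_point_in_set[OF Z(1,3)])
  show "w' $ j = w $ j" if "blk j \<noteq> i" for j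
    unfolding w' by (rule projected_step_unchanged[OF w c_pos]) (simp add: block_gradient_def that)
  show "f w' + \<alpha> / 2 * (norm (w' - w))\<^sup>2 \<le> f w"
    unfolding w'
    by (rule sufficient_decrease_projected_step[OF Z(1,2) w c_pos decrease[unfolded w']])
  have "L \<ge> 0" using lipschitz by (rule lipschitz_on_nonneg)
  have "\<beta> ^ k * c0 \<le> max c0 (\<beta> * (2 * L + \<alpha>))"
  proof (rule backtracking_constant_le)
    show "sufficient_decrease f \<alpha> c w ?D (projected_step ?Z c w ?D)" if "2 * L + \<alpha> \<le> c" for c
      by (rule sufficient_decrease_of_large_constant[OF w _ that])
        (use that pos \<open>L \<ge> 0\<close> in linarith)
  qed (use minimal pos in auto)
  moreover have "- ((\<beta> ^ k * c0) *\<^sub>R (w' - w) + ?D) \<in> normal_cone ?Z w'"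
    unfolding w' by (rule projected_step_normal_cone[OF Z c_pos])
  ultimately show "\<exists>c>0. c \<le> max c0 (\<beta> * (2 * L + \<alpha>)) \<and>
      - (c *\<^sub>R (w' - w) + ?D) \<in> normal_cone ?Z w'" using c_pos by blast
qed

end

section \<open>Convergence of the sweeps\<close>

definition path_length :: "(nat \<Rightarrow> 'a::real_normed_vector) \<Rightarrow> nat \<Rightarrow> real" where
  "path_length w n = (\<Sum>k<n. norm (w (Suc k) - w k))"

lemma norm_diff_le_path_length:
  assumes "i \<le> n"
  shows "norm (w n - w i) \<le> path_length w n"
proof -
  have "norm (w n - w i) = norm (\<Sum>k\<in>{i..<n}. w (Suc k) - w k)"
    using assms by (simp add: sum_Suc_diff')
  also have "\<dots> \<le> (\<Sum>k\<in>{i..<n}. norm (w (Suc k) - w k))" by (rule norm_sum)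
  also have "\<dots> \<le> path_length w n" unfolding path_length_def by (rule sum_mono2) auto
  finally show ?thesis .
qed

lemma norm_step_le_path_length: "i < n \<Longrightarrow> norm (w (Suc i) - w i) \<le> path_length w n"
  unfolding path_length_def by (rule member_le_sum) auto

lemma path_length_sq_le:
  assumes "\<kappa> \<ge> 0" "\<And>i. i < n \<Longrightarrow> \<kappa> * (norm (w (Suc i) - w i))\<^sup>2 \<le> g (w i) - g (w (Suc i))"
  shows "\<kappa> * (path_length w n)\<^sup>2 \<le> real n * (g (w 0) - g (w n))"
proof -
  have "\<kappa> * (path_length w n)\<^sup>2 \<le> \<kappa> * (real n * (\<Sum>i<n. (norm (w (Suc i) - w i))\<^sup>2))"
    using sum_squared_le_sum_of_squares[of "\<lambda>i. norm (w (Suc i) - w i)" "{..<n}"] assms(1)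
    by (intro mult_left_mono) (simp_all add: path_length_def mult.commute)
  also have "\<dots> = real n * (\<Sum>i<n. \<kappa> * (norm (w (Suc i) - w i))\<^sup>2)"
    by (simp add: sum_distrib_left mult.left_commute)
  also have "\<dots> \<le> real n * (\<Sum>i<n. g (w i) - g (w (Suc i)))"
    using assms(2) by (intro mult_left_mono sum_mono) auto
  also have "(\<Sum>i<n. g (w i) - g (w (Suc i))) = g (w 0) - g (w n)"
    by (rule sum_lessThan_telescope')
  finally show ?thesis .
qed

locale sweep_iterates = lipschitz_gradient_on_box f D a b L
  for f :: "real^'n \<Rightarrow> real" and D a b L +
  fixes blk :: "'n \<Rightarrow> nat" and P :: nat and \<alpha> c0 :: "nat \<Rightarrow> real" and \<beta> \<alpha>\<^sub>0 C :: real
    and w :: "nat \<Rightarrow> real^'n"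
  assumes blk_less: "blk j < P" and \<alpha>\<^sub>0_pos: "\<alpha>\<^sub>0 > 0" and \<alpha>_ge: "i < P \<Longrightarrow> \<alpha>\<^sub>0 \<le> \<alpha> i"
    and \<beta>_gt: "\<beta> > 1" and c0_pos: "i < P \<Longrightarrow> c0 i > 0"
    and constant_le: "i < P \<Longrightarrow> max (c0 i) (\<beta> * (2 * L + \<alpha> i)) \<le> C"
    and start: "w 0 \<in> cbox a b"
    and step: "i < P \<Longrightarrow> block_step f (cbox a b) blk (\<alpha> i) \<beta> (c0 i) i (w i) (w (Suc i))"
begin

lemma \<alpha>_pos: "i < P \<Longrightarrow> \<alpha> i > 0"
  using \<alpha>_ge \<alpha>\<^sub>0_pos by (rule less_le_trans[rotated])

lemma iterate_in_box: "i \<le> P \<Longrightarrow> w i \<in> cbox a b"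
proof (induction i)
  case (Suc i)
  then show ?case
    using block_step_properties(1)[OF \<alpha>_pos \<beta>_gt c0_pos _ step] by simp
qed (rule start)

lemma step_properties:
  assumes "i < P"
  shows "\<And>j. blk j \<noteq> i \<Longrightarrow> w (Suc i) $ j = w i $ j"
    and "f (w (Suc i)) + \<alpha> i / 2 * (norm (w (Suc i) - w i))\<^sup>2 \<le> f (w i)"
    and "\<exists>c>0. c \<le> C \<and> - (c *\<^sub>R (w (Suc i) - w i) + block_gradient blk i (D (w i)))
      \<in> normal_cone (cbox a b) (w (Suc i))"
  using block_step_properties(2-4)[OF \<alpha>_pos \<beta>_gt c0_pos iterate_in_box step, of i]
    assms constant_le[of i]
  by (auto intro: order_trans)

lemma sweep_descent: "\<alpha>\<^sub>0 / 2 * (path_length w P)\<^sup>2 \<le> real P * (f (w 0) - f (w P))"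
proof (rule path_length_sq_le)
  fix i assume i: "i < P"
  have "\<alpha>\<^sub>0 / 2 * (norm (w (Suc i) - w i))\<^sup>2 \<le> \<alpha> i / 2 * (norm (w (Suc i) - w i))\<^sup>2"
    using \<alpha>_ge[OF i] by (intro mult_right_mono) auto
  with step_properties(2)[OF i]
  show "\<alpha>\<^sub>0 / 2 * (norm (w (Suc i) - w i))\<^sup>2 \<le> f (w i) - f (w (Suc i))" by linarith
qed (use \<alpha>\<^sub>0_pos in simp)

lemma last_iterate_nth: "w P $ j = w (Suc (blk j)) $ j"
proof -
  have "w k $ j = w (Suc (blk j)) $ j" if "Suc (blk j) \<le> k" "k \<le> P" for k
    using that
  proof (induction k rule: dec_induct)
    case (step k)
    then show ?case using step_properties(1)[of k j] by simp
  qed simp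
  then show ?thesis using blk_less[of j] Suc_leI by blast
qed

lemma coordinate_relative_error:
  obtains g where "\<bar>D (w P) $ j - g\<bar> \<le> (C + L) * path_length w P"
    "\<And>t. t \<in> {a $ j..b $ j} \<Longrightarrow> 0 \<le> g * (t - w P $ j)"
proof -
  define i where "i = blk j"
  have i: "i < P" using blk_less by (simp add: i_def)
  obtain c where c: "c > 0" "c \<le> C"
    and normal: "- (c *\<^sub>R (w (Suc i) - w i) + block_gradient blk i (D (w i)))
      \<in> normal_cone (cbox a b) (w (Suc i))" using step_properties(3)[OF i] by blast
  let ?v = "- (c *\<^sub>R (w (Suc i) - w i) + block_gradient blk i (D (w i)))"
  define g where "g = c * (w (Suc i) $ j - w i $ j) + D (w i) $ j"
  have "0 \<le> g * (t - w P $ j)" if "t \<in> {a $ j..b $ j}" for t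
  proof -
    have "?v $ j * (t - w (Suc i) $ j) \<le> 0"
      using normal that unfolding normal_cone_cbox_iff by blast
    moreover have "?v $ j = - g"
      by (simp add: g_def block_gradient_def i_def)
    ultimately show ?thesis by (simp add: last_iterate_nth[of j] flip: i_def)
  qed
  moreover have "\<bar>D (w P) $ j - g\<bar> \<le> (C + L) * path_length w P"
  proof -
    have "\<bar>D (w P) $ j - D (w i) $ j\<bar> \<le> norm (D (w P) - D (w i))"
      using component_le_norm_cart[of "D (w P) - D (w i)" j] by simp
    also have "\<dots> \<le> L * norm (w P - w i)"
      using i by (intro lipschitz_on_normD[OF lipschitz] iterate_in_box) auto
    also have "\<dots> \<le> L * path_length w P"
      using i
      by (intro mult_left_mono norm_diff_le_path_length lipschitz_on_nonneg[OF lipschitz]) auto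
    finally have "\<bar>D (w P) $ j - D (w i) $ j\<bar> \<le> L * path_length w P" .
    moreover have "\<bar>c * (w (Suc i) $ j - w i $ j)\<bar> \<le> C * path_length w P"
      using c component_le_norm_cart[of "w (Suc i) - w i" j] norm_step_le_path_length[OF i, of w]
      by (auto simp: abs_mult intro!: mult_mono)
    ultimately show ?thesis by (simp add: g_def distrib_right)
  qed
  ultimately show thesis using that by blast
qed

lemma sweep_relative_error:
  "\<exists>G. - G \<in> normal_cone (cbox a b) (w P) \<and>
    norm (D (w P) - G) \<le> real CARD('n) * (C + L) * path_length w P"
proof -
  have "\<forall>j. \<exists>g. \<bar>D (w P) $ j - g\<bar> \<le> (C + L) * path_length w P \<and>
      (\<forall>t\<in>{a $ j..b $ j}. 0 \<le> g * (t - w P $ j))"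
    using coordinate_relative_error by metis
  then obtain g where g: "\<And>j. \<bar>D (w P) $ j - g j\<bar> \<le> (C + L) * path_length w P"
    "\<And>j t. t \<in> {a $ j..b $ j} \<Longrightarrow> 0 \<le> g j * (t - w P $ j)" by metis
  define G where "G = (\<chi> j. g j)"
  have "- G \<in> normal_cone (cbox a b) (w P)"
    using g(2) iterate_in_box[of P] by (simp add: normal_cone_cbox_iff G_def)
  moreover have "norm (D (w P) - G) \<le> (\<Sum>j\<in>UNIV. \<bar>(D (w P) - G) $ j\<bar>)" by (rule norm_le_l1_cart)
  moreover have "\<dots> \<le> (\<Sum>j\<in>(UNIV::'n set). (C + L) * path_length w P)"
    using g(1) by (intro sum_mono) (simp add: G_def)
  ultimately show ?thesis by (intro exI[of _ G]) (simp add: mult.assoc)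
qed

end

lemma (in lipschitz_gradient_on_box) primal_sweep_bounds:
  assumes blk: "\<And>j. blk j < P" and \<alpha>: "\<And>i. i < P \<Longrightarrow> \<alpha> i > 0"
    and \<beta>: "\<beta> > 1" and c0: "\<And>i. i < P \<Longrightarrow> c0 i > 0"
  shows "\<exists>\<kappa>>0. \<exists>K. \<forall>z\<in>cbox a b. \<forall>z'. primal_sweep f (cbox a b) blk P \<alpha> \<beta> c0 z z' \<longrightarrow>
    z' \<in> cbox a b \<and> (\<exists>d. norm (z' - z) \<le> d \<and> \<kappa> * d\<^sup>2 \<le> f z - f z' \<and>
      (\<exists>G. - G \<in> normal_cone (cbox a b) z' \<and> norm (D z' - G) \<le> K * d))"
proof -
  have "P > 0" using blk[of undefined] by simp
  obtain \<alpha>\<^sub>0 where \<alpha>\<^sub>0: "\<alpha>\<^sub>0 > 0" "\<And>i. i \<in> {..<P} \<Longrightarrow> \<alpha>\<^sub>0 \<le> \<alpha> i"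
    using \<alpha> by (auto intro: finite_positive_lower_bound[of "{..<P}" \<alpha>])
  define C where "C = Max ((\<lambda>i. max (c0 i) (\<beta> * (2 * L + \<alpha> i))) ` {..<P})"
  have C: "max (c0 i) (\<beta> * (2 * L + \<alpha> i)) \<le> C" if "i < P" for i
    unfolding C_def using that by (intro Max_ge) auto
  have "z' \<in> cbox a b \<and> (\<exists>d. norm (z' - z) \<le> d \<and> \<alpha>\<^sub>0 / (2 * real P) * d\<^sup>2 \<le> f z - f z' \<and>
      (\<exists>G. - G \<in> normal_cone (cbox a b) z' \<and> norm (D z' - G) \<le> real CARD('n) * (C + L) * d))"
    if z: "z \<in> cbox a b" and sweep: "primal_sweep f (cbox a b) blk P \<alpha> \<beta> c0 z z'" for z z'
  proof -
    obtain w where w: "w 0 = z" "w P = z'"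
      "\<And>i. i < P \<Longrightarrow> block_step f (cbox a b) blk (\<alpha> i) \<beta> (c0 i) i (w i) (w (Suc i))"
      using sweep unfolding primal_sweep_def by metis
    interpret sweep_iterates f D a b L blk P \<alpha> c0 \<beta> \<alpha>\<^sub>0 C w
      by unfold_locales (use z w blk \<alpha>\<^sub>0 \<beta> c0 C in auto)
    have "norm (z' - z) \<le> path_length w P"
      using norm_diff_le_path_length[of 0 P w] by (simp add: w)
    moreover have "\<alpha>\<^sub>0 / (2 * real P) * (path_length w P)\<^sup>2 \<le> f z - f z'"
      using sweep_descent \<open>P > 0\<close> by (simp add: w field_simps)
    ultimately show ?thesis
      using iterate_in_box[of P] sweep_relative_error unfolding w(2) by blast
  qed
  moreover have "\<alpha>\<^sub>0 / (2 * real P) > 0" using \<alpha>\<^sub>0(1) \<open>P > 0\<close> by simp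
  ultimately show ?thesis by blast
qed

theorem polynomial_sweeps_converge:
  fixes f :: "real^'n \<Rightarrow> real" and blk :: "'n \<Rightarrow> nat"
  assumes f: "polyfun f" and blk: "\<And>j. blk j < P"
    and \<alpha>: "\<And>i. i < P \<Longrightarrow> \<alpha> i > 0" and \<beta>: "\<beta> > 1" and c0: "\<And>i. i < P \<Longrightarrow> c0 i > 0"
    and z0: "z 0 \<in> cbox a b"
    and sweep: "\<And>l. primal_sweep f (cbox a b) blk P \<alpha> \<beta> c0 (z l) (z (Suc l))"
  shows "\<exists>x\<in>cbox a b. z \<longlonglongrightarrow> x \<and> (\<exists>G. GDERIV f x :> G \<and> - G \<in> normal_cone (cbox a b) x)"
proof -
  obtain D where D: "\<And>x. GDERIV f x :> D x" "\<And>j. polyfun (\<lambda>x. D x $ j)"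
    using polyfun_GDERIV[OF f] by blast
  obtain L where "L-lipschitz_on (cbox a b) D"
    using polyfun_vec_lipschitz_on_bounded[OF D(2) bounded_cbox] by blast
  with D(1) interpret lipschitz_gradient_on_box f D a b L by unfold_locales
  from primal_sweep_bounds[of blk P \<alpha> \<beta> c0, OF blk \<alpha> \<beta> c0] obtain \<kappa> K where "\<kappa> > 0"
    and bounds: "\<And>l. z l \<in> cbox a b \<Longrightarrow> z (Suc l) \<in> cbox a b \<and>
      (\<exists>d. norm (z (Suc l) - z l) \<le> d \<and> \<kappa> * d\<^sup>2 \<le> f (z l) - f (z (Suc l)) \<and>
      (\<exists>G. - G \<in> normal_cone (cbox a b) (z (Suc l)) \<and> norm (D (z (Suc l)) - G) \<le> K * d))"
    using sweep by blast
  have in_box: "z l \<in> cbox a b" for l by (induction l) (use z0 bounds in auto)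
  obtain d where d: "\<And>l. norm (z (Suc l) - z l) \<le> d l" "\<And>l. \<kappa> * (d l)\<^sup>2 \<le> f (z l) - f (z (Suc l))"
    "\<And>l. \<exists>G. - G \<in> normal_cone (cbox a b) (z (Suc l)) \<and> norm (D (z (Suc l)) - G) \<le> K * d l"
    using bounds[OF in_box] by metis
  interpret box_descent_sequence f D a b z d \<kappa> K
    by unfold_locales (use f D in_box \<open>\<kappa> > 0\<close> d in auto)
  show ?thesis by (rule converges_to_critical_point)
qed

lemma polyfun_aug_lag:
  assumes "\<forall>i<P. polyfun (J i)" "\<forall>k<m. polyfun (Q k)" "\<forall>i<P. \<forall>r<q i. polyfun (g i r)"
  shows "polyfun (aug_lag P m q J Q g T rho muQ mug s)"
  unfolding aug_lag_def[abs_def] using assms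
  by (intro polyfun_add polyfun_sum polyfun_mult polyfun_const) auto

theorem mainTheorem5:
  fixes P m :: nat and q :: "nat \<Rightarrow> nat" and blk :: "'n::finite \<Rightarrow> nat"
    and a b :: "real^'n"
    and J :: "nat \<Rightarrow> real^'n \<Rightarrow> real" and Q :: "nat \<Rightarrow> real^'n \<Rightarrow> real"
    and g :: "nat \<Rightarrow> nat \<Rightarrow> real^'n \<Rightarrow> real" and T :: "nat \<Rightarrow> nat \<Rightarrow> real^'p::finite"
    and S :: "(real^'p) set" and s :: "real^'p"
    and muQ :: "nat \<Rightarrow> real" and mug :: "nat \<Rightarrow> nat \<Rightarrow> real"
    and rho beta :: real and alpha c0 :: "nat \<Rightarrow> real"
    and z :: "nat \<Rightarrow> real^'n"
  assumes "P \<ge> 1" and "CARD('n) \<ge> 2"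
    and "\<forall>j. blk j < P"
    and "\<forall>j. a $ j \<le> b $ j"
    and "\<forall>i<P. poly_deg_ge2 (J i) \<and> dep_block blk i (J i)"
    and "\<forall>k<m. polyfun (Q k)"
    and "\<forall>i<P. \<forall>r<q i. polyfun (g i r) \<and> dep_block blk i (g i r)"
    and "s \<in> S" and "rho > 0"
    and "\<forall>i<P. alpha i > 0" and "beta > 1" and "\<forall>i<P. c0 i > 0"
    and "z 0 \<in> cbox a b"
    and "\<forall>l. primal_sweep (aug_lag P m q J Q g T rho muQ mug s) (cbox a b) blk P
                alpha beta c0 (z l) (z (Suc l))"
  shows "\<exists>zinf \<in> cbox a b. z \<longlonglongrightarrow> zinf \<and>
           (\<exists>D. GDERIV (aug_lag P m q J Q g T rho muQ mug s) zinf :> D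
                \<and> - D \<in> normal_cone (cbox a b) zinf)"
proof (rule polynomial_sweeps_converge
    [where blk = blk and P = P and \<alpha> = alpha and \<beta> = beta and ?c0.0 = c0])
  show "polyfun (aug_lag P m q J Q g T rho muQ mug s)"
    using assms(5-7) by (intro polyfun_aug_lag) (auto simp: poly_deg_ge2_def)
qed (use assms in auto)

end
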